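(* Let $X$ be an uncountable Polish space, let $1\le \xi<\omega_1$, let $f : X \to \mathbb{R}$ be a bounded Baire class $\xi$ function, and let $\lambda$ be an ordinal with $1 \le \lambda < \omega_1$. Then $f \in \mathscr{B}_\xi^\lambda$ if and only if $\operatorname{length}_\xi(f) \le \omega^\lambda$.
   Context: $\boldsymbol{\Sigma}^0_\xi$, $\boldsymbol{\Pi}^0_\xi$ denote the additive and multiplicative classes of the Borel hierarchy of $X$ ($\boldsymbol{\Sigma}^0_1$ = open sets, $\boldsymbol{\Pi}^0_1$ = closed sets). A function is of Baire class 1 if it is the pointwise limit of a sequence of continuous functions, and of Baire class $\xi$ ($1<\xi<\omega_1$) if it is the pointwise limit of a sequence of functions from smaller Baire classes; equivalently, $f$ is of Baire class $\xi$ iff $\{f<c\},\{f>c\}\in\boldsymbol{\Sigma}^0_{\xi+1}$ for all $c\in\mathbb{R}$. A function $g : X\to\mathbb{R}$ is semi-Borel class $\xi$ if $\{g<c\}\in\boldsymbol{\Sigma}^0_\xi$ for every $c\in\mathbb{R}$. An ordinal is even (odd) if it has the form $\mu + n$ with $\mu$ limit or $0$ and $n$ an even (odd) natural number; $(-1)^\theta$ is $1$ if $\theta$ is even and $-1$ if $\theta$ is odd. Separation by transfinite differences. Consider a decreasing sequence $(F_\eta)_{\eta<\mu}$ ($\mu<\omega_1$) of $\boldsymbol{\Pi}^0_\xi$ subsets of $X$ that is continuous (for every limit ordinal $\theta<\mu$, $F_\theta = \bigcap_{\eta<\theta}F_\eta$), with $F_0 = X$, and with $\bigcap_{\eta<\mu}F_\eta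 = \emptyset$ if $\mu$ is limit. Put $F_\eta=\emptyset$ for $\eta \ge \mu$. Sets $A, B \subseteq X$ can be separated by the transfinite difference of this sequence if $$A \subseteq \bigcup_{\eta<\mu,\ \eta \text{ even}} F_\eta\setminus F_{\eta+1} \subseteq X \setminus B .$$ $\alpha_\xi(A,B)$ is the least length $\mu$ of such a sequence if one exists, and $\omega_1$ otherwise. For a Baire class $\xi$ function $f$, $$\alpha_\xi(f) = \sup_{p<q,\ p,q\in\mathbb{Q}} \alpha_\xi(\{f\le p\},\{f\ge q\}).$$ $\mathscr{B}_\xi^\lambda$ is the set of bounded Baire class $\xi$ functions $f$ on $X$ with $\alpha_\xi(f)\le\omega^\lambda$. Alternating sums. $\mathrm{DUSB}_\xi$ is the set of transfinite (pointwise) decreasing sequences $(f_\eta)_{\eta<\mu}$, $\mu<\omega_1$, of non-negative bounded semi-Borel class $\xi$ functions on $X$ such that, if $\mu$ is limit, $f_\eta\to 0$ pointwise as $\eta\to\mu$. For such a sequence the alternating sum $\sum^*_{\eta<\theta}(-1)^\eta f_\eta$ ($\theta\le\mu$) is defined inductively: it is $0$ for $\theta=0$; $$\sum^*_{\eta<\theta+1}(-1)^\eta f_\eta = \sum^*_{\eta<\theta}(-1)^\eta f_\eta + (-1)^\theta f_\theta;$$ and for limit $\theta$, $$\sum^*_{\eta<\theta}(-1)^\eta f_\eta = \sup\Big\{\sum^*_{\eta<\zeta}(-1)^\eta f_\eta : \zeta<\theta,\ \zeta \text{ even}\Big\}$$ (pointwise supremum). $\operatorname{length}_\xi(f)$ is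 the least $\mu$ for which there exist $(f_\eta)_{\eta<\mu}\in\mathrm{DUSB}_\xi$ and $c\in\mathbb{R}$ with $f = c+\sum^*_{\eta<\mu}(-1)^\eta f_\eta$, and it is $\omega_1$ if no such $\mu$ exists. *)

theory Defs
  imports "HOL-Analysis.Analysis"
begin

section \<open>The ordinals up to and including the first uncountable one\<close>

text \<open>
  \<open>cardSuc natLeq\<close> is a well-order of type \<open>\<omega>\<^sub>1\<close>. Its initial segments, ordered by inclusion,
  form a well-order of type \<open>\<omega>\<^sub>1 + 1\<close>: the proper ones are the countable ordinals and
  the whole field, the top element, is \<open>\<omega>\<^sub>1\<close>.
\<close>

typedef ordinal = "{A. Order_Relation.ofilter (cardSuc natLeq) A}"
  by (auto simp: Order_Relation.ofilter_def)

setup_lifting type_definition_ordinal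

lemma Well_order_omega1: "Well_order (cardSuc natLeq)"
  using cardSuc_Card_order natLeq_Card_order Card_order_wo_rel wo_rel_def by blast

lemma wo_rel_omega1: "wo_rel (cardSuc natLeq)"
  using Well_order_omega1 by (simp add: wo_rel_def)

instantiation ordinal :: complete_lattice
begin

lift_definition less_eq_ordinal :: "ordinal \<Rightarrow> ordinal \<Rightarrow> bool" is "(\<subseteq>)" .
lift_definition less_ordinal :: "ordinal \<Rightarrow> ordinal \<Rightarrow> bool" is "(\<subset>)" .
lift_definition inf_ordinal :: "ordinal \<Rightarrow> ordinal \<Rightarrow> ordinal" is "(\<inter>)"
  by (auto simp: Order_Relation.ofilter_def)
lift_definition sup_ordinal :: "ordinal \<Rightarrow> ordinal \<Rightarrow> ordinal" is "(\<union>)"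
  by (auto simp: Order_Relation.ofilter_def)
lift_definition bot_ordinal :: ordinal is "{}"
  by (auto simp: Order_Relation.ofilter_def)
lift_definition top_ordinal :: ordinal is "Field (cardSuc natLeq)"
  using wo_rel.Field_ofilter[OF wo_rel_omega1] .
lift_definition Sup_ordinal :: "ordinal set \<Rightarrow> ordinal" is "\<Union>"
  unfolding Order_Relation.ofilter_def by blast
lift_definition Inf_ordinal :: "ordinal set \<Rightarrow> ordinal"
  is "\<lambda>S. Field (cardSuc natLeq) \<inter> \<Inter>S"
  unfolding Order_Relation.ofilter_def
  by (auto simp: Order_Relation.under_def Field_def)

instance
  by standard (transfer; auto simp: Order_Relation.ofilter_def; blast)+

end

instance ordinal :: complete_linorder
proof
  fix x y :: ordinal
  show "x \<le> y \<or> y \<le> x"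
    using wo_rel.ofilter_linord[OF wo_rel_omega1] Rep_ordinal[of x] Rep_ordinal[of y]
    by (simp add: less_eq_ordinal.rep_eq)
qed

instance ordinal :: wellorder
proof (rule wf_wellorderI)
  let ?r = "cardSuc natLeq"
  have "wf (inv_image (ofilterIncl ?r) Rep_ordinal)"
    by (intro wf_inv_image wf_ofilterIncl Well_order_omega1)
  then have *: "\<exists>z\<in>Q. \<forall>y. (y, z) \<in> inv_image (ofilterIncl ?r) Rep_ordinal \<longrightarrow> y \<notin> Q"
    if "x \<in> Q" for x :: ordinal and Q
    using that by (meson wf_eq_minimal)
  have less: "(y, z) \<in> inv_image (ofilterIncl ?r) Rep_ordinal"
    if "y < z" "z \<noteq> top" for y z
  proof -
    have "y \<noteq> top" using that by auto
    then show ?thesis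
      using that Rep_ordinal[of y] Rep_ordinal[of z]
      by (auto simp: ofilterIncl_def less_ordinal.rep_eq top_ordinal.rep_eq
          simp flip: Rep_ordinal_inject)
  qed
  show "wf {(x::ordinal, y). x < y}"
    unfolding wf_eq_minimal
  proof (intro allI impI)
    fix Q :: "ordinal set" and x assume x: "x \<in> Q"
    show "\<exists>z\<in>Q. \<forall>y. (y, z) \<in> {(x, y). x < y} \<longrightarrow> y \<notin> Q"
    proof (cases "Q \<subseteq> {top}")
      case True
      then show ?thesis using x by auto
    next
      case False
      then obtain w where "w \<in> Q - {top}" by auto
      from *[OF this] obtain z where z: "z \<in> Q" "z \<noteq> top"
        "\<And>y. (y, z) \<in> inv_image (ofilterIncl ?r) Rep_ordinal \<Longrightarrow> y \<notin> Q - {top}"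
        by auto
      then show ?thesis using less
        by (metis (no_types, lifting) Diff_iff case_prodD mem_Collect_eq not_top_less singletonD)
    qed
  qed
qed intro_classes

instantiation ordinal :: linorder_topology
begin

definition open_ordinal :: "ordinal set \<Rightarrow> bool" where
  "open_ordinal = generate_topology (range lessThan \<union> range greaterThan)"

instance
  by standard (simp add: open_ordinal_def)

end

abbreviation omega1 :: ordinal (\<open>\<omega>\<^sub>1\<close>) where
  "\<omega>\<^sub>1 \<equiv> top"

lemma ordinal_eq_underS:
  assumes "x < \<omega>\<^sub>1"
  obtains a where "a \<in> Field (cardSuc natLeq)" "Rep_ordinal x = underS (cardSuc natLeq) a"
proof -
  have "Rep_ordinal x \<noteq> Field (cardSuc natLeq)"
    using assms by (metis Rep_ordinal_inject less_irrefl top_ordinal.rep_eq)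
  then show ?thesis
    using that Rep_ordinal[of x] wo_rel.ofilter_underS_Field[OF wo_rel_omega1, of "Rep_ordinal x"]
    by auto
qed

unbundle cardinal_syntax

lemma countable_iff_natLeq: "countable A \<longleftrightarrow> |A| \<le>o natLeq"
proof -
  have "countable A \<longleftrightarrow> |A| \<le>o |UNIV :: nat set|"
    by (auto simp: countable_def simp flip: card_of_ordLeq)
  then show ?thesis
    using card_of_nat ordIso_symmetric ordLeq_ordIso_trans by blast
qed

lemma countable_lessThan_ordinal:
  assumes "x < \<omega>\<^sub>1"
  shows "countable {..<x}"
proof -
  let ?r = "cardSuc natLeq"
  obtain a where a: "a \<in> Field ?r" "Rep_ordinal x = underS ?r a"
    using ordinal_eq_underS[OF assms] .
  have "|underS ?r a| <o ?r"
    using a by (simp add: card_of_underS cardSuc_Card_order natLeq_Card_order)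
  then have "countable (underS ?r a)"
    using cardSuc_least[OF natLeq_Card_order card_of_Card_order] countable_iff_natLeq
    by (metis card_of_Well_order natLeq_Well_order not_ordLess_ordLeq ordLess_or_ordLeq)
  moreover have "{..<x} \<subseteq> (\<lambda>b. Abs_ordinal (underS ?r b)) ` underS ?r a"
  proof
    fix y assume "y \<in> {..<x}"
    then have y: "y < x" by simp
    obtain b where b: "b \<in> Field ?r" "Rep_ordinal y = underS ?r b"
      using ordinal_eq_underS[OF less_trans[OF y assms]] .
    have "underS ?r b \<subset> underS ?r a"
      using y a b by (simp add: less_ordinal.rep_eq)
    then have "(b, a) \<in> ?r" "b \<noteq> a"
      using a(1) b(1) wo_rel.LIN[OF wo_rel_omega1] by (auto simp: underS_incl_iff)
    then show "y \<in> (\<lambda>b. Abs_ordinal (underS ?r b)) ` underS ?r a"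
      using b by (metis (mono_tags, lifting) Rep_ordinal_inverse image_eqI mem_Collect_eq underS_def)
  qed
  ultimately show ?thesis
    by (meson countable_image countable_subset)
qed

lemma uncountable_lessThan_omega1: "uncountable {..<\<omega>\<^sub>1}"
proof
  let ?r = "cardSuc natLeq"
  let ?f = "\<lambda>b. Abs_ordinal (underS ?r b)"
  assume count: "countable {..<\<omega>\<^sub>1}"
  have rep: "Rep_ordinal (?f b) = underS ?r b" for b
    using wo_rel.underS_ofilter[OF wo_rel_omega1] by (simp add: Abs_ordinal_inverse)
  have "inj_on ?f (Field ?r)"
  proof (rule inj_onI)
    fix a b assume ab: "a \<in> Field ?r" "b \<in> Field ?r" "?f a = ?f b"
    then have "underS ?r a = underS ?r b" by (metis rep)
    then show "a = b"
      using ab wo_rel.suc_underS[OF wo_rel_omega1] by metis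
  qed
  moreover have "?f ` Field ?r \<subseteq> {..<\<omega>\<^sub>1}"
  proof (intro image_subsetI)
    fix b assume "b \<in> Field ?r"
    moreover have "b \<notin> underS ?r b" by (simp add: underS_def)
    ultimately have "?f b \<noteq> top" by (metis rep top_ordinal.rep_eq)
    then show "?f b \<in> {..<\<omega>\<^sub>1}" by (simp add: less_top)
  qed
  ultimately have "countable (Field ?r)"
    using count by (meson countable_image_inj_on countable_subset)
  then have "|Field ?r| \<le>o natLeq" by (simp add: countable_iff_natLeq)
  then have "?r \<le>o natLeq"
    using card_of_Field_ordIso cardSuc_Card_order natLeq_Card_order
      ordIso_ordLeq_trans ordIso_symmetric by blast
  then show False
    using cardSuc_greater natLeq_Card_order not_ordLess_ordLeq by blast
qed

unbundle no cardinal_syntax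

lemma Sup_less_omega1:
  assumes "countable S" "\<And>x. x \<in> S \<Longrightarrow> x < \<omega>\<^sub>1"
  shows "Sup S < \<omega>\<^sub>1"
proof (rule ccontr)
  assume "\<not> Sup S < \<omega>\<^sub>1"
  then have "Sup S = \<omega>\<^sub>1" using top.not_eq_extremum by blast
  have "{..<\<omega>\<^sub>1} \<subseteq> (\<Union>x\<in>S. {..<x})"
  proof
    fix y :: ordinal assume "y \<in> {..<\<omega>\<^sub>1}"
    then have "y < Sup S" by (metis \<open>Sup S = \<omega>\<^sub>1\<close> lessThan_iff)
    then show "y \<in> (\<Union>x\<in>S. {..<x})" by (simp add: less_Sup_iff)
  qed
  moreover have "countable (\<Union>x\<in>S. {..<x})"
    using assms countable_lessThan_ordinal by blast
  ultimately show False
    using uncountable_lessThan_omega1 countable_subset by blast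
qed

lemma SUP_less_omega1:
  assumes "y < \<omega>\<^sub>1" "\<And>z. z < y \<Longrightarrow> g z < \<omega>\<^sub>1"
  shows "(SUP z\<in>{..<y}. g z) < \<omega>\<^sub>1"
proof (rule Sup_less_omega1)
  show "countable (g ` {..<y})" using countable_lessThan_ordinal[OF assms(1)] by simp
qed (use assms(2) in auto)


section \<open>Ordinal arithmetic\<close>

text \<open>
  Since \<open>Inf {} = \<omega>\<^sub>1\<close>, the successor saturates at \<open>\<omega>\<^sub>1\<close>; below \<open>\<omega>\<^sub>1\<close> it is the true
  successor. The same applies to the arithmetic built from it.
\<close>

definition osuc :: "ordinal \<Rightarrow> ordinal" where
  "osuc x = Inf {y. x < y}"

instantiation ordinal :: "{zero, one}"
begin

definition zero_ordinal :: ordinal where "0 = (bot :: ordinal)"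

definition one_ordinal :: ordinal where "1 = osuc 0"

instance ..

end

text \<open>Meaningful for successors only, where it gives the predecessor.\<close>

definition opred :: "ordinal \<Rightarrow> ordinal" where
  "opred x = Sup {..<x}"

definition is_limit :: "ordinal \<Rightarrow> bool" where
  "is_limit x \<longleftrightarrow> x \<noteq> 0 \<and> (\<forall>y<x. osuc y < x)"

lemma less_osuc:
  assumes "x < \<omega>\<^sub>1"
  shows "x < osuc x"
proof -
  have *: "(LEAST y. x < y) > x" using assms by (rule LeastI)
  have "(LEAST y. x < y) \<le> osuc x"
    unfolding osuc_def by (rule Inf_greatest) (auto intro: Least_le)
  with * show ?thesis by simp
qed

lemma osuc_le_iff: "x < \<omega>\<^sub>1 \<Longrightarrow> osuc x \<le> y \<longleftrightarrow> x < y"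
  using less_osuc[of x] by (auto simp: osuc_def intro: Inf_lower)

lemma less_osuc_iff: "y < \<omega>\<^sub>1 \<Longrightarrow> x < osuc y \<longleftrightarrow> x \<le> y"
  using osuc_le_iff[of y x] by (meson not_le)

lemma osuc_less_omega1:
  assumes "x < \<omega>\<^sub>1"
  shows "osuc x < \<omega>\<^sub>1"
proof (rule ccontr)
  assume "\<not> osuc x < \<omega>\<^sub>1"
  then have eq: "osuc x = \<omega>\<^sub>1" using top.not_eq_extremum by blast
  have "{..<\<omega>\<^sub>1} \<subseteq> insert x {..<x}"
    unfolding eq[symmetric] using less_osuc_iff[OF assms] by (auto simp: le_less)
  then show False
    using uncountable_lessThan_omega1 countable_lessThan_ordinal[OF assms]
      countable_subset countable_insert by metis
qed

lemma zero_less_omega1: "0 < \<omega>\<^sub>1"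
proof -
  have "{..<\<omega>\<^sub>1} \<noteq> {}" using uncountable_lessThan_omega1 by force
  then have "\<omega>\<^sub>1 \<noteq> (bot :: ordinal)" by (simp add: Iio_eq_empty_iff)
  then show ?thesis by (simp add: zero_ordinal_def bot.not_eq_extremum)
qed

lemma opred_osuc [simp]:
  assumes "x < \<omega>\<^sub>1"
  shows "opred (osuc x) = x"
proof -
  have "{..<osuc x} = {..x}" using less_osuc_iff[OF assms] by auto
  then show ?thesis
    unfolding opred_def by (simp add: Sup_eqI)
qed

lemma not_limit_osuc [simp]: "x < \<omega>\<^sub>1 \<Longrightarrow> \<not> is_limit (osuc x)"
  using less_osuc[of x] by (auto simp: is_limit_def)

lemma not_limit_0 [simp]: "\<not> is_limit 0"
  by (simp add: is_limit_def)

lemma osuc_not_0 [simp]: "x < \<omega>\<^sub>1 \<Longrightarrow> osuc x \<noteq> 0"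
  using less_osuc[of x] by (auto simp: zero_ordinal_def)

lemma ordinal_cases:
  obtains (zero) "x = 0" | (suc) y where "y < \<omega>\<^sub>1" "y < x" "x = osuc y" | (limit) "is_limit x"
proof -
  consider "x = 0" | "is_limit x" | y where "y < x" "\<not> osuc y < x"
    by (auto simp: is_limit_def)
  then show ?thesis
  proof cases
    case (3 y)
    then have "y < \<omega>\<^sub>1" using less_le_trans top_greatest by blast
    moreover have "x = osuc y"
      using 3 osuc_le_iff[OF \<open>y < \<omega>\<^sub>1\<close>] by (simp add: antisym not_less)
    ultimately show ?thesis using suc 3 by blast
  qed (use zero limit in auto)
qed

lemma opred_less: "x \<noteq> 0 \<Longrightarrow> \<not> is_limit x \<Longrightarrow> opred x < x"
  by (cases x rule: ordinal_cases) auto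

function oadd :: "ordinal \<Rightarrow> ordinal \<Rightarrow> ordinal" where
  "oadd x y =
     (if y = 0 then x
      else if is_limit y then SUP z\<in>{..<y}. oadd x z
      else osuc (oadd x (opred y)))"
  by auto
termination
  by (relation "inv_image {(a, b). a < b} snd") (auto simp: opred_less wf)

function omul :: "ordinal \<Rightarrow> ordinal \<Rightarrow> ordinal" where
  "omul x y =
     (if y = 0 then 0
      else if is_limit y then SUP z\<in>{..<y}. omul x z
      else oadd (omul x (opred y)) x)"
  by auto
termination
  by (relation "inv_image {(a, b). a < b} snd") (auto simp: opred_less wf)

definition omega :: ordinal (\<open>\<omega>\<close>) where
  "\<omega> = (SUP n::nat. (osuc ^^ n) 0)"

function omega_pow :: "ordinal \<Rightarrow> ordinal" where
  "omega_pow y =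
     (if y = 0 then 1
      else if is_limit y then SUP z\<in>{..<y}. omega_pow z
      else omul (omega_pow (opred y)) \<omega>)"
  by auto
termination
  by (relation "{(a, b). a < b}") (auto simp: opred_less wf)

declare oadd.simps [simp del] omul.simps [simp del] omega_pow.simps [simp del]

lemma oadd_clauses:
  "oadd x 0 = x"
  "y < \<omega>\<^sub>1 \<Longrightarrow> oadd x (osuc y) = osuc (oadd x y)"
  "is_limit y \<Longrightarrow> oadd x y = (SUP z\<in>{..<y}. oadd x z)"
  by (subst oadd.simps; auto)+

lemma omul_clauses:
  "omul x 0 = 0"
  "y < \<omega>\<^sub>1 \<Longrightarrow> omul x (osuc y) = oadd (omul x y) x"
  "is_limit y \<Longrightarrow> omul x y = (SUP z\<in>{..<y}. omul x z)"
  by (subst omul.simps; auto)+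

lemma omega_pow_clauses:
  "omega_pow 0 = 1"
  "y < \<omega>\<^sub>1 \<Longrightarrow> omega_pow (osuc y) = omul (omega_pow y) \<omega>"
  "is_limit y \<Longrightarrow> omega_pow y = (SUP z\<in>{..<y}. omega_pow z)"
  by (subst omega_pow.simps; auto)+

text \<open>No saturation occurs in \<open>omega_pow\<close> below \<open>\<omega>\<^sub>1\<close>.\<close>

lemma oadd_less_omega1:
  assumes "x < \<omega>\<^sub>1" "y < \<omega>\<^sub>1"
  shows "oadd x y < \<omega>\<^sub>1"
  using assms(2)
proof (induction y rule: less_induct)
  case (less y)
  show ?case
  proof (cases y rule: ordinal_cases)
    case limit
    show ?thesis
      unfolding oadd_clauses(3)[OF limit]
      using less.prems by (intro SUP_less_omega1 less.IH) auto
  qed (use less assms in \<open>auto simp: oadd_clauses osuc_less_omega1\<close>)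
qed

lemma omul_less_omega1:
  assumes "x < \<omega>\<^sub>1" "y < \<omega>\<^sub>1"
  shows "omul x y < \<omega>\<^sub>1"
  using assms(2)
proof (induction y rule: less_induct)
  case (less y)
  show ?case
  proof (cases y rule: ordinal_cases)
    case limit
    show ?thesis
      unfolding omul_clauses(3)[OF limit]
      using less.prems by (intro SUP_less_omega1 less.IH) auto
  qed (use less assms in \<open>auto simp: omul_clauses oadd_less_omega1\<close>)
qed

lemma omega_less_omega1: "\<omega> < \<omega>\<^sub>1"
proof -
  have "(osuc ^^ n) 0 < \<omega>\<^sub>1" for n
    by (induction n) (auto simp: osuc_less_omega1 zero_less_omega1)
  then show ?thesis
    unfolding omega_def by (intro Sup_less_omega1) auto
qed

lemma omega_pow_less_omega1: "y < \<omega>\<^sub>1 \<Longrightarrow> omega_pow y < \<omega>\<^sub>1"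
proof (induction y rule: less_induct)
  case (less y)
  show ?case
  proof (cases y rule: ordinal_cases)
    case limit
    show ?thesis
      unfolding omega_pow_clauses(3)[OF limit]
      using less.prems by (intro SUP_less_omega1 less.IH) auto
  qed (use less in \<open>auto simp: omega_pow_clauses omul_less_omega1 omega_less_omega1
         one_ordinal_def osuc_less_omega1 zero_less_omega1\<close>)
qed

definition even_ordinal :: "ordinal \<Rightarrow> bool" where
  "even_ordinal x \<longleftrightarrow> (\<exists>\<mu> n. (\<mu> = 0 \<or> is_limit \<mu>) \<and> even n \<and> x = (osuc ^^ n) \<mu>)"

definition osign :: "ordinal \<Rightarrow> real" where
  "osign x = (if even_ordinal x then 1 else -1)"


section \<open>Borel and Baire classes\<close>

inductive sigma0 :: "ordinal \<Rightarrow> 'a::topological_space set \<Rightarrow> bool"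
  and pi0 :: "ordinal \<Rightarrow> 'a set \<Rightarrow> bool" where
  sigma0_open: "open U \<Longrightarrow> sigma0 1 U"
| sigma0_Union: "1 < \<xi> \<Longrightarrow> (\<And>n::nat. \<exists>\<eta>. 1 \<le> \<eta> \<and> \<eta> < \<xi> \<and> pi0 \<eta> (A n)) \<Longrightarrow> sigma0 \<xi> (\<Union>n. A n)"
| pi0_Compl: "sigma0 \<xi> A \<Longrightarrow> pi0 \<xi> (- A)"

lemma sigma0_1_iff: "sigma0 1 U \<longleftrightarrow> open U"
  by (auto elim: sigma0.cases intro: sigma0_open)

lemma pi0_1_iff: "pi0 1 C \<longleftrightarrow> closed C"
proof
  show "pi0 1 C \<Longrightarrow> closed C"
    by (auto elim!: pi0.cases simp: sigma0_1_iff closed_def)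
  show "closed C \<Longrightarrow> pi0 1 C"
    using pi0_Compl[of 1 "- C"] by (simp add: sigma0_1_iff closed_def)
qed

inductive baire_class :: "ordinal \<Rightarrow> ('a::topological_space \<Rightarrow> real) \<Rightarrow> bool" where
  baire_class_1:
    "(\<And>n::nat. continuous_on UNIV (g n)) \<Longrightarrow> (\<And>x. (\<lambda>n. g n x) \<longlonglongrightarrow> f x) \<Longrightarrow> baire_class 1 f"
| baire_class_lim:
    "1 < \<xi> \<Longrightarrow> (\<And>n::nat. \<exists>\<eta>. 1 \<le> \<eta> \<and> \<eta> < \<xi> \<and> baire_class \<eta> (g n)) \<Longrightarrow>
     (\<And>x. (\<lambda>n. g n x) \<longlonglongrightarrow> f x) \<Longrightarrow> baire_class \<xi> f"

definition semi_borel :: "ordinal \<Rightarrow> ('a::topological_space \<Rightarrow> real) \<Rightarrow> bool" where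
  "semi_borel \<xi> g \<longleftrightarrow> (\<forall>c. sigma0 \<xi> {x. g x < c})"


section \<open>Separation by transfinite differences\<close>

text \<open>
  A sequence of length \<open>\<mu>\<close> is a function on all ordinals. The last conjunct is the
  convention that it is continued by \<open>{}\<close>; together with \<open>F 0 = UNIV\<close> it forces \<open>\<mu> \<noteq> 0\<close>.
\<close>

definition difference_seq ::
  "ordinal \<Rightarrow> ordinal \<Rightarrow> (ordinal \<Rightarrow> 'a::topological_space set) \<Rightarrow> bool" where
  "difference_seq \<xi> \<mu> F \<longleftrightarrow>
     \<mu> < \<omega>\<^sub>1 \<and>
     (\<forall>\<eta><\<mu>. pi0 \<xi> (F \<eta>)) \<and>
     (\<forall>\<theta><\<mu>. \<forall>\<eta>\<le>\<theta>. F \<theta> \<subseteq> F \<eta>) \<and>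
     (\<forall>\<theta><\<mu>. is_limit \<theta> \<longrightarrow> F \<theta> = (\<Inter>\<eta>\<in>{..<\<theta>}. F \<eta>)) \<and>
     F 0 = UNIV \<and>
     (is_limit \<mu> \<longrightarrow> (\<Inter>\<eta>\<in>{..<\<mu>}. F \<eta>) = {}) \<and>
     (\<forall>\<eta>\<ge>\<mu>. F \<eta> = {})"

definition transfinite_difference :: "ordinal \<Rightarrow> (ordinal \<Rightarrow> 'a set) \<Rightarrow> 'a set" where
  "transfinite_difference \<mu> F = (\<Union>\<eta>\<in>{\<eta>. \<eta> < \<mu> \<and> even_ordinal \<eta>}. F \<eta> - F (osuc \<eta>))"

text \<open>
  Below, \<open>Inf\<close> of a nonempty set of ordinals is its least element, and \<open>Inf {} = \<omega>\<^sub>1\<close>.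
\<close>

definition alpha_sep :: "ordinal \<Rightarrow> 'a::topological_space set \<Rightarrow> 'a set \<Rightarrow> ordinal" where
  "alpha_sep \<xi> A B =
     Inf {\<mu>. \<exists>F. difference_seq \<xi> \<mu> F \<and>
                A \<subseteq> transfinite_difference \<mu> F \<and> transfinite_difference \<mu> F \<subseteq> - B}"

definition alpha_rank :: "ordinal \<Rightarrow> ('a::topological_space \<Rightarrow> real) \<Rightarrow> ordinal" where
  "alpha_rank \<xi> f =
     Sup {alpha_sep \<xi> {x. f x \<le> of_rat p} {x. f x \<ge> of_rat q} | p q :: rat. p < q}"

definition bounded_baire_rank ::
  "ordinal \<Rightarrow> ordinal \<Rightarrow> ('a::topological_space \<Rightarrow> real) set" where
  "bounded_baire_rank \<xi> \<Lambda> =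
     {f. bounded (range f) \<and> baire_class \<xi> f \<and> alpha_rank \<xi> f \<le> omega_pow \<Lambda>}"


section \<open>Alternating sums\<close>

text \<open>
  Of \<open>F\<close> only the values below the length \<open>\<mu>\<close> matter. The limit \<open>\<eta> \<longlongrightarrow> \<mu>\<close> is taken in the
  order topology on ordinals.
\<close>

definition DUSB ::
  "ordinal \<Rightarrow> ordinal \<Rightarrow> (ordinal \<Rightarrow> 'a::topological_space \<Rightarrow> real) \<Rightarrow> bool" where
  "DUSB \<xi> \<mu> F \<longleftrightarrow>
     \<mu> < \<omega>\<^sub>1 \<and>
     (\<forall>\<theta><\<mu>. \<forall>\<eta>\<le>\<theta>. \<forall>x. F \<theta> x \<le> F \<eta> x) \<and>
     (\<forall>\<eta><\<mu>. (\<forall>x. 0 \<le> F \<eta> x) \<and> bounded (range (F \<eta>)) \<and> semi_borel \<xi> (F \<eta>)) \<and>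
     (is_limit \<mu> \<longrightarrow> (\<forall>x. ((\<lambda>\<eta>. F \<eta> x) \<longlongrightarrow> 0) (at_left \<mu>)))"

text \<open>
  For a sequence in \<open>DUSB\<close> all partial sums lie between \<open>0\<close> and the bounded function \<open>F 0\<close>,
  so the real supremum taken at limits is the genuine one.
\<close>

function altsum :: "(ordinal \<Rightarrow> 'a \<Rightarrow> real) \<Rightarrow> ordinal \<Rightarrow> 'a \<Rightarrow> real" where
  "altsum F \<theta> x =
     (if \<theta> = 0 then 0
      else if is_limit \<theta> then SUP \<zeta>\<in>{\<zeta>. \<zeta> < \<theta> \<and> even_ordinal \<zeta>}. altsum F \<zeta> x
      else altsum F (opred \<theta>) x + osign (opred \<theta>) * F (opred \<theta>) x)"
  by auto
termination
  by (relation "inv_image {(a, b). a < b} (\<lambda>(F, \<theta>, x). \<theta>)") (auto simp: opred_less wf)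

declare altsum.simps [simp del]

lemma altsum_clauses:
  "altsum F 0 x = 0"
  "\<theta> < \<omega>\<^sub>1 \<Longrightarrow> altsum F (osuc \<theta>) x = altsum F \<theta> x + osign \<theta> * F \<theta> x"
  "is_limit \<theta> \<Longrightarrow> altsum F \<theta> x = (SUP \<zeta>\<in>{\<zeta>. \<zeta> < \<theta> \<and> even_ordinal \<zeta>}. altsum F \<zeta> x)"
  by (subst altsum.simps; auto)+

definition altsum_length :: "ordinal \<Rightarrow> ('a::topological_space \<Rightarrow> real) \<Rightarrow> ordinal" where
  "altsum_length \<xi> f =
     Inf {\<mu>. \<exists>F c. DUSB \<xi> \<mu> F \<and> (\<forall>x. f x = c + altsum F \<mu> x)}"

end

theory Submission
  imports Defs
begin

text \<open>
  Both ranks are compared with a third property of \<open>f\<close>: for every \<open>\<epsilon> > 0\<close> the space is cut by a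
  decreasing sequence of multiplicative sets of length \<open>\<omega>\<^sup>\<Lambda>\<close> into pieces on which \<open>f\<close>
  oscillates by at most \<open>\<epsilon>\<close>. Two such decompositions have a common refinement of the same length,
  since a length \<open>\<omega>\<^sup>\<Lambda>\<close> is a sequence of type \<open>\<omega>\<close> of shorter blocks, and the shorter lengths are
  finite sums of smaller powers of \<open>\<omega>\<close>.

  Separating at the pairs of neighbours of a finite grid gives such decompositions; conversely, pieces of
  oscillation below \<open>q - p\<close> can be distributed between the two sides. An alternating sum at an even stage
  is determined up to the next term. Hence on the piece where \<open>f\<^sub>\<eta>\<close> has just come within
  \<open>\<epsilon>\<close> of its infimum, the sum is nearly a shorter one, and induction along Cantor normal forms applies.
  In the other direction, a function that is constant on the pieces is an alternating sum
  of length \<open>\<omega>\<^sup>\<Lambda>\<close>, and a function in \<open>[0, K]\<close> with the third property is a series of such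
  step functions with geometrically decreasing bounds, which can be summed termwise.
\<close>

section \<open>Ordinals\<close>

text \<open>Powers of \<omega> are the right lengths because sums of smaller ordinals stay below
  them and, for \<Lambda> \<ge> 1, they are limits. So finitely many extra cuts never lengthen a
  decomposition, and neither does reserving two consecutive indices for a piece in order to give it
  an index of prescribed parity. Parities can therefore be forgotten while decompositions are
  refined and restored at the end. Two obstacles shape the treatment of alternating sums. Before a
  limit stage the terms decrease to an infimum that varies from point to point and need not be 0, so
  the space is first sliced by the levels of this infimum; only at the full length, where the terms
  tend to 0, is slicing unnecessary. And the sum is a supremum at limits, which does not obviously
  commute with an infinite series of sequences. Only finite additivity is proved, and the remainder
  of the series is controlled by its geometric bound.\<close>

lemma ordinal_zero_le [simp]: "0 \<le> (x::ordinal)"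
  by (simp add: zero_ordinal_def)

lemma ordinal_not_less_0 [simp]: "\<not> x < (0::ordinal)"
  by (simp add: not_less)

lemma ordinal_less_omega1_trans: "x < y \<Longrightarrow> x < \<omega>\<^sub>1"
  using less_le_trans top_greatest by blast

lemma osuc_le_osuc_iff: "x < \<omega>\<^sub>1 \<Longrightarrow> y < \<omega>\<^sub>1 \<Longrightarrow> osuc x \<le> osuc y \<longleftrightarrow> x \<le> y"
  by (simp add: osuc_le_iff less_osuc_iff)

lemma is_limit_pos: "is_limit x \<Longrightarrow> 0 < x"
  by (metis is_limit_def le_less ordinal_zero_le)

lemma is_limitD: "is_limit x \<Longrightarrow> y < x \<Longrightarrow> osuc y < x"
  by (simp add: is_limit_def)

lemma ordinal_induct [case_names zero suc limit]:
  assumes "P 0"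
    and "\<And>y. y < \<omega>\<^sub>1 \<Longrightarrow> y < osuc y \<Longrightarrow> P y \<Longrightarrow> P (osuc y)"
    and "\<And>y. is_limit y \<Longrightarrow> (\<And>z. z < y \<Longrightarrow> P z) \<Longrightarrow> P y"
  shows "P x"
proof (induction x rule: less_induct)
  case (less x)
  show ?case
    by (cases x rule: ordinal_cases) (use assms less in auto)
qed

lemma Sup_lessThan_limit:
  assumes "is_limit y"
  shows "Sup {..<y} = y"
proof (rule antisym)
  show "Sup {..<y} \<le> y" by (rule Sup_least) auto
  show "y \<le> Sup {..<y}"
  proof (rule ccontr)
    assume "\<not> y \<le> Sup {..<y}"
    then have *: "Sup {..<y} < y" by simp
    then have "osuc (Sup {..<y}) \<le> Sup {..<y}"
      using is_limitD[OF assms] by (intro Sup_upper) auto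
    then show False
      using less_osuc[OF ordinal_less_omega1_trans[OF *]] by simp
  qed
qed

section \<open>Ordinal addition and left subtraction\<close>

lemma le_oadd: "x \<le> oadd x y"
proof (induction y rule: ordinal_induct)
  case zero
  show ?case by (simp add: oadd_clauses)
next
  case (suc y)
  show ?case
  proof (cases "oadd x y < \<omega>\<^sub>1")
    case True
    then show ?thesis using suc less_osuc[OF True] by (simp add: oadd_clauses)
  next
    case False
    \<comment> \<open>The infimum defining \<open>osuc\<close> is now taken over the empty set, so
      it is \<open>\<omega>\<^sub>1\<close>.\<close>
    then have "osuc (oadd x y) = \<omega>\<^sub>1"
      unfolding osuc_def by (metis (mono_tags) Inf_empty empty_Collect_eq less_le_trans not_top_less top.not_eq_extremum)
    then show ?thesis using suc by (simp add: oadd_clauses)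
  qed
next
  case (limit y)
  have "x = oadd x 0" by (simp add: oadd_clauses)
  also have "\<dots> \<le> (SUP z\<in>{..<y}. oadd x z)"
    using is_limit_pos[OF limit(1)] by (intro SUP_upper) auto
  finally show ?case using limit by (simp add: oadd_clauses)
qed

lemma oadd_0_left [simp]: "oadd 0 y = y"
proof (induction y rule: ordinal_induct)
  case (limit y)
  then have "(SUP z\<in>{..<y}. oadd 0 z) = (SUP z\<in>{..<y}. z)"
    by (intro SUP_cong) auto
  then show ?case using limit by (simp add: oadd_clauses Sup_lessThan_limit)
qed (simp_all add: oadd_clauses)

lemma oadd_0_right [simp]: "oadd x 0 = x"
  by (simp add: oadd_clauses)

lemma oadd_strict_mono:
  assumes "x < \<omega>\<^sub>1" "z < \<omega>\<^sub>1" "y < z"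
  shows "oadd x y < oadd x z"
  using assms(2,3)
proof (induction z arbitrary: y rule: ordinal_induct)
  case (suc z)
  have "oadd x y \<le> oadd x z"
    using suc by (cases "y = z") (auto simp: less_osuc_iff less_imp_le)
  also have "\<dots> < osuc (oadd x z)"
    by (intro less_osuc oadd_less_omega1 assms suc)
  finally show ?case using suc by (simp add: oadd_clauses)
next
  case (limit z)
  have y: "y < \<omega>\<^sub>1" using limit.prems by auto
  have "oadd x y < osuc (oadd x y)"
    by (intro less_osuc oadd_less_omega1 assms y)
  also have "\<dots> = oadd x (osuc y)" using y by (simp add: oadd_clauses)
  also have "\<dots> \<le> (SUP z\<in>{..<z}. oadd x z)"
    using is_limitD limit by (intro SUP_upper) auto
  finally show ?case using limit by (simp add: oadd_clauses)
qed auto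

lemma oadd_less_iff:
  assumes "x < \<omega>\<^sub>1" "y < \<omega>\<^sub>1" "z < \<omega>\<^sub>1"
  shows "oadd x y < oadd x z \<longleftrightarrow> y < z"
  using oadd_strict_mono[of x] assms by (metis less_asym linorder_neqE)

lemma oadd_le_iff:
  assumes "x < \<omega>\<^sub>1" "y < \<omega>\<^sub>1" "z < \<omega>\<^sub>1"
  shows "oadd x y \<le> oadd x z \<longleftrightarrow> y \<le> z"
  using oadd_less_iff[of x z y] assms by (meson not_le)

lemma oadd_eq_iff:
  assumes "x < \<omega>\<^sub>1" "y < \<omega>\<^sub>1" "z < \<omega>\<^sub>1"
  shows "oadd x y = oadd x z \<longleftrightarrow> y = z"
  using oadd_le_iff assms by (metis antisym order_refl)

lemma is_limit_oadd:
  assumes "is_limit y" "x < \<omega>\<^sub>1" "y < \<omega>\<^sub>1"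
  shows "is_limit (oadd x y)"
  unfolding is_limit_def
proof (intro conjI allI impI)
  have "oadd x 0 < oadd x y"
    using assms by (intro oadd_strict_mono is_limit_pos)
  then show "oadd x y \<noteq> 0" by auto
  fix w assume "w < oadd x y"
  then obtain z where z: "z < y" "w < oadd x z"
    using assms by (auto simp: oadd_clauses less_SUP_iff)
  then have "osuc w \<le> oadd x z" by (simp add: osuc_le_iff ordinal_less_omega1_trans)
  also have "\<dots> < oadd x y" using assms z by (intro oadd_strict_mono)
  finally show "osuc w < oadd x y" .
qed

lemma oadd_assoc:
  assumes "x < \<omega>\<^sub>1" "y < \<omega>\<^sub>1" "z < \<omega>\<^sub>1"
  shows "oadd (oadd x y) z = oadd x (oadd y z)"
  using assms(3)
proof (induction z rule: ordinal_induct)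
  case (suc z)
  then show ?case using assms by (simp add: oadd_clauses oadd_less_omega1)
next
  case (limit z)
  have lim: "is_limit (oadd y z)" using limit assms by (intro is_limit_oadd)
  have "oadd (oadd x y) z = (SUP w\<in>{..<z}. oadd x (oadd y w))"
    using limit by (auto simp: oadd_clauses intro!: SUP_cong)
  also have "\<dots> = (SUP v\<in>{..<oadd y z}. oadd x v)"
  proof (rule antisym)
    show "(SUP w\<in>{..<z}. oadd x (oadd y w)) \<le> (SUP v\<in>{..<oadd y z}. oadd x v)"
      by (rule SUP_mono) (use assms limit.prems in \<open>auto intro!: oadd_strict_mono\<close>)
    show "(SUP v\<in>{..<oadd y z}. oadd x v) \<le> (SUP w\<in>{..<z}. oadd x (oadd y w))"
    proof (rule SUP_mono)
      fix v assume "v \<in> {..<oadd y z}"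
      then obtain w where w: "w < z" "v < oadd y w"
        using limit by (auto simp: oadd_clauses less_SUP_iff)
      then have "oadd x v \<le> oadd x (oadd y w)"
        using assms limit.prems
        by (intro less_imp_le oadd_strict_mono oadd_less_omega1) auto
      then show "\<exists>w\<in>{..<z}. oadd x v \<le> oadd x (oadd y w)" using w by auto
    qed
  qed
  finally show ?case using lim by (simp add: oadd_clauses)
qed simp

lemma oadd_mono_left:
  assumes "x \<le> y" "y < \<omega>\<^sub>1" "z < \<omega>\<^sub>1"
  shows "oadd x z \<le> oadd y z"
  using assms(3)
proof (induction z rule: ordinal_induct)
  case (suc z)
  have "x < \<omega>\<^sub>1" using assms by auto
  then show ?case
    using suc assms by (simp add: oadd_clauses osuc_le_osuc_iff oadd_less_omega1)
next
  case (limit z)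
  then show ?case using less_trans[OF _ limit.prems]
    by (simp add: oadd_clauses) (rule SUP_mono, auto)
qed (use assms in simp)

text \<open>Left subtraction with the least candidate \<open>z\<close>: all \<open>oadd x w\<close>
  with \<open>w < z\<close> are below \<open>y\<close>, so \<open>oadd x z\<close> cannot overshoot,
  by continuity in the right argument. The bound \<open>z \<le> y\<close> keeps the remainder
  countable.\<close>

lemma oadd_diff:
  assumes "x \<le> y" "y < \<omega>\<^sub>1"
  obtains z where "z \<le> y" "y = oadd x z"
proof -
  have *: "y \<le> oadd x y"
    using oadd_mono_left[of 0 x y] assms by auto
  define z where "z = (LEAST z. y \<le> oadd x z)"
  have z: "y \<le> oadd x z" "z \<le> y"
    unfolding z_def using * by (rule LeastI, rule Least_le)
  have less: "oadd x w < y" if "w < z" for w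
    using that not_less_Least unfolding z_def by (meson not_le)
  have "oadd x z \<le> y"
  proof (cases z rule: ordinal_cases)
    case zero
    then show ?thesis using assms by simp
  next
    case (suc w)
    then show ?thesis using less[of w]
      by (simp add: oadd_clauses osuc_le_iff ordinal_less_omega1_trans[OF less[of w]])
  next
    case limit
    then show ?thesis
      unfolding oadd_clauses(3)[OF limit] by (intro SUP_least) (auto intro: less_imp_le less)
  qed
  with z show ?thesis using that by auto
qed

section \<open>Parity\<close>

lemma funpow_osuc_less_omega1: "\<mu> < \<omega>\<^sub>1 \<Longrightarrow> (osuc ^^ n) \<mu> < \<omega>\<^sub>1"
  by (induction n) (auto simp: osuc_less_omega1)

lemma osuc_inject: "x < \<omega>\<^sub>1 \<Longrightarrow> y < \<omega>\<^sub>1 \<Longrightarrow> osuc x = osuc y \<longleftrightarrow> x = y"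
  by (metis opred_osuc)

lemma even_ordinal_0 [simp]: "even_ordinal 0"
  unfolding even_ordinal_def by (rule exI[of _ 0], rule exI[of _ 0]) simp

lemma even_ordinal_limit [simp]: "is_limit x \<Longrightarrow> even_ordinal x"
  unfolding even_ordinal_def by (rule exI[of _ x], rule exI[of _ 0]) simp

text \<open>\<open>even_ordinal\<close> asks for some decomposition into a limit part and a finite
  part, so parity behaves well only once the finite part is unique. This fails at
  \<open>\<omega>\<^sub>1\<close>, a limit that is fixed by \<open>osuc\<close>.\<close>

lemma funpow_osuc_unique:
  assumes "\<mu> = 0 \<or> is_limit \<mu>" "\<nu> = 0 \<or> is_limit \<nu>" "\<mu> < \<omega>\<^sub>1" "\<nu> < \<omega>\<^sub>1"
    and "(osuc ^^ m) \<mu> = (osuc ^^ n) \<nu>"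
  shows "m = n"
  using assms(5)
proof (induction m arbitrary: n)
  case 0
  show ?case
  proof (cases n)
    case (Suc k)
    then have "\<mu> = osuc ((osuc ^^ k) \<nu>)" using 0 by simp
    then show ?thesis
      using assms by (metis funpow_osuc_less_omega1 not_limit_osuc osuc_not_0)
  qed simp
next
  case (Suc m)
  show ?case
  proof (cases n)
    case 0
    then have "\<nu> = osuc ((osuc ^^ m) \<mu>)" using Suc by simp
    then show ?thesis
      using assms by (metis funpow_osuc_less_omega1 not_limit_osuc osuc_not_0)
  next
    case (Suc k)
    then show ?thesis
      using Suc.IH[of k] Suc.prems assms by (simp add: osuc_inject funpow_osuc_less_omega1)
  qed
qed

lemma ordinal_limit_plus_nat:
  obtains \<mu> n where "\<mu> = 0 \<or> is_limit \<mu>" "x = (osuc ^^ n) \<mu>"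
proof -
  have "\<exists>\<mu> n. (\<mu> = 0 \<or> is_limit \<mu>) \<and> x = (osuc ^^ n) \<mu>"
  proof (induction x rule: ordinal_induct)
    case (suc y)
    then obtain \<mu> n where "\<mu> = 0 \<or> is_limit \<mu>" "y = (osuc ^^ n) \<mu>" by blast
    then show ?case by (intro exI[of _ \<mu>] exI[of _ "Suc n"]) auto
  next
    case (limit y)
    then show ?case by (intro exI[of _ y] exI[of _ 0]) auto
  qed (intro exI[of _ 0], auto)
  then show ?thesis using that by blast
qed

lemma funpow_osuc_less_omega1D:
  assumes "(osuc ^^ n) \<mu> < \<omega>\<^sub>1"
  shows "\<mu> < \<omega>\<^sub>1"
proof (rule ccontr)
  have top: "osuc \<omega>\<^sub>1 = \<omega>\<^sub>1" by (simp add: osuc_def)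
  assume "\<not> \<mu> < \<omega>\<^sub>1"
  then have "\<mu> = \<omega>\<^sub>1" using top.not_eq_extremum by blast
  moreover have "(osuc ^^ n) \<omega>\<^sub>1 = \<omega>\<^sub>1"
    by (induction n) (auto simp: top)
  ultimately show False using assms by simp
qed

lemma even_ordinal_osuc [simp]:
  assumes "x < \<omega>\<^sub>1"
  shows "even_ordinal (osuc x) \<longleftrightarrow> \<not> even_ordinal x"
proof -
  obtain \<mu> n where \<mu>: "\<mu> = 0 \<or> is_limit \<mu>" "x = (osuc ^^ n) \<mu>"
    using ordinal_limit_plus_nat .
  have *: "even_ordinal y \<longleftrightarrow> even m"
    if m: "y = (osuc ^^ m) \<mu>" "y < \<omega>\<^sub>1" for y m
  proof
    assume "even_ordinal y"
    then obtain \<nu> k where \<nu>: "\<nu> = 0 \<or> is_limit \<nu>" "even k" "y = (osuc ^^ k) \<nu>"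
      unfolding even_ordinal_def by blast
    then have "m = k"
      using \<mu> m funpow_osuc_unique[of \<mu> \<nu> m k]
        funpow_osuc_less_omega1D[of m \<mu>] funpow_osuc_less_omega1D[of k \<nu>] by simp
    then show "even m" using \<nu> by simp
  next
    assume "even m"
    then show "even_ordinal y" unfolding even_ordinal_def using \<mu> m by blast
  qed
  show ?thesis
    using *[of x n] *[of "osuc x" "Suc n"] assms \<mu> by (auto simp: osuc_less_omega1)
qed

text \<open>Limit stages cause no trouble because the sum is then a limit, hence even on both sides.
  This allows blocks of even length to be concatenated without changing parities.\<close>

lemma even_ordinal_oadd:
  assumes "even_ordinal x" "x < \<omega>\<^sub>1" "y < \<omega>\<^sub>1"
  shows "even_ordinal (oadd x y) \<longleftrightarrow> even_ordinal y"
  using assms(3)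
proof (induction y rule: ordinal_induct)
  case (suc y)
  then show ?case using assms by (simp add: oadd_clauses oadd_less_omega1)
next
  case (limit y)
  then show ?case using assms by (simp add: is_limit_oadd)
qed (use assms in simp)

section \<open>Powers of \<omega>\<close>

lemma is_limit_omega: "is_limit \<omega>"
  unfolding is_limit_def
proof (intro conjI allI impI)
  have "(osuc ^^ Suc 0) 0 \<le> \<omega>"
    unfolding omega_def by (rule SUP_upper) simp
  then have "osuc 0 \<le> \<omega>" by simp
  then show "\<omega> \<noteq> 0"
    using less_osuc[OF zero_less_omega1] by auto
  fix y assume "y < \<omega>"
  then obtain n where n: "y < (osuc ^^ n) 0" unfolding omega_def by (auto simp: less_SUP_iff)
  then have "osuc y \<le> (osuc ^^ n) 0" by (simp add: osuc_le_iff ordinal_less_omega1_trans)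
  also have "\<dots> < osuc ((osuc ^^ n) 0)"
    by (intro less_osuc funpow_osuc_less_omega1 zero_less_omega1)
  also have "\<dots> = (osuc ^^ Suc n) 0" by simp
  also have "\<dots> \<le> \<omega>"
    unfolding omega_def by (rule SUP_upper) simp
  finally show "osuc y < \<omega>" .
qed

lemma less_omega_iff: "x < \<omega> \<longleftrightarrow> (\<exists>n. x = (osuc ^^ n) 0)"
proof
  assume "x < \<omega>"
  then obtain n where "x < (osuc ^^ n) 0" unfolding omega_def by (auto simp: less_SUP_iff)
  then show "\<exists>n. x = (osuc ^^ n) 0"
    by (induction n) (auto simp: less_osuc_iff funpow_osuc_less_omega1 zero_less_omega1 le_less)
next
  have "(osuc ^^ n) 0 < \<omega>" for n
    by (induction n) (auto simp: is_limitD[OF is_limit_omega] is_limit_pos[OF is_limit_omega])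
  then show "\<exists>n. x = (osuc ^^ n) 0 \<Longrightarrow> x < \<omega>" by auto
qed

lemma less_omul_omega_iff: "x < omul w \<omega> \<longleftrightarrow> (\<exists>n. x < omul w ((osuc ^^ n) 0))"
  unfolding omul_clauses(3)[OF is_limit_omega] less_SUP_iff Bex_def lessThan_iff less_omega_iff
  by blast

lemma omul_nat_clauses:
  "omul w ((osuc ^^ 0) 0) = 0"
  "omul w ((osuc ^^ Suc n) 0) = oadd (omul w ((osuc ^^ n) 0)) w"
  by (auto simp: omul_clauses funpow_osuc_less_omega1 zero_less_omega1)

lemma omul_nat_less_omega1: "w < \<omega>\<^sub>1 \<Longrightarrow> omul w ((osuc ^^ n) 0) < \<omega>\<^sub>1"
  by (intro omul_less_omega1 funpow_osuc_less_omega1 zero_less_omega1)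

lemma less_omega_pow_osuc_iff:
  "\<kappa> < \<omega>\<^sub>1 \<Longrightarrow> x < omega_pow (osuc \<kappa>) \<longleftrightarrow> (\<exists>n. x < omul (omega_pow \<kappa>) ((osuc ^^ n) 0))"
  by (simp add: omega_pow_clauses less_omul_omega_iff)

lemma less_omega_pow_limit_iff:
  "is_limit \<kappa> \<Longrightarrow> x < omega_pow \<kappa> \<longleftrightarrow> (\<exists>z<\<kappa>. x < omega_pow z)"
  by (auto simp: omega_pow_clauses less_SUP_iff)

lemma omega_pow_pos:
  assumes "\<kappa> < \<omega>\<^sub>1"
  shows "0 < omega_pow \<kappa>"
  using assms
proof (induction \<kappa> rule: ordinal_induct)
  case zero
  show ?case using less_osuc[OF zero_less_omega1] by (simp add: omega_pow_clauses one_ordinal_def)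
next
  case (suc \<kappa>)
  have "0 < omul (omega_pow \<kappa>) ((osuc ^^ Suc 0) 0)"
    unfolding omul_nat_clauses using suc by simp
  then show ?case using suc less_omega_pow_osuc_iff by blast
next
  case (limit \<kappa>)
  then show ?case using is_limit_pos less_omega_pow_limit_iff by (meson less_trans)
qed

lemma omega_pow_less_osuc:
  assumes "\<kappa> < \<omega>\<^sub>1"
  shows "omega_pow \<kappa> < omega_pow (osuc \<kappa>)"
proof -
  let ?w = "omega_pow \<kappa>"
  have w: "?w < \<omega>\<^sub>1" using assms by (rule omega_pow_less_omega1)
  have "omul ?w ((osuc ^^ Suc 0) 0) = ?w" unfolding omul_nat_clauses by simp
  then have "omul ?w ((osuc ^^ Suc (Suc 0)) 0) = oadd ?w ?w"
    using omul_nat_clauses by metis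
  moreover have "?w < oadd ?w ?w"
    using oadd_strict_mono[OF w w omega_pow_pos[OF assms]] by simp
  ultimately show ?thesis using assms less_omega_pow_osuc_iff by metis
qed

lemma omega_pow_strict_mono:
  assumes "\<kappa> < \<Lambda>" "\<Lambda> < \<omega>\<^sub>1"
  shows "omega_pow \<kappa> < omega_pow \<Lambda>"
  using assms
proof (induction \<Lambda> rule: ordinal_induct)
  case (suc \<Lambda>)
  have "omega_pow \<kappa> \<le> omega_pow \<Lambda>"
    using suc by (cases "\<kappa> = \<Lambda>") (auto simp: less_osuc_iff less_imp_le)
  then show ?case using omega_pow_less_osuc suc by (meson le_less_trans)
next
  case (limit \<Lambda>)
  then have "osuc \<kappa> < \<Lambda>" "\<kappa> < \<omega>\<^sub>1" by (auto simp: is_limitD)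
  then show ?case using limit omega_pow_less_osuc less_omega_pow_limit_iff by blast
qed auto

lemma is_limit_omega_pow:
  assumes "0 < \<kappa>" "\<kappa> < \<omega>\<^sub>1"
  shows "is_limit (omega_pow \<kappa>)"
  unfolding is_limit_def
proof (intro conjI allI impI)
  show "omega_pow \<kappa> \<noteq> 0" using omega_pow_pos[OF assms(2)] by auto
  fix x assume x: "x < omega_pow \<kappa>"
  have x1: "x < \<omega>\<^sub>1" using x ordinal_less_omega1_trans by blast
  show "osuc x < omega_pow \<kappa>"
  proof (cases \<kappa> rule: ordinal_cases)
    case zero
    then show ?thesis using assms by simp
  next
    case (suc \<nu>)
    let ?w = "omega_pow \<nu>"
    have w: "?w < \<omega>\<^sub>1" using suc by (intro omega_pow_less_omega1)
    obtain n where n: "x < omul ?w ((osuc ^^ n) 0)"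
      using x suc less_omega_pow_osuc_iff by blast
    have "osuc x \<le> omul ?w ((osuc ^^ n) 0)" using n x1 by (simp add: osuc_le_iff)
    also have "\<dots> = oadd (omul ?w ((osuc ^^ n) 0)) 0" by simp
    also have "\<dots> < oadd (omul ?w ((osuc ^^ n) 0)) ?w"
      using w suc by (intro oadd_strict_mono omul_nat_less_omega1 omega_pow_pos)
    also have "\<dots> = omul ?w ((osuc ^^ Suc n) 0)" by (simp only: omul_nat_clauses)
    finally show ?thesis using suc less_omega_pow_osuc_iff by blast
  next
    case limit
    then obtain z where z: "z < \<kappa>" "x < omega_pow z" using x less_omega_pow_limit_iff by blast
    then have "osuc x \<le> omega_pow z" using x1 by (simp add: osuc_le_iff)
    also have "\<dots> < omega_pow \<kappa>" using z assms by (intro omega_pow_strict_mono)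
    finally show ?thesis .
  qed
qed

text \<open>Cantor normal form as an induction rule: everything below
  \<open>\<omega>\<^sup>\<Lambda>\<close> arises from smaller powers by addition. The
  \<open>add\<close> case does not ask for the sum to be below
  \<open>\<omega>\<^sup>\<Lambda>\<close>, since the rule itself serves to prove this.\<close>

lemma omega_pow_induct [consumes 2, case_names zero pow add]:
  assumes "\<delta> < omega_pow \<Lambda>" "\<Lambda> < \<omega>\<^sub>1"
    and "P 0"
    and pow: "\<And>\<kappa>. \<kappa> < \<Lambda> \<Longrightarrow> P (omega_pow \<kappa>)"
    and add: "\<And>x y. x < omega_pow \<Lambda> \<Longrightarrow> y < omega_pow \<Lambda> \<Longrightarrow> P x \<Longrightarrow> P y \<Longrightarrow> P (oadd x y)"
  shows "P \<delta>"
  using assms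
proof (induction \<Lambda> arbitrary: \<delta> rule: ordinal_induct)
  case zero
  then have "\<delta> = 0"
    using less_osuc_iff[OF zero_less_omega1, of \<delta>]
    unfolding omega_pow_clauses one_ordinal_def by (metis antisym ordinal_zero_le)
  then show ?case using \<open>P 0\<close> by simp
next
  case (suc \<Lambda>)
  let ?w = "omega_pow \<Lambda>" and ?V = "omega_pow (osuc \<Lambda>)"
  have w: "?w < \<omega>\<^sub>1" using suc by (intro omega_pow_less_omega1)
  have wV: "?w < ?V" using suc by (intro omega_pow_less_osuc)
  have small: "P \<rho>" if "\<rho> < ?w" for \<rho>
  proof (rule suc.IH[OF that suc.hyps(1) suc.prems(3)])
    show "P (omega_pow \<kappa>)" if "\<kappa> < \<Lambda>" for \<kappa>
      using that suc.hyps(2) by (intro suc.prems(4)) (rule less_trans)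
    show "P (oadd x y)" if "x < ?w" "y < ?w" "P x" "P y" for x y
      using that less_trans[OF _ wV] by (intro suc.prems(5))
  qed
  \<comment> \<open>Finite multiples of \<open>?w\<close> are reached by repeated addition; the
    bound \<open>?V\<close> is carried along because \<open>add\<close> demands it of the
    summands.\<close>
  have mult: "omul ?w ((osuc ^^ n) 0) < ?V \<and> P (omul ?w ((osuc ^^ n) 0))" for n
  proof (induction n)
    case 0
    show ?case using suc.prems(2,3) omega_pow_pos[of "osuc \<Lambda>"] by (simp add: omul_clauses)
  next
    case (Suc n)
    have "oadd (omul ?w ((osuc ^^ Suc n) 0)) 0 < oadd (omul ?w ((osuc ^^ Suc n) 0)) ?w"
      using w suc.hyps by (intro oadd_strict_mono omul_nat_less_omega1 omega_pow_pos)
    then have "omul ?w ((osuc ^^ Suc n) 0) < omul ?w ((osuc ^^ Suc (Suc n)) 0)"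
      using omul_nat_clauses(2)[of ?w "Suc n"] by simp
    then have "omul ?w ((osuc ^^ Suc n) 0) < ?V"
      using suc.hyps less_omega_pow_osuc_iff by blast
    moreover have "P (omul ?w ((osuc ^^ Suc n) 0))"
      unfolding omul_nat_clauses
      using Suc wV suc.prems(4)[OF suc.hyps(2)] by (intro suc.prems(5)) auto
    ultimately show ?case by blast
  qed
  obtain n where "\<delta> < omul ?w ((osuc ^^ n) 0)"
    using suc less_omega_pow_osuc_iff by blast
  then show ?case
  proof (induction n)
    case (Suc n)
    show ?case
    proof (cases "\<delta> < omul ?w ((osuc ^^ n) 0)")
      case False
      have d: "\<delta> < \<omega>\<^sub>1" using suc.prems ordinal_less_omega1_trans by blast
      \<comment> \<open>Here \<delta> lies between two consecutive multiples of \<open>?w\<close>,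
        so the remainder is below \<open>?w\<close> and falls under \<open>small\<close>.\<close>
      obtain \<rho> where \<rho>: "\<rho> \<le> \<delta>" "\<delta> = oadd (omul ?w ((osuc ^^ n) 0)) \<rho>"
        using oadd_diff[OF leI[OF False] d] .
      have "\<rho> < ?w"
        using Suc.prems \<rho> d unfolding omul_nat_clauses
        by (simp add: oadd_less_iff omul_nat_less_omega1 w)
      then show ?thesis
        using \<rho> small mult[of n] suc.prems(5) wV by (metis less_trans)
    qed (use Suc in simp)
  qed (simp add: omul_clauses)
next
  case (limit \<Lambda>)
  then obtain z where z: "z < \<Lambda>" "\<delta> < omega_pow z" using less_omega_pow_limit_iff by blast
  have "omega_pow z < omega_pow \<Lambda>" using z limit by (intro omega_pow_strict_mono)
  show ?case
  proof (rule limit.IH[OF z(1,2) _ limit.prems(3)])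
    show "z < \<omega>\<^sub>1" using z(1) by (rule ordinal_less_omega1_trans)
    show "P (omega_pow \<kappa>)" if "\<kappa> < z" for \<kappa>
      using that z(1) by (intro limit.prems(4)) (rule less_trans)
    show "P (oadd x y)" if "x < omega_pow z" "y < omega_pow z" "P x" "P y" for x y
      using that less_trans[OF _ \<open>omega_pow z < omega_pow \<Lambda>\<close>] by (intro limit.prems(5))
  qed
qed

text \<open>Additive indecomposability. The induction runs over \<open>b\<close> with
  \<open>a\<close> arbitrary, so that adding a sum can be regrouped as adding twice. What remains is
  one smaller power, and \<open>a\<close> plus this power is below a finite multiple of some
  \<open>\<omega>\<^sup>\<tau>\<close> with \<open>\<tau> < \<kappa>\<close>.\<close>

lemma oadd_less_omega_pow:
  assumes "a < omega_pow \<kappa>" "b < omega_pow \<kappa>" "\<kappa> < \<omega>\<^sub>1"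
  shows "oadd a b < omega_pow \<kappa>"
proof -
  have 1: "x < \<omega>\<^sub>1" if "x < omega_pow \<kappa>" for x
    using that ordinal_less_omega1_trans by blast
  have "\<forall>a<omega_pow \<kappa>. oadd a b < omega_pow \<kappa>"
    using assms(2,3)
  proof (induction rule: omega_pow_induct)
    case (pow \<nu>)
    show ?case
    proof (intro allI impI)
      fix a assume a: "a < omega_pow \<kappa>"
      have \<nu>: "\<nu> < \<omega>\<^sub>1" using pow assms by auto
      let ?w = "omega_pow \<nu>"
      have w: "?w < \<omega>\<^sub>1" using \<nu> by (rule omega_pow_less_omega1)
      show "oadd a ?w < omega_pow \<kappa>"
      proof (cases "a < ?w")
        case True
        have "oadd a ?w \<le> oadd ?w ?w"
          using True w by (intro oadd_mono_left) auto
        also have "\<dots> < oadd (oadd ?w ?w) ?w"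
          using oadd_strict_mono[of "oadd ?w ?w" ?w 0] w \<nu>
          by (simp add: oadd_less_omega1 omega_pow_pos)
        also have "\<dots> = omul ?w ((osuc ^^ Suc (Suc (Suc 0))) 0)"
          by (simp only: omul_nat_clauses) simp
        finally have "oadd a ?w < omega_pow (osuc \<nu>)"
          using \<nu> less_omega_pow_osuc_iff by blast
        also have "\<dots> \<le> omega_pow \<kappa>"
          using omega_pow_strict_mono[of "osuc \<nu>" \<kappa>] pow assms \<nu> osuc_le_iff[of \<nu> \<kappa>]
          by (metis le_less)
        finally show ?thesis .
      next
        case False
        \<comment> \<open>The least power exceeding \<open>a\<close> has a successor exponent: at a
          limit exponent a smaller power would already exceed \<open>a\<close>.\<close>
        obtain \<tau> where \<tau>: "\<nu> \<le> \<tau>" "\<tau> < \<kappa>" "a < omega_pow (osuc \<tau>)"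
        proof -
          define \<sigma> where "\<sigma> = (LEAST \<sigma>. a < omega_pow \<sigma>)"
          have \<sigma>: "a < omega_pow \<sigma>" "\<sigma> \<le> \<kappa>"
            unfolding \<sigma>_def using a by (rule LeastI, rule Least_le)
          have min: "\<not> a < omega_pow z" if "z < \<sigma>" for z
            using that not_less_Least unfolding \<sigma>_def by blast
          have "\<nu> < \<sigma>"
            using False \<sigma> omega_pow_strict_mono[of \<sigma> \<nu>] \<nu> by (metis less_trans linorder_neqE)
          show ?thesis
          proof (cases \<sigma> rule: ordinal_cases)
            case (suc y)
            show ?thesis
            proof (rule that)
              show "\<nu> \<le> y" using suc \<open>\<nu> < \<sigma>\<close> less_osuc_iff by blast
              show "y < \<kappa>" using suc \<sigma> by (metis less_le_trans)
              show "a < omega_pow (osuc y)" using suc \<sigma> by simp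
            qed
          next
            case limit
            then show ?thesis using \<sigma> min less_omega_pow_limit_iff by blast
          qed (use \<open>\<nu> < \<sigma>\<close> in auto)
        qed
        have t: "\<tau> < \<omega>\<^sub>1" using \<tau> ordinal_less_omega1_trans by blast
        let ?v = "omega_pow \<tau>"
        have v: "?v < \<omega>\<^sub>1" using t by (rule omega_pow_less_omega1)
        have wv: "?w \<le> ?v" using \<tau> t omega_pow_strict_mono[of \<nu> \<tau>] by (auto simp: le_less)
        obtain n where n: "a < omul ?v ((osuc ^^ n) 0)"
          using \<tau> t less_omega_pow_osuc_iff by blast
        have "oadd a ?w \<le> oadd a ?v"
          using wv w v 1[OF a] by (simp add: oadd_le_iff)
        also have "\<dots> \<le> oadd (omul ?v ((osuc ^^ n) 0)) ?v"
          using n v by (intro oadd_mono_left omul_nat_less_omega1) auto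
        also have "\<dots> < oadd (oadd (omul ?v ((osuc ^^ n) 0)) ?v) ?v"
          using oadd_strict_mono[of "oadd (omul ?v ((osuc ^^ n) 0)) ?v" ?v 0] v t
          by (simp add: oadd_less_omega1 omega_pow_pos omul_nat_less_omega1)
        also have "\<dots> = omul ?v ((osuc ^^ Suc (Suc n)) 0)"
          by (simp only: omul_nat_clauses)
        finally have "oadd a ?w < omega_pow (osuc \<tau>)"
          using t less_omega_pow_osuc_iff by blast
        also have "\<dots> \<le> omega_pow \<kappa>"
          using omega_pow_strict_mono[of "osuc \<tau>" \<kappa>] \<tau> assms t osuc_le_iff[of \<tau> \<kappa>]
          by (metis le_less)
        finally show ?thesis .
      qed
    qed
  next
    case (add x y)
    then show ?case using 1 by (metis oadd_assoc)
  qed simp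
  then show ?thesis using assms by blast
qed

text \<open>Take running maxima of an enumeration of the predecessors of \<theta>, started at
  \<gamma>, and round them up to even ordinals. Even stages are those between which alternating sums
  can be compared.\<close>

lemma even_cofinal_sequence:
  assumes "is_limit \<theta>" "\<theta> < \<omega>\<^sub>1" "\<gamma> < \<theta>"
  obtains z :: "nat \<Rightarrow> ordinal"
  where "\<And>m n. m \<le> n \<Longrightarrow> z m \<le> z n" "\<And>n. \<gamma> \<le> z n" "\<And>n. z n < \<theta>"
    "\<And>n. even_ordinal (z n)" "\<And>\<eta>. \<eta> < \<theta> \<Longrightarrow> \<exists>n. \<eta> \<le> z n"
proof -
  define e where "e x = (if even_ordinal x then x else osuc x)" for x
  have e: "x \<le> e x" "e x < \<theta>" "even_ordinal (e x)" if "x < \<theta>" for x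
    using that assms less_osuc[of x] ordinal_less_omega1_trans[OF that]
    by (auto simp: e_def is_limitD)
  have e_mono: "e x \<le> e y" if "x \<le> y" "y < \<theta>" for x y
  proof (cases "x = y")
    case False
    have "x < \<omega>\<^sub>1" using that assms by auto
    then have "osuc x \<le> y" using that False by (simp add: osuc_le_iff)
    then show ?thesis using that e[of y] unfolding e_def[of x] by auto
  qed simp
  define b where "b = from_nat_into {..<\<theta>}"
  have b: "range b = {..<\<theta>}"
    unfolding b_def using countable_lessThan_ordinal assms by (intro range_from_nat_into) auto
  define M where "M n = Max (insert \<gamma> (b ` {..n}))" for n
  have M: "M n < \<theta>" for n
    using b assms unfolding M_def by (subst Max_less_iff) auto
  show ?thesis
  proof (rule that[of "\<lambda>n. e (M n)"])
    show "e (M m) \<le> e (M n)" if "m \<le> n" for m n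
    proof (rule e_mono[OF _ M])
      show "M m \<le> M n" unfolding M_def by (rule Max_mono) (use that in auto)
    qed
    show "\<gamma> \<le> e (M n)" for n
    proof (rule order_trans[OF _ e(1)[OF M]])
      show "\<gamma> \<le> M n" unfolding M_def by (rule Max_ge) auto
    qed
    show "e (M n) < \<theta>" "even_ordinal (e (M n))" for n
      using e M by auto
    show "\<exists>n. \<eta> \<le> e (M n)" if "\<eta> < \<theta>" for \<eta>
    proof -
      obtain n where "\<eta> = b n" using b \<open>\<eta> < \<theta>\<close> by (metis imageE lessThan_iff)
      then have "\<eta> \<le> M n" unfolding M_def by (intro Max_ge) auto
      then show ?thesis using e(1)[OF M] order_trans by blast
    qed
  qed
qed

section \<open>Transfinite decompositions\<close>

text \<open>These closure properties are what the theory of decompositions takes from the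
  multiplicative sets of class \<xi>; the level \<xi> itself enters only when the locale is
  interpreted.\<close>

locale multiplicative_class =
  fixes Pi :: "'a set set"
  assumes UNIV_in: "UNIV \<in> Pi"
    and empty_in: "{} \<in> Pi"
    and Un_in: "A \<in> Pi \<Longrightarrow> B \<in> Pi \<Longrightarrow> A \<union> B \<in> Pi"
    and INT_in: "(\<And>n::nat. F n \<in> Pi) \<Longrightarrow> (\<Inter>n. F n) \<in> Pi"
begin

lemma Int_in:
  assumes "A \<in> Pi" "B \<in> Pi"
  shows "A \<inter> B \<in> Pi"
proof -
  have "(\<Inter>n::nat. if n = 0 then A else B) = A \<inter> B" by (auto split: if_splits)
  then show ?thesis using INT_in[of "\<lambda>n. if n = 0 then A else B"] assms by simp
qed

text \<open>
  \<open>splits \<P> \<Lambda> C\<close>: the set \<open>C\<close> is cut by a decreasing \<open>Pi\<close>-sequence of length less than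
  \<open>\<omega>\<^sup>\<Lambda>\<close> into members of \<open>\<P>\<close>; \<open>omega_splits \<P> \<Lambda> C\<close>: by one of length \<open>\<omega>\<^sup>\<Lambda>\<close>. The
  inductive form is what makes common refinements easy to obtain without natural sums of ordinals.
\<close>

inductive splits :: "'a set set \<Rightarrow> ordinal \<Rightarrow> 'a set \<Rightarrow> bool" for \<P> where
  empty: "splits \<P> \<Lambda> {}"
| base: "C \<in> \<P> \<Longrightarrow> 0 < \<Lambda> \<Longrightarrow> splits \<P> \<Lambda> C"
| cut: "P \<in> Pi \<Longrightarrow> splits \<P> \<Lambda> (C - P) \<Longrightarrow> splits \<P> \<Lambda> (C \<inter> P) \<Longrightarrow> splits \<P> \<Lambda> C"
| seq: "0 < \<kappa> \<Longrightarrow> \<kappa> < \<Lambda> \<Longrightarrow> (\<And>n::nat. P n \<in> Pi) \<Longrightarrow> (\<And>n. P (Suc n) \<subseteq> P n) \<Longrightarrow> C \<subseteq> P 0 \<Longrightarrow>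
    C \<inter> (\<Inter>n. P n) = {} \<Longrightarrow> (\<And>n. splits \<P> \<kappa> (C \<inter> P n - P (Suc n))) \<Longrightarrow> splits \<P> \<Lambda> C"

definition omega_splits :: "'a set set \<Rightarrow> ordinal \<Rightarrow> 'a set \<Rightarrow> bool" where
  "omega_splits \<P> \<Lambda> C \<longleftrightarrow> (\<exists>P::nat \<Rightarrow> 'a set. (\<forall>n. P n \<in> Pi) \<and> (\<forall>n. P (Suc n) \<subseteq> P n) \<and> C \<subseteq> P 0 \<and>
     C \<inter> (\<Inter>n. P n) = {} \<and> (\<forall>n. splits \<P> \<Lambda> (C \<inter> P n - P (Suc n))))"

lemma omega_splitsI:
  assumes "\<And>n::nat. P n \<in> Pi" "\<And>n. P (Suc n) \<subseteq> P n" "C \<subseteq> P 0" "C \<inter> (\<Inter>n. P n) = {}"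
    and "\<And>n. splits \<P> \<Lambda> (C \<inter> P n - P (Suc n))"
  shows "omega_splits \<P> \<Lambda> C"
  unfolding omega_splits_def using assms by blast

lemma omega_splitsE:
  assumes "omega_splits \<P> \<Lambda> C"
  obtains P :: "nat \<Rightarrow> 'a set" where "\<And>n. P n \<in> Pi" "\<And>n. P (Suc n) \<subseteq> P n" "C \<subseteq> P 0"
    "C \<inter> (\<Inter>n. P n) = {}" "\<And>n. splits \<P> \<Lambda> (C \<inter> P n - P (Suc n))"
  using assms unfolding omega_splits_def by blast

lemma splits_omega_splits:
  "omega_splits \<P> \<kappa> C \<Longrightarrow> 0 < \<kappa> \<Longrightarrow> \<kappa> < \<Lambda> \<Longrightarrow> splits \<P> \<Lambda> C"
  by (erule omega_splitsE) (rule splits.seq)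

lemma omega_splits_splits:
  assumes "splits \<P> \<Lambda> C"
  shows "omega_splits \<P> \<Lambda> C"
proof (rule omega_splitsI[of "\<lambda>n. if n = 0 then UNIV else {}"])
  show "splits \<P> \<Lambda> (C \<inter> (if n = 0 then UNIV else {}) - (if Suc n = 0 then UNIV else {}))" for n
    using assms by (cases n) (auto intro: splits.empty)
qed (auto simp: UNIV_in empty_in split: if_splits)

section \<open>Closure properties and common refinements\<close>

lemma splits_mono:
  assumes "splits \<P> \<kappa> C" "\<kappa> \<le> \<Lambda>"
  shows "splits \<P> \<Lambda> C"
  using assms
proof (induction rule: splits.induct)
  case (seq \<nu> \<kappa> P C)
  show ?case
  proof (rule splits.seq[where \<kappa> = \<nu> and P = P])
    show "\<nu> < \<Lambda>" using seq by auto
  qed (use seq.hyps in auto)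
qed (auto intro: splits.intros)

text \<open>The cutting sets are kept and only the pieces shrink. As a cut is just a trace on the
  set being cut, \<open>D\<close> may be arbitrary.\<close>

lemma splits_restrict:
  assumes "splits \<P> \<Lambda> C" "\<And>S. S \<in> \<P> \<Longrightarrow> S \<inter> D \<in> \<Q>"
  shows "splits \<Q> \<Lambda> (C \<inter> D)"
  using assms(1)
proof (induction rule: splits.induct)
  case (cut P \<Lambda> C)
  have eq: "C \<inter> D - P = (C - P) \<inter> D" "C \<inter> D \<inter> P = C \<inter> P \<inter> D" by auto
  show ?case
    by (rule splits.cut[OF cut.hyps(1)]; unfold eq) (rule cut.IH)+
next
  case (seq \<nu> \<Lambda> P C)
  have eq: "C \<inter> D \<inter> P n - P (Suc n) = (C \<inter> P n - P (Suc n)) \<inter> D" for n by auto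
  show ?case
  proof (rule splits.seq[where P = P, OF seq.hyps(1-4)])
    show "splits \<Q> \<nu> (C \<inter> D \<inter> P n - P (Suc n))" for n
      unfolding eq by (rule seq.IH)
  qed (use seq.hyps(5,6) in blast)+
qed (use assms(2) in \<open>auto intro: splits.intros\<close>)

lemma omega_splits_restrict:
  assumes "omega_splits \<P> \<Lambda> C" "\<And>S. S \<in> \<P> \<Longrightarrow> S \<inter> D \<in> \<Q>"
  shows "omega_splits \<Q> \<Lambda> (C \<inter> D)"
proof -
  obtain P where P: "\<And>n. P n \<in> Pi" "\<And>n. P (Suc n) \<subseteq> P n" "C \<subseteq> P 0"
    "C \<inter> (\<Inter>n. P n) = {}" "\<And>n. splits \<P> \<Lambda> (C \<inter> P n - P (Suc n))"
    using assms(1) omega_splitsE by blast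
  have eq: "C \<inter> D \<inter> P n - P (Suc n) = (C \<inter> P n - P (Suc n)) \<inter> D" for n by auto
  show ?thesis
  proof (rule omega_splitsI[where P = P, OF P(1,2)])
    show "splits \<Q> \<Lambda> (C \<inter> D \<inter> P n - P (Suc n))" for n
      unfolding eq by (rule splits_restrict[OF P(5) assms(2)])
  qed (use P(3,4) in blast)+
qed

lemma omega_splits_family_mono:
  assumes "omega_splits \<P> \<Lambda> C" "\<P> \<subseteq> \<Q>"
  shows "omega_splits \<Q> \<Lambda> C"
  using omega_splits_restrict[OF assms(1), of UNIV \<Q>] assms(2) by auto

text \<open>Finitely many initial blocks are assembled by \<open>cut\<close>, which does not raise
  the exponent.\<close>

lemma splits_prefix:
  assumes "\<And>n. P n \<in> Pi" "\<And>n. P (Suc n) \<subseteq> P n" "C \<subseteq> P 0"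
    and "\<And>n. splits \<P> \<Lambda> (C \<inter> P n - P (Suc n))"
  shows "splits \<P> \<Lambda> (C - P n)"
proof (induction n)
  case 0
  have "C - P 0 = {}" using assms by auto
  then show ?case using splits.empty by metis
next
  case (Suc n)
  have eq: "C - P (Suc n) - P n = C - P n" "(C - P (Suc n)) \<inter> P n = C \<inter> P n - P (Suc n)"
    using assms(2)[of n] by auto
  show ?case
    by (rule splits.cut[OF assms(1)[of n]]) (unfold eq, use Suc assms(4) in auto)
qed

text \<open>The two sequences are interleaved through the unions \<open>P n \<union> Q n\<close>. A
  point of block \<open>n\<close> of the unions is outside both \<open>P (Suc n)\<close> and
  \<open>Q (Suc n)\<close>, hence in two prefixes of length below
  \<open>\<omega>\<^sup>\<Lambda>\<close>. So only the merging of \<open>splits\<close> is needed,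
  and no ordinal sum of the two lengths is ever formed.\<close>

lemma omega_splits_merge_step:
  assumes "omega_splits \<P> \<Lambda> C" "omega_splits \<Q> \<Lambda> D"
    and merge: "\<And>C D. splits \<P> \<Lambda> C \<Longrightarrow> splits \<Q> \<Lambda> D \<Longrightarrow> splits \<R> \<Lambda> (C \<inter> D)"
    and subset: "\<And>S T. S \<in> \<R> \<Longrightarrow> S \<inter> T \<in> \<R>"
  shows "omega_splits \<R> \<Lambda> (C \<inter> D)"
proof -
  obtain P where P: "\<And>n. P n \<in> Pi" "\<And>n. P (Suc n) \<subseteq> P n" "C \<subseteq> P 0"
    "C \<inter> (\<Inter>n. P n) = {}" "\<And>n. splits \<P> \<Lambda> (C \<inter> P n - P (Suc n))"
    using assms(1) omega_splitsE by blast
  obtain Q where Q: "\<And>n. Q n \<in> Pi" "\<And>n. Q (Suc n) \<subseteq> Q n" "D \<subseteq> Q 0"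
    "D \<inter> (\<Inter>n. Q n) = {}" "\<And>n. splits \<Q> \<Lambda> (D \<inter> Q n - Q (Suc n))"
    using assms(2) omega_splitsE by blast
  have dec: "P n \<subseteq> P m" "Q n \<subseteq> Q m" if "m \<le> n" for m n
    using that P(2) Q(2) by (metis lift_Suc_antimono_le)+
  show ?thesis
  proof (rule omega_splitsI[of "\<lambda>n. P n \<union> Q n"])
    show "P n \<union> Q n \<in> Pi" for n using P Q Un_in by blast
    show "P (Suc n) \<union> Q (Suc n) \<subseteq> P n \<union> Q n" for n using P Q by blast
    show "C \<inter> D \<subseteq> P 0 \<union> Q 0" using P by blast
    show "C \<inter> D \<inter> (\<Inter>n. P n \<union> Q n) = {}"
    proof -
      have False if x: "x \<in> C" "x \<in> D" "\<And>n. x \<in> P n \<union> Q n" for x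
      proof -
        obtain m where m: "x \<notin> P m" using P(4) x by blast
        obtain n where n: "x \<notin> Q n" using Q(4) x by blast
        have "x \<notin> P (max m n)" "x \<notin> Q (max m n)" using m n dec by (meson max.cobounded1 max.cobounded2 subsetD)+
        then show False using x by blast
      qed
      then show ?thesis by blast
    qed
    fix n
    have "splits \<R> \<Lambda> ((C - P (Suc n)) \<inter> (D - Q (Suc n)))"
      by (rule merge; rule splits_prefix) (use P Q in auto)
    then have "splits \<R> \<Lambda> (((C - P (Suc n)) \<inter> (D - Q (Suc n))) \<inter> (P n \<union> Q n))"
      by (rule splits_restrict) (rule subset)
    moreover have "((C - P (Suc n)) \<inter> (D - Q (Suc n))) \<inter> (P n \<union> Q n) =
        C \<inter> D \<inter> (P n \<union> Q n) - (P (Suc n) \<union> Q (Suc n))" by auto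
    ultimately show "splits \<R> \<Lambda> (C \<inter> D \<inter> (P n \<union> Q n) - (P (Suc n) \<union> Q (Suc n)))" by simp
  qed
qed

lemma omega_splits_mono:
  assumes "omega_splits \<P> \<kappa> C" "\<kappa> \<le> \<Lambda>"
  shows "omega_splits \<P> \<Lambda> C"
  using assms splits_mono unfolding omega_splits_def by blast

text \<open>Induction over both derivations inside an induction on \<Lambda>. Cuts on either side
  are pulled out of the intersection, and a single piece merely restricts the other side. The one
  genuine case is a sequence on both sides: the two exponents are below \<Lambda>, so the outer
  hypothesis merges at the larger of them.\<close>

lemma splits_merge:
  assumes "splits \<P> \<Lambda> C" "splits \<Q> \<Lambda> D"
    and inter: "\<And>S T. S \<in> \<P> \<Longrightarrow> T \<in> \<Q> \<Longrightarrow> S \<inter> T \<in> \<R>"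
    and subset: "\<And>S T. S \<in> \<R> \<Longrightarrow> S \<inter> T \<in> \<R>"
  shows "splits \<R> \<Lambda> (C \<inter> D)"
  using assms(1,2)
proof (induction \<Lambda> arbitrary: C D rule: less_induct)
  case (less \<Lambda>)
  note outer = less.IH
  have "\<forall>D. splits \<Q> \<Lambda> D \<longrightarrow> splits \<R> \<Lambda> (C \<inter> D)" if "splits \<P> \<nu> C" "\<nu> = \<Lambda>" for \<nu> C
    using that
  proof (induction rule: splits.induct)
    case (empty \<nu>)
    then show ?case by (simp add: splits.empty)
  next
    case (base C \<nu>)
    show ?case
    proof (intro allI impI)
      fix D assume "splits \<Q> \<Lambda> D"
      then have "splits \<R> \<Lambda> (D \<inter> C)"
        by (rule splits_restrict) (metis Int_commute base.hyps(1) inter)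
      then show "splits \<R> \<Lambda> (C \<inter> D)" by (simp add: Int_commute)
    qed
  next
    case (cut P \<nu> C)
    show ?case
    proof (intro allI impI)
      fix D assume D: "splits \<Q> \<Lambda> D"
      have eq: "C \<inter> D - P = (C - P) \<inter> D" "C \<inter> D \<inter> P = C \<inter> P \<inter> D" by auto
      show "splits \<R> \<Lambda> (C \<inter> D)"
        by (rule splits.cut[OF cut.hyps(1)]; unfold eq) (use cut.IH cut.prems D in blast)+
    qed
  next
    case (seq \<kappa> \<nu> P C)
    have C: "omega_splits \<P> \<kappa> C" using seq.hyps by (intro omega_splitsI[of P]) auto
    have C': "splits \<P> \<Lambda> C" using C seq splits_omega_splits by blast
    have "splits \<R> \<Lambda> (C \<inter> D)" if "splits \<Q> \<tau> D" "\<tau> = \<Lambda>" for \<tau> D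
      using that
    proof (induction rule: splits.induct)
      case (empty \<tau>)
      then show ?case by (simp add: splits.empty)
    next
      case (base D \<tau>)
      then show ?case using C' inter by (metis splits_restrict)
    next
      case (cut Q \<tau> D)
      have eq: "C \<inter> D - Q = C \<inter> (D - Q)" "C \<inter> D \<inter> Q = C \<inter> (D \<inter> Q)" by auto
      show ?case
        by (rule splits.cut[OF cut.hyps(1)]; unfold eq) (use cut.IH cut.prems in blast)+
    next
      case (seq \<kappa>' \<tau> Q D)
      have D: "omega_splits \<Q> \<kappa>' D" using seq.hyps by (intro omega_splitsI[of Q]) auto
      let ?m = "max \<kappa> \<kappa>'"
      have m: "0 < ?m" "?m < \<Lambda>"
        using seq.hyps seq.prems \<open>\<kappa> < \<nu>\<close> \<open>\<nu> = \<Lambda>\<close> by (auto simp: less_max_iff_disj)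
      have "omega_splits \<R> ?m (C \<inter> D)"
        using omega_splits_mono[OF C, of ?m] omega_splits_mono[OF D, of ?m] outer[OF m(2)] subset
        by (intro omega_splits_merge_step) auto
      then show ?case using m splits_omega_splits by blast
    qed
    then show ?case by blast
  qed
  then show ?case using less.prems by blast
qed

lemma omega_splits_merge:
  assumes "omega_splits \<P> \<Lambda> C" "omega_splits \<Q> \<Lambda> D"
    and "\<And>S T. S \<in> \<P> \<Longrightarrow> T \<in> \<Q> \<Longrightarrow> S \<inter> T \<in> \<R>"
    and "\<And>S T. S \<in> \<R> \<Longrightarrow> S \<inter> T \<in> \<R>"
  shows "omega_splits \<R> \<Lambda> (C \<inter> D)"
  by (rule omega_splits_merge_step[OF assms(1,2) splits_merge]) (use assms in auto)

section \<open>Passing between inductive decompositions and ordinal indices\<close>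

text \<open>
  The ordinal form of a decomposition: \<open>r\<close> assigns to a point the index of its piece. The parity of the
  index is recorded, since a transfinite difference consists of the pieces with an even index.
\<close>

definition rank_on :: "'a set set \<Rightarrow> 'a set set \<Rightarrow> ordinal \<Rightarrow> 'a set \<Rightarrow> ('a \<Rightarrow> ordinal) \<Rightarrow> bool" where
  "rank_on \<P> \<Q> \<gamma> C r \<longleftrightarrow>
     (\<forall>x\<in>C. r x < \<gamma>) \<and>
     (\<forall>\<eta>. \<exists>P\<in>Pi. {x \<in> C. \<eta> \<le> r x} = C \<inter> P) \<and>
     (\<forall>\<eta>. {x \<in> C. r x = \<eta>} \<in> (if even_ordinal \<eta> then \<P> else \<Q>))"

text \<open>Concatenation: the index of a point is the total length of the earlier blocks plus its
  index within its own block. Even block lengths make every offset even, so local and global parity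
  agree, and the offsets stay below \<open>\<omega>\<^sup>\<kappa>\<close> by additive
  indecomposability.\<close>

lemma rank_on_seq:
  assumes "0 < \<kappa>" "\<kappa> < \<omega>\<^sub>1"
    and P: "\<And>n::nat. P n \<in> Pi" "\<And>n. P (Suc n) \<subseteq> P n" "C \<subseteq> P 0" "C \<inter> (\<Inter>n. P n) = {}"
    and pieces: "\<And>n. \<exists>\<gamma> r. \<gamma> < omega_pow \<kappa> \<and> even_ordinal \<gamma> \<and> rank_on \<P> \<Q> \<gamma> (C \<inter> P n - P (Suc n)) r"
    and subset: "\<And>S T. S \<in> \<P> \<Longrightarrow> T \<subseteq> S \<Longrightarrow> T \<in> \<P>" "\<And>S T. S \<in> \<Q> \<Longrightarrow> T \<subseteq> S \<Longrightarrow> T \<in> \<Q>"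
    and empty: "{} \<in> \<P>" "{} \<in> \<Q>"
  shows "\<exists>r. rank_on \<P> \<Q> (omega_pow \<kappa>) C r"
proof -
  let ?w = "omega_pow \<kappa>"
  have w1: "x < \<omega>\<^sub>1" if "x < ?w" for x using that ordinal_less_omega1_trans by blast
  obtain \<gamma> \<rho> where \<gamma>: "\<And>n. \<gamma> n < ?w" "\<And>n. even_ordinal (\<gamma> n)"
    and \<rho>: "\<And>n. rank_on \<P> \<Q> (\<gamma> n) (C \<inter> P n - P (Suc n)) (\<rho> n)"
    using pieces by metis
  define \<Gamma> where "\<Gamma> = rec_nat 0 (\<lambda>n g. oadd g (\<gamma> n))"
  have \<Gamma>_0: "\<Gamma> 0 = 0" and \<Gamma>_Suc: "\<Gamma> (Suc n) = oadd (\<Gamma> n) (\<gamma> n)" for n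
    by (simp_all add: \<Gamma>_def)
  have \<Gamma>: "\<Gamma> n < ?w" for n
    by (induction n) (simp_all add: \<Gamma>_0 \<Gamma>_Suc omega_pow_pos assms \<gamma> oadd_less_omega_pow)
  have \<Gamma>_even: "even_ordinal (\<Gamma> n)" for n
    by (induction n) (simp_all add: \<Gamma>_0 \<Gamma>_Suc even_ordinal_oadd w1 \<Gamma> \<gamma>)
  have \<Gamma>_mono: "\<Gamma> m \<le> \<Gamma> n" if "m \<le> n" for m n
    using that by (rule lift_Suc_mono_le[rotated]) (simp add: \<Gamma>_Suc le_oadd)
  have dec: "P n \<subseteq> P m" if "m \<le> n" for m n
    using that P(2) by (metis lift_Suc_antimono_le)
  \<comment> \<open>The block of \<open>x\<close>, that is, the last stage containing it.\<close>
  define N where "N x = (LEAST n. x \<notin> P (Suc n))" for x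
  have N: "x \<in> P (N x)" "x \<notin> P (Suc (N x))" if "x \<in> C" for x
  proof -
    obtain m where "x \<notin> P m" using P(4) \<open>x \<in> C\<close> by blast
    then have "x \<notin> P (Suc m)" using P(2) by blast
    then show "x \<notin> P (Suc (N x))" unfolding N_def by (rule LeastI)
    show "x \<in> P (N x)"
    proof (cases "N x")
      case 0
      then show ?thesis using P(3) \<open>x \<in> C\<close> by auto
    next
      case (Suc k)
      then have "k < N x" by simp
      then have "x \<in> P (Suc k)"
        using not_less_Least[of k "\<lambda>n. x \<notin> P (Suc n)"] unfolding N_def by blast
      then show ?thesis unfolding Suc .
    qed
  qed
  have N_iff: "x \<in> P m \<longleftrightarrow> m \<le> N x" if "x \<in> C" for x m
    using N[OF that] dec by (meson not_less_eq_eq subsetD)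
  define r where "r x = oadd (\<Gamma> (N x)) (\<rho> (N x) x)" for x
  have piece: "x \<in> C \<inter> P (N x) - P (Suc (N x))" if "x \<in> C" for x
    using N[OF that] that by auto
  have \<rho>_less: "\<rho> (N x) x < \<gamma> (N x)" if "x \<in> C" for x
    using piece[OF that] \<rho>[of "N x"] unfolding rank_on_def by blast
  have r_less: "r x < \<Gamma> (Suc (N x))" and r_ge: "\<Gamma> (N x) \<le> r x" if "x \<in> C" for x
    using \<rho>_less[OF that] w1[OF \<Gamma>] w1[OF \<gamma>(1)]
    by (auto simp: r_def \<Gamma>_Suc le_oadd intro!: oadd_strict_mono)
  have N_eq: "N x = n" if "x \<in> C" "\<Gamma> n \<le> r x" "r x < \<Gamma> (Suc n)" for x n
  proof (rule antisym)
    show "N x \<le> n"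
      using r_ge[OF that(1)] that \<Gamma>_mono[of "Suc n" "N x"] by (meson leD le_less_trans not_less_eq_eq order_trans)
    show "n \<le> N x"
      using r_less[OF that(1)] that \<Gamma>_mono[of "Suc (N x)" n] by (meson leD less_le_trans not_less_eq_eq order_trans)
  qed
  have "rank_on \<P> \<Q> ?w C r"
    unfolding rank_on_def
  proof (intro conjI allI ballI)
    show "r x < ?w" if "x \<in> C" for x
      using r_less[OF that] \<Gamma> less_trans by blast
    show "\<exists>Q\<in>Pi. {x \<in> C. \<eta> \<le> r x} = C \<inter> Q" for \<eta>
    proof (cases "\<exists>n. \<eta> < \<Gamma> (Suc n)")
      case False
      then have "\<not> \<eta> \<le> r x" if "x \<in> C" for x
        using r_less[OF that] le_less_trans by blast
      then have "{x \<in> C. \<eta> \<le> r x} = C \<inter> {}" by blast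
      then show ?thesis using empty_in by blast
    next
      case True
      define n where "n = (LEAST n. \<eta> < \<Gamma> (Suc n))"
      have n: "\<eta> < \<Gamma> (Suc n)" unfolding n_def using True by (rule LeastI_ex)
      have "\<Gamma> n \<le> \<eta>"
      proof (cases n)
        case (Suc k)
        then have "\<not> \<eta> < \<Gamma> (Suc k)" using not_less_Least[of k "\<lambda>n. \<eta> < \<Gamma> (Suc n)"] unfolding n_def by auto
        then show ?thesis using Suc by simp
      qed (simp add: \<Gamma>_0)
      then obtain \<zeta> where \<zeta>: "\<eta> = oadd (\<Gamma> n) \<zeta>" "\<zeta> \<le> \<eta>"
        using oadd_diff n ordinal_less_omega1_trans by metis
      have \<eta>1: "\<eta> < \<omega>\<^sub>1" using n ordinal_less_omega1_trans by blast
      obtain Q where Q: "Q \<in> Pi" "{x \<in> C \<inter> P n - P (Suc n). \<zeta> \<le> \<rho> n x} = (C \<inter> P n - P (Suc n)) \<inter> Q"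
        using \<rho>[of n] unfolding rank_on_def by blast
      \<comment> \<open>Later blocks lie entirely above \<eta> and earlier ones entirely below it;
        in block \<open>n\<close> the local set \<open>Q\<close> decides.\<close>
      have "\<eta> \<le> r x \<longleftrightarrow> x \<in> P (Suc n) \<union> (P n \<inter> Q)" if x: "x \<in> C" for x
      proof -
        consider "Suc n \<le> N x" | "N x = n" | "N x < n" by linarith
        then show ?thesis
        proof cases
          case 1
          then have "\<eta> \<le> r x" using n r_ge[OF x] \<Gamma>_mono[OF 1] by auto
          then show ?thesis using 1 x by (simp add: N_iff)
        next
          case 2
          have "\<rho> n x < \<omega>\<^sub>1" using \<rho>_less[OF x] 2 ordinal_less_omega1_trans by blast
          then have "\<eta> \<le> r x \<longleftrightarrow> \<zeta> \<le> \<rho> n x"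
            using 2 \<zeta> \<eta>1 w1[OF \<Gamma>] by (auto simp: r_def oadd_le_iff)
          also have "\<dots> \<longleftrightarrow> x \<in> Q" using Q piece[OF x] 2 by blast
          finally show ?thesis using 2 piece[OF x] by auto
        next
          case 3
          then have "\<not> \<eta> \<le> r x"
            using r_less[OF x] \<Gamma>_mono[of "Suc (N x)" n] \<open>\<Gamma> n \<le> \<eta>\<close> by (auto simp: Suc_le_eq)
          then show ?thesis using 3 x by (simp add: N_iff)
        qed
      qed
      then have "{x \<in> C. \<eta> \<le> r x} = C \<inter> (P (Suc n) \<union> (P n \<inter> Q))" by blast
      then show ?thesis using P(1) Q(1) Un_in Int_in by meson
    qed
    show "{x \<in> C. r x = \<eta>} \<in> (if even_ordinal \<eta> then \<P> else \<Q>)" for \<eta>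
    proof (cases "\<exists>x\<in>C. r x = \<eta>")
      case False
      then have "{x \<in> C. r x = \<eta>} = {}" by blast
      then show ?thesis using empty by metis
    next
      case True
      then obtain y where y: "y \<in> C" "r y = \<eta>" by blast
      define n where "n = N y"
      define \<zeta> where "\<zeta> = \<rho> n y"
      have less1: "\<rho> (N x) x < \<omega>\<^sub>1" if "x \<in> C" for x
        using \<rho>_less[OF that] ordinal_less_omega1_trans by blast
      have \<eta>: "\<eta> = oadd (\<Gamma> n) \<zeta>" using y by (simp add: r_def n_def \<zeta>_def)
      \<comment> \<open>An inclusion is enough, both families being closed under subsets.\<close>
      have sub: "{x \<in> C. r x = \<eta>} \<subseteq> {x \<in> C \<inter> P n - P (Suc n). \<rho> n x = \<zeta>}"
      proof safe
        fix x assume x: "x \<in> C" "\<eta> = r x"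
        have "N x = n"
          by (rule N_eq) (use x y r_less[of y] r_ge[of y] n_def in auto)
        then show "x \<in> P n" "x \<in> P (Suc n) \<Longrightarrow> False" "\<rho> n x = \<zeta>"
          using piece[OF x(1)] \<eta> x less1[OF x(1)] less1[OF y(1)] w1[OF \<Gamma>]
          by (auto simp: r_def oadd_eq_iff \<zeta>_def n_def)
      qed
      have "even_ordinal \<eta> \<longleftrightarrow> even_ordinal \<zeta>"
        using \<eta> less1[OF y(1)] by (simp add: even_ordinal_oadd \<Gamma>_even w1 \<Gamma> \<zeta>_def n_def)
      moreover have "{x \<in> C \<inter> P n - P (Suc n). \<rho> n x = \<zeta>} \<in> (if even_ordinal \<zeta> then \<P> else \<Q>)"
        using \<rho>[of n] unfolding rank_on_def by blast
      ultimately show ?thesis using sub subset by (metis (full_types))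
    qed
  qed
  then show ?thesis by blast
qed

text \<open>Sorting by parity is free: a single piece gets a block of length 2 and occupies the
  index whose parity fits its family. All lengths are kept even, so that later shifts preserve these
  parities.\<close>

lemma splits_rank_on:
  assumes "splits (\<P> \<union> \<Q>) \<Lambda> C" "\<Lambda> < \<omega>\<^sub>1"
    and subset: "\<And>S T. S \<in> \<P> \<Longrightarrow> T \<subseteq> S \<Longrightarrow> T \<in> \<P>" "\<And>S T. S \<in> \<Q> \<Longrightarrow> T \<subseteq> S \<Longrightarrow> T \<in> \<Q>"
    and empty: "{} \<in> \<P>" "{} \<in> \<Q>"
  shows "\<exists>\<gamma> r. \<gamma> < omega_pow \<Lambda> \<and> even_ordinal \<gamma> \<and> rank_on \<P> \<Q> \<gamma> C r"
  using assms(1,2)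
proof (induction rule: splits.induct)
  case (empty \<Lambda>)
  then show ?case
    by (intro exI[of _ 0]) (auto simp: rank_on_def omega_pow_pos assms(5,6) intro: empty_in)
next
  case (base C \<Lambda>)
  have lim: "is_limit (omega_pow \<Lambda>)" using base by (intro is_limit_omega_pow)
  have 0: "0 < \<omega>\<^sub>1" by (rule zero_less_omega1)
  have 01: "0 < osuc 0" "osuc 0 < osuc (osuc 0)" "osuc 0 < \<omega>\<^sub>1" "osuc (osuc 0) < omega_pow \<Lambda>"
    using lim is_limit_pos by (auto simp: less_osuc zero_less_omega1 osuc_less_omega1 is_limitD)
  define v where "v = (if C \<in> \<P> then 0 else osuc 0)"
  have v: "v < osuc (osuc 0)" using 01 by (auto simp: v_def intro: less_trans)
  have "rank_on \<P> \<Q> (osuc (osuc 0)) C (\<lambda>x. v)"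
    unfolding rank_on_def
  proof (intro conjI allI ballI)
    show "\<exists>P\<in>Pi. {x \<in> C. \<eta> \<le> v} = C \<inter> P" for \<eta>
      by (rule bexI[of _ "if \<eta> \<le> v then UNIV else {}"]) (auto simp: UNIV_in empty_in)
    show "{x \<in> C. v = \<eta>} \<in> (if even_ordinal \<eta> then \<P> else \<Q>)" for \<eta>
    proof (cases "v = \<eta>")
      case True
      then have "{x \<in> C. v = \<eta>} = C" by simp
      moreover have "C \<in> (if even_ordinal v then \<P> else \<Q>)"
        using base(1) 0 by (cases "C \<in> \<P>") (simp_all add: v_def)
      ultimately show ?thesis using True by simp
    next
      case False
      then have "{x \<in> C. v = \<eta>} = {}" by simp
      then show ?thesis using assms(5,6) by metis
    qed
  qed (rule v)
  moreover have "even_ordinal (osuc (osuc 0))" using 01 0 by simp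
  ultimately show ?case using 01 by blast
next
  case (cut P \<Lambda> C)
  obtain \<gamma> r where \<gamma>: "\<gamma> < omega_pow \<Lambda>" "even_ordinal \<gamma>" and r: "rank_on \<P> \<Q> \<gamma> (C - P) r"
    using cut by blast
  obtain \<delta> s where \<delta>: "\<delta> < omega_pow \<Lambda>" "even_ordinal \<delta>" and s: "rank_on \<P> \<Q> \<delta> (C \<inter> P) s"
    using cut by blast
  have 1: "\<gamma> < \<omega>\<^sub>1" "\<delta> < \<omega>\<^sub>1" using \<gamma> \<delta> ordinal_less_omega1_trans by blast+
  \<comment> \<open>The points of \<open>P\<close> come last, shifted by the even length \<gamma> of
    the part outside \<open>P\<close>.\<close>
  define t where "t x = (if x \<in> P then oadd \<gamma> (s x) else r x)" for x
  have r_less: "r x < \<gamma>" if "x \<in> C" "x \<notin> P" for x using r that unfolding rank_on_def by blast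
  have s_less: "s x < \<delta>" if "x \<in> C" "x \<in> P" for x using s that unfolding rank_on_def by blast
  have s1: "s x < \<omega>\<^sub>1" if "x \<in> C" "x \<in> P" for x using s_less[OF that] 1 by auto
  have "rank_on \<P> \<Q> (oadd \<gamma> \<delta>) C t"
    unfolding rank_on_def
  proof (intro conjI allI ballI)
    show "t x < oadd \<gamma> \<delta>" if "x \<in> C" for x
      using that 1 s_less less_le_trans[OF r_less le_oadd] by (auto simp: t_def intro!: oadd_strict_mono)
    fix \<eta>
    show "\<exists>Q\<in>Pi. {x \<in> C. \<eta> \<le> t x} = C \<inter> Q"
    proof (cases "\<eta> \<le> \<gamma>")
      case True
      obtain Q where Q: "Q \<in> Pi" "{x \<in> C - P. \<eta> \<le> r x} = (C - P) \<inter> Q"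
        using r unfolding rank_on_def by blast
      have "\<eta> \<le> t x \<longleftrightarrow> x \<in> P \<union> Q" if "x \<in> C" for x
        using Q(2) that order_trans[OF True le_oadd] by (auto simp: t_def)
      then have "{x \<in> C. \<eta> \<le> t x} = C \<inter> (P \<union> Q)" by blast
      then show ?thesis using Q(1) cut.hyps(1) Un_in by blast
    next
      case \<eta>\<gamma>: False
      show ?thesis
      proof (cases "\<eta> < \<omega>\<^sub>1")
        case True
        obtain \<zeta> where \<zeta>: "\<eta> = oadd \<gamma> \<zeta>" "\<zeta> \<le> \<eta>"
          using oadd_diff[of \<gamma> \<eta>] \<eta>\<gamma> True by (metis linear)
        obtain Q where Q: "Q \<in> Pi" "{x \<in> C \<inter> P. \<zeta> \<le> s x} = C \<inter> P \<inter> Q"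
          using s unfolding rank_on_def by blast
        have "\<eta> \<le> t x \<longleftrightarrow> x \<in> P \<inter> Q" if x: "x \<in> C" for x
        proof (cases "x \<in> P")
          case True
          have "\<eta> \<le> t x \<longleftrightarrow> \<zeta> \<le> s x"
            using True x \<zeta> \<open>\<eta> < \<omega>\<^sub>1\<close> 1 s1 by (auto simp: t_def oadd_le_iff)
          then show ?thesis using Q(2) True x by blast
        next
          case False
          then show ?thesis using r_less[OF x] \<eta>\<gamma> by (auto simp: t_def)
        qed
        then have "{x \<in> C. \<eta> \<le> t x} = C \<inter> (P \<inter> Q)" by blast
        then show ?thesis using Q(1) cut.hyps(1) Int_in by blast
      next
        case False
        have "t x < \<omega>\<^sub>1" if "x \<in> C" for x
          using that 1 s1 r_less[of x] by (auto simp: t_def oadd_less_omega1)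
        then have "{x \<in> C. \<eta> \<le> t x} = C \<inter> {}" using False by fastforce
        then show ?thesis using empty_in by blast
      qed
    qed
    show "{x \<in> C. t x = \<eta>} \<in> (if even_ordinal \<eta> then \<P> else \<Q>)"
    proof (cases "\<eta> < \<gamma>")
      case True
      have "{x \<in> C. t x = \<eta>} = {x \<in> C - P. r x = \<eta>}"
        using True not_less[THEN iffD2, OF le_oadd[of \<gamma>]] by (auto simp: t_def)
      then show ?thesis using r unfolding rank_on_def by simp
    next
      case False
      show ?thesis
      proof (cases "\<exists>x\<in>C. t x = \<eta>")
        case True
        then obtain y where y: "y \<in> C" "t y = \<eta>" by blast
        have yP: "y \<in> P" using y False r_less[of y] by (auto simp: t_def split: if_splits)
        have \<eta>: "\<eta> = oadd \<gamma> (s y)" using y yP by (simp add: t_def)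
        have "t x = \<eta> \<longleftrightarrow> x \<in> P \<and> s x = s y" if x: "x \<in> C" for x
        proof (cases "x \<in> P")
          case True
          then show ?thesis
            using oadd_eq_iff[OF 1(1) s1[OF x True] s1[OF y(1) yP]] \<eta> by (simp add: t_def)
        next
          case xP: False
          then show ?thesis using r_less[OF x xP] False by (auto simp: t_def)
        qed
        then have "{x \<in> C. t x = \<eta>} = {x \<in> C \<inter> P. s x = s y}" by blast
        moreover have "even_ordinal \<eta> \<longleftrightarrow> even_ordinal (s y)"
          using \<eta> \<gamma> 1 s1[OF y(1) yP] by (simp add: even_ordinal_oadd)
        ultimately show ?thesis using s unfolding rank_on_def by simp
      next
        case False
        then have "{x \<in> C. t x = \<eta>} = {}" by blast
        then show ?thesis using assms(5,6) by metis
      qed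
    qed
  qed
  then show ?case
    using oadd_less_omega_pow[OF \<gamma>(1) \<delta>(1) cut.prems] \<delta> \<gamma> 1 even_ordinal_oadd by blast
next
  case (seq \<kappa> \<Lambda> P C)
  have \<kappa>: "\<kappa> < \<omega>\<^sub>1" using seq by auto
  have "\<exists>r. rank_on \<P> \<Q> (omega_pow \<kappa>) C r"
    by (rule rank_on_seq[of \<kappa> P]) (use seq \<kappa> subset assms(5,6) in auto)
  moreover have "even_ordinal (omega_pow \<kappa>)" using is_limit_omega_pow seq \<kappa> by simp
  moreover have "omega_pow \<kappa> < omega_pow \<Lambda>" using seq by (intro omega_pow_strict_mono)
  ultimately show ?case by blast
qed

lemma omega_splits_rank_on:
  assumes "omega_splits (\<P> \<union> \<Q>) \<Lambda> C" "0 < \<Lambda>" "\<Lambda> < \<omega>\<^sub>1"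
    and "\<And>S T. S \<in> \<P> \<Longrightarrow> T \<subseteq> S \<Longrightarrow> T \<in> \<P>" "\<And>S T. S \<in> \<Q> \<Longrightarrow> T \<subseteq> S \<Longrightarrow> T \<in> \<Q>"
    and "{} \<in> \<P>" "{} \<in> \<Q>"
  obtains r where "rank_on \<P> \<Q> (omega_pow \<Lambda>) C r"
proof -
  obtain P where P: "\<And>n. P n \<in> Pi" "\<And>n. P (Suc n) \<subseteq> P n" "C \<subseteq> P 0"
    "C \<inter> (\<Inter>n. P n) = {}" "\<And>n. splits (\<P> \<union> \<Q>) \<Lambda> (C \<inter> P n - P (Suc n))"
    using assms(1) omega_splitsE by blast
  have "\<exists>r. rank_on \<P> \<Q> (omega_pow \<Lambda>) C r"
  proof (rule rank_on_seq[OF assms(2,3) P(1-4)])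
    show "\<exists>\<gamma> r. \<gamma> < omega_pow \<Lambda> \<and> even_ordinal \<gamma> \<and> rank_on \<P> \<Q> \<gamma> (C \<inter> P n - P (Suc n)) r" for n
      by (rule splits_rank_on[OF P(5)]) (use assms in auto)
  qed (use assms in auto)
  then show thesis using that by blast
qed

lemma rank_on_restrict:
  assumes "rank_on \<P> \<P> \<gamma> C r" "\<And>S T. S \<in> \<P> \<Longrightarrow> T \<subseteq> S \<Longrightarrow> T \<in> \<P>" "\<And>x. x \<in> D \<Longrightarrow> r x < \<delta>" "D \<subseteq> C"
  shows "rank_on \<P> \<P> \<delta> D r"
  unfolding rank_on_def
proof (intro conjI allI ballI)
  fix \<eta>
  obtain P where P: "P \<in> Pi" "{x \<in> C. \<eta> \<le> r x} = C \<inter> P"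
    using assms(1) unfolding rank_on_def by blast
  then have "{x \<in> D. \<eta> \<le> r x} = D \<inter> P" using assms(4) by blast
  then show "\<exists>P\<in>Pi. {x \<in> D. \<eta> \<le> r x} = D \<inter> P" using P by blast
  have "{x \<in> C. r x = \<eta>} \<in> \<P>" using assms(1) unfolding rank_on_def by simp
  moreover have "{x \<in> D. r x = \<eta>} \<subseteq> {x \<in> C. r x = \<eta>}" using assms(4) by blast
  ultimately show "{x \<in> D. r x = \<eta>} \<in> (if even_ordinal \<eta> then \<P> else \<P>)"
    using assms(2) by auto
qed (rule assms(3))

text \<open>The length is cut along a cofinal sequence. Each block contains only indices up to some
  \<open>z n\<close>, so its length is below \<open>\<omega>\<^sup>\<kappa>\<close> and
  \<open>small\<close> applies; that premise is a hook for an induction on the exponent.\<close>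

lemma rank_on_omega_splits_step:
  assumes "rank_on \<P> \<P> (omega_pow \<kappa>) C r" "0 < \<kappa>" "\<kappa> < \<omega>\<^sub>1"
    and subset: "\<And>S T. S \<in> \<P> \<Longrightarrow> T \<subseteq> S \<Longrightarrow> T \<in> \<P>"
    and small: "\<And>\<delta> D. \<delta> < omega_pow \<kappa> \<Longrightarrow> rank_on \<P> \<P> \<delta> D r \<Longrightarrow> splits \<P> \<kappa> D"
  shows "omega_splits \<P> \<kappa> C"
proof -
  let ?w = "omega_pow \<kappa>"
  have lim: "is_limit ?w" "?w < \<omega>\<^sub>1" using assms by (auto simp: is_limit_omega_pow omega_pow_less_omega1)
  obtain z :: "nat \<Rightarrow> ordinal" where z: "\<And>m n. m \<le> n \<Longrightarrow> z m \<le> z n" "\<And>n. z n < ?w"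
      "\<And>\<eta>. \<eta> < ?w \<Longrightarrow> \<exists>n. \<eta> \<le> z n"
    using even_cofinal_sequence[OF lim is_limit_pos[OF lim(1)]] by metis
  have "\<exists>P\<in>Pi. {x \<in> C. osuc (z n) \<le> r x} = C \<inter> P" for n
    using assms(1) unfolding rank_on_def by blast
  then obtain Q where Q: "\<And>n. Q n \<in> Pi" "\<And>n. {x \<in> C. osuc (z n) \<le> r x} = C \<inter> Q n" by metis
  \<comment> \<open>Inside \<open>C\<close> the set \<open>Q n\<close> consists of the points of
    index above \<open>z n\<close>, but outside \<open>C\<close> nothing is known about it, so the
    \<open>Q n\<close> need not decrease. Finite intersections repair this without changing the
    trace on \<open>C\<close>.\<close>
  define P where "P n = (case n of 0 \<Rightarrow> UNIV | Suc k \<Rightarrow> (\<Inter>i\<in>{..k}. Q i))" for n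
  have zw: "z n < \<omega>\<^sub>1" for n using z(2) lim by (meson less_trans)
  have Q_iff: "x \<in> Q n \<longleftrightarrow> z n < r x" if "x \<in> C" for x n
    using Q(2)[of n] that osuc_le_iff[OF zw, of n "r x"] by blast
  have P_iff: "x \<in> P (Suc n) \<longleftrightarrow> z n < r x" if "x \<in> C" for x n
    using that Q_iff le_less_trans[OF z(1)] by (auto simp: P_def)
  have PPi: "P n \<in> Pi" for n
  proof (cases n)
    case (Suc k)
    have "(\<Inter>i\<in>{..k}. Q i) = (\<Inter>i. Q (min i k))" by auto (metis min.absorb1)
    then show ?thesis using Suc INT_in[of "\<lambda>i. Q (min i k)"] Q by (simp add: P_def)
  qed (simp add: P_def UNIV_in)
  show ?thesis
  proof (rule omega_splitsI[of P])
    show "P (Suc n) \<subseteq> P n" for n by (cases n) (auto simp: P_def)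
    show "C \<subseteq> P 0" by (simp add: P_def)
    show "C \<inter> (\<Inter>n. P n) = {}"
    proof -
      have False if x: "x \<in> C" "\<And>n. x \<in> P n" for x
      proof -
        have "r x < ?w" using assms(1) x unfolding rank_on_def by blast
        then obtain n where "r x \<le> z n" using z(3) by blast
        then show False using x(2)[of "Suc n"] P_iff[OF x(1)] by auto
      qed
      then show ?thesis by blast
    qed
    show "splits \<P> \<kappa> (C \<inter> P n - P (Suc n))" for n
    proof (rule small)
      show "osuc (z n) < ?w" using z lim is_limitD by blast
      show "rank_on \<P> \<P> (osuc (z n)) (C \<inter> P n - P (Suc n)) r"
        by (rule rank_on_restrict[OF assms(1) subset])
          (auto simp: P_iff less_osuc_iff[OF zw])
    qed
  qed (rule PPi)
qed

text \<open>Induction along Cantor normal forms inside an induction on the exponent. A sum of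
  lengths becomes a cut at the first summand with left subtraction behind it, the power
  \<open>\<omega>\<^sup>0\<close> is a single piece, and a higher power is an \<omega>-sequence of
  shorter blocks, treated at its own smaller exponent.\<close>

lemma rank_on_splits:
  assumes "rank_on \<P> \<P> \<delta> C r" "\<delta> < omega_pow \<Lambda>" "\<Lambda> < \<omega>\<^sub>1"
    and subset: "\<And>S T. S \<in> \<P> \<Longrightarrow> T \<subseteq> S \<Longrightarrow> T \<in> \<P>"
  shows "splits \<P> \<Lambda> C"
  using assms(1-3)
proof (induction \<Lambda> arbitrary: \<delta> C r rule: less_induct)
  case (less \<Lambda>)
  have "\<forall>C r. rank_on \<P> \<P> \<delta> C r \<longrightarrow> splits \<P> \<Lambda> C"
    using less.prems(2,3)
  proof (induction rule: omega_pow_induct)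
    case zero
    then show ?case by (auto simp: rank_on_def) (metis equals0I splits.empty)
  next
    case (pow \<kappa>)
    have \<kappa>: "\<kappa> < \<omega>\<^sub>1" using pow less.prems by auto
    show ?case
    proof (intro allI impI)
      fix C r assume r: "rank_on \<P> \<P> (omega_pow \<kappa>) C r"
      show "splits \<P> \<Lambda> C"
      proof (cases "\<kappa> = 0")
        case True
        have "r x = 0" if "x \<in> C" for x
        proof -
          have "r x < osuc 0"
            using r that True by (auto simp: rank_on_def omega_pow_clauses one_ordinal_def)
          then show ?thesis using less_osuc_iff[OF zero_less_omega1] by (metis antisym ordinal_zero_le)
        qed
        then have "{x \<in> C. r x = 0} = C" by blast
        moreover have "{x \<in> C. r x = 0} \<in> \<P>"
          using r unfolding rank_on_def by simp
        ultimately show ?thesis using pow by (intro splits.base) (auto intro: le_less_trans[OF ordinal_zero_le])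
      next
        case False
        then have "0 < \<kappa>" by (simp add: less_le)
        then have "omega_splits \<P> \<kappa> C"
          using less.IH[OF pow] \<kappa> by (intro rank_on_omega_splits_step[OF r _ \<kappa> subset]) auto
        then show ?thesis using splits_omega_splits \<open>0 < \<kappa>\<close> pow by blast
      qed
    qed
  next
    case (add a b)
    have 1: "a < \<omega>\<^sub>1" "b < \<omega>\<^sub>1" using add ordinal_less_omega1_trans by blast+
    show ?case
    proof (intro allI impI)
      fix C r assume r: "rank_on \<P> \<P> (oadd a b) C r"
      obtain P where P: "P \<in> Pi" "{x \<in> C. a \<le> r x} = C \<inter> P"
        using r unfolding rank_on_def by blast
      have r1: "r x < \<omega>\<^sub>1" if "x \<in> C" for x
        using r that ordinal_less_omega1_trans unfolding rank_on_def by blast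
      \<comment> \<open>Left subtraction of \<open>a\<close>; the value matters only on
        \<open>C \<inter> P\<close>, where the index is at least \<open>a\<close>.\<close>
      define s where "s x = (SOME y. y \<le> r x \<and> r x = oadd a y)" for x
      have s: "s x \<le> r x" "r x = oadd a (s x)" if "x \<in> C \<inter> P" for x
      proof -
        have "x \<in> {x \<in> C. a \<le> r x}" unfolding P(2) by (rule that)
        then have "a \<le> r x" "r x < \<omega>\<^sub>1" using r1 by auto
        then have "\<exists>y. y \<le> r x \<and> r x = oadd a y" by (rule oadd_diff) blast
        then have "s x \<le> r x \<and> r x = oadd a (s x)" unfolding s_def by (rule someI_ex)
        then show "s x \<le> r x" "r x = oadd a (s x)" by auto
      qed
      have s1: "s x < \<omega>\<^sub>1" if "x \<in> C \<inter> P" for x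
        using s(1)[OF that] r1[of x] that by auto
      have "rank_on \<P> \<P> a (C - P) r"
      proof (rule rank_on_restrict[OF r subset])
        show "r x < a" if "x \<in> C - P" for x
        proof -
          have "x \<notin> {x \<in> C. a \<le> r x}" unfolding P(2) using that by simp
          then show ?thesis using that by auto
        qed
      qed auto
      moreover have "rank_on \<P> \<P> b (C \<inter> P) s"
        unfolding rank_on_def
      proof (intro conjI allI ballI)
        show "s x < b" if "x \<in> C \<inter> P" for x
        proof -
          have "r x < oadd a b" using r that unfolding rank_on_def by blast
          then have "oadd a (s x) < oadd a b" unfolding s(2)[OF that, symmetric] .
          then show ?thesis unfolding oadd_less_iff[OF 1(1) s1[OF that] 1(2)] .
        qed
        fix \<eta>
        show "\<exists>Q\<in>Pi. {x \<in> C \<inter> P. \<eta> \<le> s x} = C \<inter> P \<inter> Q"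
        proof (cases "\<eta> < \<omega>\<^sub>1")
          case True
          obtain Q where Q: "Q \<in> Pi" "{x \<in> C. oadd a \<eta> \<le> r x} = C \<inter> Q"
            using r unfolding rank_on_def by blast
          have "\<eta> \<le> s x \<longleftrightarrow> oadd a \<eta> \<le> r x" if "x \<in> C \<inter> P" for x
            using s(2)[OF that] s1[OF that] True 1 by (simp add: oadd_le_iff)
          then have "{x \<in> C \<inter> P. \<eta> \<le> s x} = C \<inter> P \<inter> Q" using Q(2) by blast
          then show ?thesis using Q by blast
        next
          case False
          then have "{x \<in> C \<inter> P. \<eta> \<le> s x} = C \<inter> P \<inter> {}" using s1 by fastforce
          then show ?thesis using empty_in by blast
        qed
        have "{x \<in> C \<inter> P. s x = \<eta>} \<subseteq> {x \<in> C. r x = oadd a \<eta>}" using s(2) by auto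
        moreover have "{x \<in> C. r x = oadd a \<eta>} \<in> \<P>"
          using r unfolding rank_on_def by (metis (full_types))
        ultimately show "{x \<in> C \<inter> P. s x = \<eta>} \<in> (if even_ordinal \<eta> then \<P> else \<P>)"
          using subset by auto
      qed
      ultimately have "splits \<P> \<Lambda> (C - P)" "splits \<P> \<Lambda> (C \<inter> P)"
        using add.IH by blast+
      then show "splits \<P> \<Lambda> C" by (rule splits.cut[OF P(1)])
    qed
  qed
  then show ?case using less.prems by blast
qed

lemma rank_on_omega_splits:
  assumes "rank_on \<P> \<P> (omega_pow \<Lambda>) C r" "0 < \<Lambda>" "\<Lambda> < \<omega>\<^sub>1"
    and "\<And>S T. S \<in> \<P> \<Longrightarrow> T \<subseteq> S \<Longrightarrow> T \<in> \<P>"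
  shows "omega_splits \<P> \<Lambda> C"
proof (rule rank_on_omega_splits_step[OF assms])
  show "splits \<P> \<Lambda> D" if "\<delta> < omega_pow \<Lambda>" "rank_on \<P> \<P> \<delta> D r" for \<delta> D
    by (rule rank_on_splits[OF that(2,1) assms(3,4)])
qed

end

section \<open>Alternating sums\<close>

text \<open>Formulated for all ordinals: a sequence continued by 0 beyond its length is again of
  this kind, so no length has to be carried along.\<close>

definition dec_seq :: "(ordinal \<Rightarrow> 'a \<Rightarrow> real) \<Rightarrow> bool" where
  "dec_seq F \<longleftrightarrow> (\<forall>\<eta> \<theta> x. \<eta> \<le> \<theta> \<longrightarrow> F \<theta> x \<le> F \<eta> x) \<and> (\<forall>\<eta> x. 0 \<le> F \<eta> x)"

lemma dec_seqD: "dec_seq F \<Longrightarrow> \<eta> \<le> \<theta> \<Longrightarrow> F \<theta> x \<le> F \<eta> x"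
  and dec_seq_nonneg: "dec_seq F \<Longrightarrow> 0 \<le> F \<eta> x"
  by (auto simp: dec_seq_def)

lemma altsum_cong:
  assumes "\<And>\<eta>. \<eta> < \<theta> \<Longrightarrow> F \<eta> x = G \<eta> x"
  shows "altsum F \<theta> x = altsum G \<theta> x"
  using assms
proof (induction \<theta> rule: ordinal_induct)
  case (limit \<theta>)
  then show ?case by (auto simp: altsum_clauses intro!: SUP_cong)
qed (auto simp: altsum_clauses)

text \<open>
  The alternating sum over \<open>[\<zeta>, \<theta>)\<close> with both ends even lies between \<open>0\<close> and the
  total decrease of the sequence. The lower bound \<open>m\<close> lets the induction pass through odd stages.
\<close>

lemma altsum_between:
  assumes F: "dec_seq F" and "\<theta> < \<omega>\<^sub>1"
    and \<zeta>: "even_ordinal \<zeta>" "\<zeta> \<le> \<theta>" and m: "\<And>\<eta>. \<eta> < \<theta> \<Longrightarrow> m \<le> F \<eta> x" "m \<le> F \<zeta> x"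
  shows "if even_ordinal \<theta>
    then altsum F \<zeta> x \<le> altsum F \<theta> x \<and> altsum F \<theta> x \<le> altsum F \<zeta> x + (F \<zeta> x - m)
    else altsum F \<zeta> x + m \<le> altsum F \<theta> x \<and> altsum F \<theta> x \<le> altsum F \<zeta> x + F \<zeta> x"
  using assms(2-)
proof (induction \<theta> arbitrary: \<zeta> m rule: ordinal_induct)
  case zero
  then have "\<zeta> = 0" by (simp add: antisym)
  then show ?case using zero by simp
next
  case (suc \<theta>)
  show ?case
  proof (cases "\<zeta> = osuc \<theta>")
    case True
    then show ?thesis using suc.prems by simp
  next
    case False
    then have \<zeta>\<theta>: "\<zeta> \<le> \<theta>" using suc by (metis le_less less_osuc_iff)
    have le: "F \<theta> x \<le> F \<eta> x" if "\<eta> < \<theta>" for \<eta> using dec_seqD[OF F] that by simp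
    \<comment> \<open>The induction hypothesis is used with \<open>F \<theta> x\<close> as the lower
      bound, since this is the amount that stage \<theta> adds or subtracts; \<open>m\<close>
      returns only through \<open>m \<le> F \<theta> x\<close>.\<close>
    have IH: "if even_ordinal \<theta>
      then altsum F \<zeta> x \<le> altsum F \<theta> x \<and> altsum F \<theta> x \<le> altsum F \<zeta> x + (F \<zeta> x - F \<theta> x)
      else altsum F \<zeta> x + F \<theta> x \<le> altsum F \<theta> x \<and> altsum F \<theta> x \<le> altsum F \<zeta> x + F \<zeta> x"
      using suc.prems(2) \<zeta>\<theta> dec_seqD[OF F] le by (intro suc.IH suc.hyps(1)) auto
    have "m \<le> F \<theta> x" using suc by auto
    then show ?thesis
      using IH suc.hyps by (simp add: altsum_clauses osign_def split: if_splits)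
  qed
next
  case (limit \<theta>)
  let ?S = "\<lambda>\<zeta>. altsum F \<zeta> x"
  show ?case
  proof (cases "\<zeta> = \<theta>")
    case True
    then show ?thesis using limit.prems by simp
  next
    case False
    then have \<zeta>\<theta>: "\<zeta> < \<theta>" using limit by auto
    have 1: "\<tau> < \<omega>\<^sub>1" if "\<tau> < \<theta>" for \<tau> using that limit.prems by auto
    have bound: "?S \<tau> \<le> ?S \<zeta> + (F \<zeta> x - m)" if \<tau>: "\<tau> < \<theta>" "even_ordinal \<tau>" for \<tau>
    proof (cases "\<zeta> \<le> \<tau>")
      case True
      then show ?thesis
        using limit.IH[OF \<tau>(1) 1[OF \<tau>(1)] limit.prems(2) True, of m] limit.prems \<tau>
        by (auto intro: less_trans)
    next
      case False
      \<comment> \<open>Now \<tau> precedes \<zeta>, and the hypothesis at \<zeta> with start \<tau>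
        says that sums at even stages increase.\<close>
      then have "?S \<tau> \<le> ?S \<zeta>"
        using limit.IH[OF \<zeta>\<theta> 1[OF \<zeta>\<theta>] \<tau>(2), of m] limit.prems \<tau> \<zeta>\<theta>
        by (auto intro: less_trans)
      then show ?thesis using limit.prems by simp
    qed
    let ?E = "{\<zeta>. \<zeta> < \<theta> \<and> even_ordinal \<zeta>}"
    have "?S \<zeta> \<le> (SUP \<tau>\<in>?E. ?S \<tau>)"
      using \<zeta>\<theta> limit.prems bound by (intro cSUP_upper bdd_aboveI2) auto
    moreover have "(SUP \<tau>\<in>?E. ?S \<tau>) \<le> ?S \<zeta> + (F \<zeta> x - m)"
      using \<zeta>\<theta> limit.prems bound by (intro cSUP_least) auto
    ultimately show ?thesis using limit.hyps by (simp add: altsum_clauses)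
  qed
qed

lemma altsum_bounds:
  assumes "dec_seq F" "\<theta> < \<omega>\<^sub>1"
  shows "0 \<le> altsum F \<theta> x" "altsum F \<theta> x \<le> F 0 x"
  using altsum_between[OF assms even_ordinal_0 ordinal_zero_le, of 0 x] dec_seq_nonneg[OF assms(1)]
  by (auto simp: altsum_clauses split: if_splits)

text \<open>At a limit, the sum of the suprema is the supremum of the sums because both families
  increase along even stages: values taken at two different stages are dominated at the later
  one.\<close>

lemma altsum_add:
  assumes F: "dec_seq F" and G: "dec_seq G" and "\<theta> < \<omega>\<^sub>1"
  shows "altsum (\<lambda>\<eta> x. F \<eta> x + G \<eta> x) \<theta> x = altsum F \<theta> x + altsum G \<theta> x"
  using assms(3)
proof (induction \<theta> rule: ordinal_induct)
  case zero
  then show ?case by (simp add: altsum_clauses)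
next
  case (suc \<theta>)
  then show ?case by (simp add: altsum_clauses algebra_simps)
next
  case (limit \<theta>)
  let ?E = "{\<zeta>. \<zeta> < \<theta> \<and> even_ordinal \<zeta>}"
  have E: "?E \<noteq> {}" using is_limit_pos[OF limit.hyps] by auto
  have 1: "\<tau> < \<omega>\<^sub>1" if "\<tau> \<in> ?E" for \<tau> using that limit.prems by auto
  have bdd: "bdd_above ((\<lambda>\<zeta>. altsum H \<zeta> x) ` ?E)" if "dec_seq H" for H :: "ordinal \<Rightarrow> 'a \<Rightarrow> real"
    using altsum_bounds(2)[OF that 1] by (intro bdd_aboveI2) auto
  have mono: "altsum H \<sigma> x \<le> altsum H \<tau> x" if "dec_seq H" "\<sigma> \<in> ?E" "\<tau> \<in> ?E" "\<sigma> \<le> \<tau>"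
    for H :: "ordinal \<Rightarrow> 'a \<Rightarrow> real" and \<sigma> \<tau>
    using altsum_between[OF that(1) 1[OF that(3)] _ that(4), of 0 x] that dec_seq_nonneg[OF that(1)]
    by auto
  let ?f = "\<lambda>\<zeta>. altsum F \<zeta> x" and ?g = "\<lambda>\<zeta>. altsum G \<zeta> x"
  have "(SUP \<zeta>\<in>?E. ?f \<zeta> + ?g \<zeta>) = (SUP \<zeta>\<in>?E. ?f \<zeta>) + (SUP \<zeta>\<in>?E. ?g \<zeta>)"
  proof (rule antisym)
    show "(SUP \<zeta>\<in>?E. ?f \<zeta> + ?g \<zeta>) \<le> (SUP \<zeta>\<in>?E. ?f \<zeta>) + (SUP \<zeta>\<in>?E. ?g \<zeta>)"
      by (rule cSUP_least[OF E]) (intro add_mono cSUP_upper bdd F G; assumption)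
    have bdd': "bdd_above ((\<lambda>\<zeta>. ?f \<zeta> + ?g \<zeta>) ` ?E)"
      by (rule bdd_aboveI2[of _ _ "F 0 x + G 0 x"])
        (intro add_mono altsum_bounds(2) F G 1; assumption)
    have *: "?f \<sigma> + ?g \<tau> \<le> (SUP \<zeta>\<in>?E. ?f \<zeta> + ?g \<zeta>)" if "\<sigma> \<in> ?E" "\<tau> \<in> ?E" for \<sigma> \<tau>
    proof -
      have m: "max \<sigma> \<tau> \<in> ?E" using that by (cases "\<sigma> \<le> \<tau>") (auto simp: max_def)
      have "?f \<sigma> + ?g \<tau> \<le> ?f (max \<sigma> \<tau>) + ?g (max \<sigma> \<tau>)"
        by (intro add_mono mono F G m that) auto
      also have "\<dots> \<le> (SUP \<zeta>\<in>?E. ?f \<zeta> + ?g \<zeta>)" using m bdd' by (rule cSUP_upper)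
      finally show ?thesis .
    qed
    have "?f \<sigma> \<le> (SUP \<zeta>\<in>?E. ?f \<zeta> + ?g \<zeta>) - (SUP \<zeta>\<in>?E. ?g \<zeta>)" if "\<sigma> \<in> ?E" for \<sigma>
    proof -
      have "(SUP \<zeta>\<in>?E. ?g \<zeta>) \<le> (SUP \<zeta>\<in>?E. ?f \<zeta> + ?g \<zeta>) - ?f \<sigma>"
        by (rule cSUP_least[OF E]) (use *[OF that] in \<open>simp add: algebra_simps\<close>)
      then show ?thesis by simp
    qed
    then have "(SUP \<zeta>\<in>?E. ?f \<zeta>) \<le> (SUP \<zeta>\<in>?E. ?f \<zeta> + ?g \<zeta>) - (SUP \<zeta>\<in>?E. ?g \<zeta>)"
      by (rule cSUP_least[OF E])
    then show "(SUP \<zeta>\<in>?E. ?f \<zeta>) + (SUP \<zeta>\<in>?E. ?g \<zeta>) \<le> (SUP \<zeta>\<in>?E. ?f \<zeta> + ?g \<zeta>)" by simp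
  qed
  moreover have "(SUP \<zeta>\<in>?E. altsum (\<lambda>\<eta> x. F \<eta> x + G \<eta> x) \<zeta> x) = (SUP \<zeta>\<in>?E. ?f \<zeta> + ?g \<zeta>)"
    using limit.IH 1 by (intro SUP_cong) auto
  ultimately show ?case using limit.hyps by (simp add: altsum_clauses)
qed

section \<open>Functions with small oscillation on the pieces\<close>

definition small_osc :: "('a \<Rightarrow> real) \<Rightarrow> real \<Rightarrow> 'a set set" where
  "small_osc u \<epsilon> = {S. \<forall>x\<in>S. \<forall>y\<in>S. \<bar>u x - u y\<bar> \<le> \<epsilon>}"

lemma small_osc_subset: "S \<in> small_osc u \<epsilon> \<Longrightarrow> T \<subseteq> S \<Longrightarrow> T \<in> small_osc u \<epsilon>"
  by (auto simp: small_osc_def)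

lemma small_osc_empty [simp]: "{} \<in> small_osc u \<epsilon>"
  by (simp add: small_osc_def)

lemma small_osc_add:
  "S \<in> small_osc u \<epsilon> \<Longrightarrow> T \<in> small_osc v \<delta> \<Longrightarrow> S \<inter> T \<in> small_osc (\<lambda>x. u x + v x) (\<epsilon> + \<delta>)"
  unfolding small_osc_def
proof (intro CollectI ballI)
  fix x y assume *: "S \<in> {S. \<forall>x\<in>S. \<forall>y\<in>S. \<bar>u x - u y\<bar> \<le> \<epsilon>}"
    "T \<in> {S. \<forall>x\<in>S. \<forall>y\<in>S. \<bar>v x - v y\<bar> \<le> \<delta>}" "x \<in> S \<inter> T" "y \<in> S \<inter> T"
  then have "\<bar>u x - u y\<bar> \<le> \<epsilon>" "\<bar>v x - v y\<bar> \<le> \<delta>" by blast+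
  then show "\<bar>(u x + v x) - (u y + v y)\<bar> \<le> \<epsilon> + \<delta>" by linarith
qed

section \<open>Alternating sums oscillate little on suitable pieces\<close>

context multiplicative_class
begin

text \<open>For the closed sets this is upper semicontinuity; for the multiplicative class \<xi> it
  is \<open>semi_borel \<xi>\<close>, seen through complements.\<close>

definition upper :: "('a \<Rightarrow> real) \<Rightarrow> bool" where
  "upper g \<longleftrightarrow> (\<forall>c. {x. c \<le> g x} \<in> Pi)"

text \<open>A function bounded on \<open>C\<close> meets only finitely many levels of width
  \<epsilon> there, so finitely many cuts isolate them and the exponent does not grow.\<close>

lemma splits_levels:
  assumes g: "upper g" and bound: "\<And>x. x \<in> C \<Longrightarrow> 0 \<le> g x \<and> g x \<le> M" and "0 < \<epsilon>"
    and level: "\<And>i::nat. splits \<P> \<Lambda> (C \<inter> {x. real i * \<epsilon> \<le> g x \<and> g x < real (Suc i) * \<epsilon>})"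
  shows "splits \<P> \<Lambda> C"
proof -
  have *: "splits \<P> \<Lambda> (C \<inter> {x. g x < real n * \<epsilon>})" for n
  proof (induction n)
    case 0
    have "C \<inter> {x. g x < real 0 * \<epsilon>} = {}" using bound by force
    then show ?case by (metis splits.empty)
  next
    case (Suc n)
    let ?P = "{x. real n * \<epsilon> \<le> g x}"
    have P: "?P \<in> Pi" using g unfolding upper_def by blast
    have le: "real n * \<epsilon> \<le> real (Suc n) * \<epsilon>" using assms(3) by (simp add: algebra_simps)
    have eq: "C \<inter> {x. g x < real (Suc n) * \<epsilon>} - ?P = C \<inter> {x. g x < real n * \<epsilon>}"
      "C \<inter> {x. g x < real (Suc n) * \<epsilon>} \<inter> ?P = C \<inter> {x. real n * \<epsilon> \<le> g x \<and> g x < real (Suc n) * \<epsilon>}"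
      using le by auto
    show ?case by (rule splits.cut[OF P]; unfold eq) (rule Suc level)+
  qed
  obtain n where "M < real n * \<epsilon>" using assms(3) reals_Archimedean3 by blast
  then have "C \<inter> {x. g x < real n * \<epsilon>} = C" using bound by force
  then show ?thesis using *[of n] by simp
qed

lemma splits_upper:
  assumes "upper g" "\<And>x. 0 \<le> g x \<and> g x \<le> M" "0 < \<epsilon>" "0 < \<Lambda>"
  shows "splits (small_osc g \<epsilon>) \<Lambda> UNIV"
proof (rule splits_levels[OF assms(1) assms(2) assms(3)])
  show "splits (small_osc g \<epsilon>) \<Lambda> (UNIV \<inter> {x. real i * \<epsilon> \<le> g x \<and> g x < real (Suc i) * \<epsilon>})" for i
    using assms(4) by (intro splits.base) (auto simp: small_osc_def algebra_simps)
qed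

text \<open>Points are sorted by the first \<open>z n\<close> with
  \<open>F (z n) x < m + \<epsilon>\<close>. From this stage to \<theta> the sum grows by at most
  \<epsilon>, by \<open>altsum_between\<close>; together with the oscillation up to
  \<open>z n\<close> this gives \<open>2 * \<epsilon>\<close>. The reference \<open>u\<close> stands
  for the sum at the start of a segment, or for 0.\<close>

lemma omega_splits_block:
  fixes z :: "nat \<Rightarrow> ordinal"
  assumes F: "dec_seq F" "\<And>\<eta>. \<eta> < \<theta> \<Longrightarrow> upper (F \<eta>)" and \<theta>: "\<theta> < \<omega>\<^sub>1" "even_ordinal \<theta>"
    and z: "\<And>m n. m \<le> n \<Longrightarrow> z m \<le> z n" "\<And>n. z n < \<theta>" "\<And>n. even_ordinal (z n)"
    and C: "\<And>x \<eta>. x \<in> C \<Longrightarrow> \<eta> < \<theta> \<Longrightarrow> m \<le> F \<eta> x" "\<And>x. x \<in> C \<Longrightarrow> \<exists>n. F (z n) x < m + \<epsilon>"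
    and small: "\<And>n. splits (small_osc (\<lambda>x. altsum F (z n) x - u x) \<epsilon>) \<kappa> UNIV"
  shows "omega_splits (small_osc (\<lambda>x. altsum F \<theta> x - u x) (2 * \<epsilon>)) \<kappa> C"
proof -
  define P where "P n = (case n of 0 \<Rightarrow> UNIV | Suc k \<Rightarrow> {x. m + \<epsilon> \<le> F (z k) x})" for n
  show ?thesis
  proof (rule omega_splitsI[of P])
    show "P n \<in> Pi" for n
      using F(2)[OF z(2)] by (cases n) (auto simp: P_def UNIV_in upper_def)
    show "P (Suc n) \<subseteq> P n" for n
      using order_trans[OF _ dec_seqD[OF F(1) z(1)]] by (cases n) (auto simp: P_def)
    show "C \<subseteq> P 0" by (simp add: P_def)
    show "C \<inter> (\<Inter>n. P n) = {}"
    proof -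
      have False if x: "x \<in> C" "\<And>n. x \<in> P n" for x
      proof -
        obtain n where "F (z n) x < m + \<epsilon>" using C(2) x by blast
        then show False using x(2)[of "Suc n"] by (simp add: P_def)
      qed
      then show ?thesis by blast
    qed
    fix n
    let ?D = "C \<inter> P n - P (Suc n)"
    have "splits (small_osc (\<lambda>x. altsum F \<theta> x - u x) (2 * \<epsilon>)) \<kappa> (UNIV \<inter> ?D)"
    proof (rule splits_restrict[OF small[of n]])
      fix S assume S: "S \<in> small_osc (\<lambda>x. altsum F (z n) x - u x) \<epsilon>"
      have near: "altsum F (z n) x \<le> altsum F \<theta> x \<and> altsum F \<theta> x \<le> altsum F (z n) x + \<epsilon>"
        if "x \<in> ?D" for x
        using altsum_between[OF F(1) \<theta>(1) z(3)[of n] less_imp_le[OF z(2)], of m x] that C(1) \<theta>(2) z(2)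
        by (auto simp: P_def)
      show "S \<inter> ?D \<in> small_osc (\<lambda>x. altsum F \<theta> x - u x) (2 * \<epsilon>)"
        unfolding small_osc_def
      proof (intro CollectI ballI)
        fix x y assume xy: "x \<in> S \<inter> ?D" "y \<in> S \<inter> ?D"
        have "\<bar>(altsum F (z n) x - u x) - (altsum F (z n) y - u y)\<bar> \<le> \<epsilon>"
          using S xy unfolding small_osc_def by blast
        then show "\<bar>(altsum F \<theta> x - u x) - (altsum F \<theta> y - u y)\<bar> \<le> 2 * \<epsilon>"
          using near[of x] near[of y] xy unfolding abs_le_iff by auto
      qed
    qed
    then show "splits (small_osc (\<lambda>x. altsum F \<theta> x - u x) (2 * \<epsilon>)) \<kappa> ?D" by simp
  qed
qed

text \<open>The start \<gamma> of the segment must be arbitrary, since a normal form is processed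
  summand by summand and each summand starts where the previous one ended. A single term is handled
  by its own levels; over a segment of length \<open>\<omega>\<^sup>\<kappa>\<close> with
  \<open>\<kappa> > 0\<close> the levels of the infimum of the terms provide the regions that
  \<open>omega_splits_block\<close> requires.\<close>

lemma splits_altsum_diff:
  assumes F: "dec_seq F" "\<And>\<eta>. upper (F \<eta>)" "\<And>x. F 0 x \<le> M"
    and "\<delta> < omega_pow \<Lambda>" "0 < \<Lambda>" "\<Lambda> < \<omega>\<^sub>1" "\<gamma> < \<omega>\<^sub>1" "0 < \<epsilon>"
  shows "splits (small_osc (\<lambda>x. altsum F (oadd \<gamma> \<delta>) x - altsum F \<gamma> x) \<epsilon>) \<Lambda> UNIV"
  using assms(4-)
proof (induction \<Lambda> arbitrary: \<delta> \<gamma> \<epsilon> rule: less_induct)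
  case (less \<Lambda>)
  have bound: "0 \<le> F \<eta> x \<and> F \<eta> x \<le> M" for \<eta> x
    using order_trans[OF dec_seqD[OF F(1) ordinal_zero_le] F(3)] dec_seq_nonneg[OF F(1)] by blast
  have "\<forall>\<gamma> \<epsilon>. \<gamma> < \<omega>\<^sub>1 \<longrightarrow> 0 < \<epsilon> \<longrightarrow>
      splits (small_osc (\<lambda>x. altsum F (oadd \<gamma> \<delta>) x - altsum F \<gamma> x) \<epsilon>) \<Lambda> UNIV"
    using less.prems(1,3)
  proof (induction rule: omega_pow_induct)
    case zero
    then show ?case using less.prems by (auto intro!: splits.base simp: small_osc_def)
  next
    case (add a b)
    have 1: "a < \<omega>\<^sub>1" "b < \<omega>\<^sub>1" using add ordinal_less_omega1_trans by blast+
    show ?case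
    proof (intro allI impI)
      fix \<gamma> and \<epsilon> :: real assume \<gamma>: "\<gamma> < \<omega>\<^sub>1" and \<epsilon>: "0 < \<epsilon>"
      let ?u = "\<lambda>x. altsum F (oadd \<gamma> a) x - altsum F \<gamma> x"
      let ?v = "\<lambda>x. altsum F (oadd (oadd \<gamma> a) b) x - altsum F (oadd \<gamma> a) x"
      have "splits (small_osc ?u (\<epsilon> / 2)) \<Lambda> UNIV" "splits (small_osc ?v (\<epsilon> / 2)) \<Lambda> UNIV"
        using add.IH \<gamma> \<epsilon> 1 oadd_less_omega1 by simp_all
      then have "splits (small_osc (\<lambda>x. ?u x + ?v x) (\<epsilon> / 2 + \<epsilon> / 2)) \<Lambda> (UNIV \<inter> UNIV)"
      proof (rule splits_merge)
        show "S \<inter> T \<in> small_osc (\<lambda>x. ?u x + ?v x) (\<epsilon> / 2 + \<epsilon> / 2)"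
          if "S \<in> small_osc ?u (\<epsilon> / 2)" "T \<in> small_osc ?v (\<epsilon> / 2)" for S T
          using small_osc_add[OF that] .
      qed (rule small_osc_subset, auto)
      then show "splits (small_osc (\<lambda>x. altsum F (oadd \<gamma> (oadd a b)) x - altsum F \<gamma> x) \<epsilon>) \<Lambda> UNIV"
        using \<gamma> 1 by (simp add: oadd_assoc)
    qed
  next
    case (pow \<kappa>)
    have \<kappa>: "\<kappa> < \<omega>\<^sub>1" using pow less.prems by auto
    show ?case
    proof (intro allI impI)
      fix \<gamma> and \<epsilon> :: real assume \<gamma>: "\<gamma> < \<omega>\<^sub>1" and \<epsilon>: "0 < \<epsilon>"
      define \<theta> where "\<theta> = oadd \<gamma> (omega_pow \<kappa>)"
      let ?R = "small_osc (\<lambda>x. altsum F \<theta> x - altsum F \<gamma> x) \<epsilon>"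
      have "splits ?R \<Lambda> UNIV"
      proof (cases "\<kappa> = 0")
        case True
        have "\<theta> = osuc \<gamma>"
          using True zero_less_omega1 by (simp add: \<theta>_def omega_pow_clauses one_ordinal_def oadd_clauses)
        then have "altsum F \<theta> x - altsum F \<gamma> x = osign \<gamma> * F \<gamma> x" for x
          using \<gamma> by (simp add: altsum_clauses)
        then have "?R = small_osc (F \<gamma>) \<epsilon>"
          by (auto simp: small_osc_def osign_def)
        then show ?thesis using splits_upper[OF F(2) bound \<epsilon> less.prems(2)] by simp
      next
        case False
        then have \<kappa>0: "0 < \<kappa>" by (simp add: less_le)
        have w: "omega_pow \<kappa> < \<omega>\<^sub>1" using \<kappa> by (rule omega_pow_less_omega1)
        have \<theta>: "is_limit \<theta>" "\<theta> < \<omega>\<^sub>1" "\<gamma> < \<theta>"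
          using \<kappa> \<kappa>0 w \<gamma> oadd_strict_mono[OF \<gamma> w omega_pow_pos[OF \<kappa>]]
          by (auto simp: \<theta>_def is_limit_oadd is_limit_omega_pow oadd_less_omega1)
        obtain z :: "nat \<Rightarrow> ordinal" where z: "\<And>m n. m \<le> n \<Longrightarrow> z m \<le> z n" "\<And>n. \<gamma> \<le> z n"
          "\<And>n. z n < \<theta>" "\<And>n. even_ordinal (z n)" "\<And>\<eta>. \<eta> < \<theta> \<Longrightarrow> \<exists>n. \<eta> \<le> z n"
          using even_cofinal_sequence[OF \<theta>] by blast
        have small: "splits (small_osc (\<lambda>x. altsum F (z n) x - altsum F \<gamma> x) (\<epsilon> / 2)) \<kappa> UNIV" for n
        proof -
          have z1: "z n < \<omega>\<^sub>1" using z(3) \<theta>(2) less_trans by blast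
          obtain \<tau> where \<tau>: "\<tau> \<le> z n" "z n = oadd \<gamma> \<tau>" using oadd_diff[OF z(2) z1] .
          then have \<tau>1: "\<tau> < \<omega>\<^sub>1" using z1 by auto
          have "oadd \<gamma> \<tau> < oadd \<gamma> (omega_pow \<kappa>)" using z(3) unfolding \<theta>_def \<tau>(2)[symmetric] .
          then have "\<tau> < omega_pow \<kappa>" using oadd_less_iff[OF \<gamma> \<tau>1 w] by blast
          then show ?thesis
            unfolding \<tau>(2) using less.IH[OF pow] \<kappa> \<kappa>0 \<gamma> \<epsilon> by simp
        qed
        \<comment> \<open>By cofinality this is the infimum over all indices below \<theta>; written
          with countably many of them it is visibly \<open>upper\<close>.\<close>
        define g where "g x = (INF n. F (z n) x)" for x
        have bdd: "bdd_below (range (\<lambda>n. F (z n) x))" for x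
          using bound by (intro bdd_belowI2) blast
        have "{x. c \<le> g x} = (\<Inter>n. {x. c \<le> F (z n) x})" for c
          unfolding g_def using le_cINF_iff[OF _ bdd] by auto
        then have g: "upper g"
          using F(2) INT_in[of "\<lambda>n. {x. _ \<le> F (z n) x}"] unfolding upper_def by metis
        have g_le: "g x \<le> F \<eta> x" if "\<eta> < \<theta>" for x \<eta>
        proof -
          obtain n where "\<eta> \<le> z n" using z(5) \<open>\<eta> < \<theta>\<close> by blast
          then have "F (z n) x \<le> F \<eta> x" by (rule dec_seqD[OF F(1)])
          moreover have "g x \<le> F (z n) x" unfolding g_def using bdd by (intro cINF_lower) auto
          ultimately show ?thesis by simp
        qed
        have g_bound: "0 \<le> g x \<and> g x \<le> M" for x
          using bound g_le[of 0 x] is_limit_pos[OF \<theta>(1)]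
          by (auto simp: g_def intro!: cINF_greatest intro: order_trans)
        show ?thesis
        \<comment> \<open>Levels have width \<open>\<epsilon> / 2\<close> because
          \<open>omega_splits_block\<close> doubles the error.\<close>
        proof (rule splits_levels[OF g g_bound, where \<epsilon> = "\<epsilon> / 2"])
          fix i
          let ?m = "real i * (\<epsilon> / 2)"
          let ?C = "UNIV \<inter> {x. ?m \<le> g x \<and> g x < real (Suc i) * (\<epsilon> / 2)}"
          have "omega_splits (small_osc (\<lambda>x. altsum F \<theta> x - altsum F \<gamma> x) (2 * (\<epsilon> / 2))) \<kappa> ?C"
          proof (rule omega_splits_block[OF F(1,2) \<theta>(2) even_ordinal_limit[OF \<theta>(1)] z(1,3,4)])
            show "?m \<le> F \<eta> x" if "x \<in> ?C" "\<eta> < \<theta>" for x \<eta>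
              using that g_le[of \<eta> x] by auto
            show "\<exists>n. F (z n) x < ?m + \<epsilon> / 2" if "x \<in> ?C" for x
            proof -
              have "g x < ?m + \<epsilon> / 2" using that by (simp add: algebra_simps)
              then show ?thesis unfolding g_def using bdd by (subst (asm) cINF_less_iff) auto
            qed
          qed (rule small | assumption)+
          then show "splits ?R \<Lambda> ?C" using splits_omega_splits[OF _ \<kappa>0 pow] by simp
        qed (use \<epsilon> in auto)
      qed
      then show "splits (small_osc (\<lambda>x. altsum F (oadd \<gamma> (omega_pow \<kappa>)) x - altsum F \<gamma> x) \<epsilon>) \<Lambda> UNIV"
        by (simp add: \<theta>_def)
    qed
  qed
  then show ?case using less.prems by blast
qed

text \<open>At the full length the terms tend to 0 at every point, so
  \<open>omega_splits_block\<close> applies to the whole space with \<open>m = 0\<close>; without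
  slicing, the result stays an \<omega>-sequence at the exponent \<Lambda> itself. Shorter lengths
  are covered by \<open>splits_altsum_diff\<close>.\<close>

lemma omega_splits_altsum:
  assumes F: "dec_seq F" "\<And>\<eta>. upper (F \<eta>)" "\<And>x. F 0 x \<le> M"
    and \<mu>: "\<mu> \<le> omega_pow \<Lambda>" "0 < \<Lambda>" "\<Lambda> < \<omega>\<^sub>1" "0 < \<epsilon>"
    and vanish: "\<And>x \<epsilon>. is_limit \<mu> \<Longrightarrow> 0 < \<epsilon> \<Longrightarrow> \<exists>\<eta><\<mu>. F \<eta> x < \<epsilon>"
  shows "omega_splits (small_osc (altsum F \<mu>) \<epsilon>) \<Lambda> UNIV"
proof -
  have small: "splits (small_osc (\<lambda>x. altsum F \<delta> x - 0) \<epsilon>) \<Lambda> UNIV"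
    if "\<delta> < omega_pow \<Lambda>" "0 < \<epsilon>" for \<delta> \<epsilon>
    using splits_altsum_diff[OF F that(1) \<mu>(2,3) zero_less_omega1 that(2)]
    by (simp add: altsum_clauses)
  show ?thesis
  proof (cases "\<mu> = omega_pow \<Lambda>")
    case False
    then show ?thesis using small \<mu> omega_splits_splits by simp
  next
    case True
    have lim: "is_limit \<mu>" "\<mu> < \<omega>\<^sub>1"
      using True \<mu> by (auto simp: is_limit_omega_pow omega_pow_less_omega1)
    obtain z :: "nat \<Rightarrow> ordinal" where z: "\<And>m n. m \<le> n \<Longrightarrow> z m \<le> z n"
      "\<And>n. z n < \<mu>" "\<And>n. even_ordinal (z n)" "\<And>\<eta>. \<eta> < \<mu> \<Longrightarrow> \<exists>n. \<eta> \<le> z n"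
      using even_cofinal_sequence[OF lim is_limit_pos[OF lim(1)]] by metis
    have "omega_splits (small_osc (\<lambda>x. altsum F \<mu> x - 0) (2 * (\<epsilon> / 2))) \<Lambda> UNIV"
    proof (rule omega_splits_block[OF F(1,2) lim(2) even_ordinal_limit[OF lim(1)] z(1,2,3), where m = 0])
      show "\<exists>n. F (z n) x < 0 + \<epsilon> / 2" for x
      proof -
        obtain \<eta> where "\<eta> < \<mu>" "F \<eta> x < \<epsilon> / 2" using vanish[OF lim(1), of "\<epsilon> / 2" x] \<mu> by auto
        moreover obtain n where "\<eta> \<le> z n" using z(4) \<open>\<eta> < \<mu>\<close> by blast
        ultimately show ?thesis using dec_seqD[OF F(1), of \<eta> "z n" x] by (intro exI[of _ n]) auto
      qed
      show "splits (small_osc (\<lambda>x. altsum F (z n) x - 0) (\<epsilon> / 2)) \<Lambda> UNIV" for n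
        by (rule small) (use z(2)[of n] True \<mu>(4) in simp_all)
    qed (rule dec_seq_nonneg[OF F(1)] | assumption)+
    then show ?thesis by simp
  qed
qed

end

section \<open>Functions with small oscillation on pieces as alternating sums\<close>

context multiplicative_class
begin

text \<open>\<open>f x + g x < c\<close> means that some rational \<open>q\<close> has
  \<open>f x < q\<close> and \<open>g x < c - q\<close>. The complement is a countable intersection
  of unions of two sets.\<close>

lemma upper_add:
  assumes "upper f" "upper g"
  shows "upper (\<lambda>x. f x + g x)"
proof -
  define q :: "nat \<Rightarrow> real" where "q n = of_rat (from_nat n)" for n
  have "{x. c \<le> f x + g x} = (\<Inter>n. {x. q n \<le> f x} \<union> {x. c - q n \<le> g x})" for c
  proof (intro set_eqI iffI)
    fix x assume "x \<in> (\<Inter>n. {x. q n \<le> f x} \<union> {x. c - q n \<le> g x})"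
    then have *: "q n \<le> f x \<or> c - q n \<le> g x" for n by blast
    show "x \<in> {x. c \<le> f x + g x}"
    proof (rule ccontr)
      assume "x \<notin> {x. c \<le> f x + g x}"
      then have "f x < c - g x" by simp
      then obtain r where "f x < of_rat r" "of_rat r < c - g x" using of_rat_dense by blast
      moreover have "of_rat r = q (to_nat r)" by (simp add: q_def)
      ultimately show False using *[of "to_nat r"] by simp
    qed
  qed auto
  moreover have "{x. a \<le> f x} \<union> {x. b \<le> g x} \<in> Pi" for a b
    using assms Un_in unfolding upper_def by blast
  ultimately show ?thesis unfolding upper_def using INT_in by simp
qed

lemma upper_zero: "upper (\<lambda>x. 0)"
  unfolding upper_def
proof
  fix c :: real
  show "{x. c \<le> 0} \<in> Pi" using UNIV_in empty_in by (cases "c \<le> 0") auto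
qed

lemma upper_sum: "(\<And>i. i < n \<Longrightarrow> upper (f i)) \<Longrightarrow> upper (\<lambda>x. \<Sum>i<n. f i x)" for n :: nat
  by (induction n) (auto simp: upper_zero upper_add)

text \<open>The tail after \<open>n\<close> terms is at most \<open>b n\<close> at every point, and
  \<open>b n\<close> tends to 0. Hence the series is at least \<open>c\<close> exactly when each
  partial sum is at least \<open>c - b n\<close>.\<close>

lemma upper_suminf:
  assumes "\<And>i. upper (f i)" "\<And>i x. 0 \<le> f i x \<and> f i x \<le> K / 2 ^ i"
  shows "upper (\<lambda>x. \<Sum>i. f i x)"
proof -
  have geo: "summable (\<lambda>i. K / 2 ^ i)"
    using summable_mult[OF summable_geometric[of "1/2::real"], of K] by (simp add: power_divide)
  have f: "summable (\<lambda>i. f i x)" for x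
    using assms(2) by (intro summable_comparison_test'[OF geo, of 0]) auto
  define b where "b n = (\<Sum>i. K / 2 ^ (i + n))" for n
  have b: "b \<longlonglongrightarrow> 0" unfolding b_def by (rule suminf_exist_split2[OF geo])
  have "{x. c \<le> (\<Sum>i. f i x)} = (\<Inter>n. {x. c - b n \<le> (\<Sum>i<n. f i x)})" for c
  proof (intro set_eqI iffI)
    fix x assume x: "x \<in> {x. c \<le> (\<Sum>i. f i x)}"
    have "c - b n \<le> (\<Sum>i<n. f i x)" for n
    proof -
      have "(\<Sum>i. f (i + n) x) \<le> b n"
        unfolding b_def using assms(2) f geo
        by (intro suminf_le) (auto simp: summable_iff_shift[of "\<lambda>i. f i x"] summable_iff_shift[of "\<lambda>i. K / 2 ^ i"])
      then show ?thesis using suminf_split_initial_segment[OF f, of x n] x by simp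
    qed
    then show "x \<in> (\<Inter>n. {x. c - b n \<le> (\<Sum>i<n. f i x)})" by blast
  next
    fix x assume "x \<in> (\<Inter>n. {x. c - b n \<le> (\<Sum>i<n. f i x)})"
    then have *: "c - b n \<le> (\<Sum>i<n. f i x)" for n by blast
    have "(\<lambda>n. c - b n) \<longlonglongrightarrow> c - 0" by (intro tendsto_intros b)
    then have "c - 0 \<le> (\<Sum>i. f i x)"
      using * by (intro LIMSEQ_le[OF _ summable_LIMSEQ[OF f]]) auto
    then show "x \<in> {x. c \<le> (\<Sum>i. f i x)}" by simp
  qed
  moreover have "upper (\<lambda>x. \<Sum>i<n. f i x)" for n using assms(1) by (rule upper_sum)
  ultimately show ?thesis
    unfolding upper_def using INT_in by simp
qed

definition approximable :: "ordinal \<Rightarrow> ('a \<Rightarrow> real) \<Rightarrow> bool" where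
  "approximable \<Lambda> u \<longleftrightarrow> (\<forall>\<epsilon>>0. omega_splits (small_osc u \<epsilon>) \<Lambda> UNIV)"

text \<open>
  If \<open>r\<close> indexes pieces by even ordinals and \<open>v\<close> is constant on pieces, the sequence \<open>h\<close> below
  equals \<open>K\<close> before the index of a point, \<open>v\<close> at it and \<open>0\<close> after it. The terms
  before the index cancel in pairs, so the alternating sum is \<open>v\<close>.
\<close>

lemma altsum_step:
  assumes u: "\<And>x. 0 \<le> u x \<and> u x \<le> K" "approximable \<Lambda> u" and "0 < K" and \<Lambda>: "0 < \<Lambda>" "\<Lambda> < \<omega>\<^sub>1"
  defines "\<mu> \<equiv> omega_pow \<Lambda>"
  shows "\<exists>h. dec_seq h \<and> (\<forall>\<eta><\<mu>. upper (h \<eta>)) \<and> (\<forall>\<eta> x. h \<eta> x \<le> K) \<and>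
    (\<forall>x. \<exists>\<eta><\<mu>. \<forall>\<theta>>\<eta>. h \<theta> x = 0) \<and>
    (\<forall>x. 0 \<le> u x - altsum h \<mu> x \<and> u x - altsum h \<mu> x \<le> K / 2) \<and>
    approximable \<Lambda> (\<lambda>x. u x - altsum h \<mu> x)"
proof -
  have \<mu>: "is_limit \<mu>" "\<mu> < \<omega>\<^sub>1"
    using \<Lambda> by (auto simp: \<mu>_def is_limit_omega_pow omega_pow_less_omega1)
  have "omega_splits (small_osc u (K / 2)) \<Lambda> UNIV"
    using u(2) \<open>0 < K\<close> unfolding approximable_def by simp
  \<comment> \<open>With \<open>{{}}\<close> as the family for odd indices, no point can receive an
    odd index.\<close>
  then have "omega_splits (small_osc u (K / 2) \<union> {{}}) \<Lambda> UNIV"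
    by (rule omega_splits_family_mono) blast
  then obtain r where r: "rank_on (small_osc u (K / 2)) {{}} \<mu> UNIV r"
    unfolding \<mu>_def by (rule omega_splits_rank_on[OF _ \<Lambda>]) (auto intro: small_osc_subset)
  have r_less: "r x < \<mu>" for x using r unfolding rank_on_def by blast
  have r1: "r x < \<omega>\<^sub>1" for x using r_less \<mu>(2) less_trans by blast
  have r_even: "even_ordinal (r x)" for x
  proof (rule ccontr)
    assume "\<not> even_ordinal (r x)"
    then have "{y \<in> UNIV. r y = r x} \<in> {{}}" using r unfolding rank_on_def by (metis (full_types))
    then show False by blast
  qed
  have r_osc: "\<bar>u y - u z\<bar> \<le> K / 2" if "r y = r x" "r z = r x" for x y z
  proof -
    have "{y \<in> UNIV. r y = r x} \<in> small_osc u (K / 2)"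
      using r r_even[of x] unfolding rank_on_def by (metis (full_types))
    then show ?thesis using that by (simp add: small_osc_def)
  qed
  have r_Pi: "{x. \<eta> \<le> r x} \<in> Pi" for \<eta>
    using r unfolding rank_on_def by simp
  \<comment> \<open>The infimum over the piece keeps \<open>u - v\<close> nonnegative, and
    oscillation at most \<open>K / 2\<close> bounds it by \<open>K / 2\<close>: the next step starts
    with half the bound.\<close>
  define v where "v x = (INF y\<in>{y. r y = r x}. u y)" for x
  have bdd: "bdd_below (u ` S)" for S using u(1) by (intro bdd_belowI2) blast
  have v_fiber: "v x = v y" if "r x = r y" for x y using that by (simp add: v_def)
  have v_le: "v x \<le> u x" for x
    unfolding v_def using bdd by (intro cINF_lower) auto
  have v_ge: "u x - K / 2 \<le> v x" for x
    unfolding v_def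
  proof (rule cINF_greatest)
    show "u x - K / 2 \<le> u y" if "y \<in> {y. r y = r x}" for y
    proof -
      have "\<bar>u x - u y\<bar> \<le> K / 2" using that by (intro r_osc[of x x y]) auto
      then show ?thesis unfolding abs_le_iff by linarith
    qed
  qed auto
  have v_nonneg: "0 \<le> v x" for x
    unfolding v_def using u(1) by (intro cINF_greatest) auto
  have v_K: "v x \<le> K" for x using v_le[of x] u(1)[of x] by simp
  define h where "h \<eta> x = (if r x < \<eta> then 0 else if r x = \<eta> then v x else K)" for \<eta> x
  have h: "dec_seq h"
    unfolding dec_seq_def h_def using v_nonneg v_K \<open>0 < K\<close> by (auto simp: not_less)
  have upper_h: "upper (h \<eta>)" if "\<eta> < \<mu>" for \<eta>
    unfolding upper_def
  proof
    fix c
    have \<eta>1: "\<eta> < \<omega>\<^sub>1" using that \<mu>(2) by auto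
    \<comment> \<open>As \<open>v\<close> is constant on the piece of index \<eta>, a superlevel set
      of \<open>h \<eta>\<close> contains that piece entirely or not at all. For
      \<open>0 < c \<le> K\<close> it thus consists of the indices from \<eta> or from
      \<open>osuc \<eta>\<close> on.\<close>
    consider "c \<le> 0" | "K < c" | "0 < c" "c \<le> K" "\<exists>y. r y = \<eta> \<and> c \<le> v y"
      | "0 < c" "c \<le> K" "\<nexists>y. r y = \<eta> \<and> c \<le> v y" by fastforce
    then show "{x. c \<le> h \<eta> x} \<in> Pi"
    proof cases
      case 1
      then have "{x. c \<le> h \<eta> x} = UNIV" using order_trans[OF 1 dec_seq_nonneg[OF h]] by blast
      then show ?thesis using UNIV_in by simp
    next
      case 2
      have "h \<eta> x < c" for x using 2 v_K[of x] \<open>0 < K\<close> by (auto simp: h_def)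
      then have "{x. c \<le> h \<eta> x} = {}" by (auto simp: not_le)
      then show ?thesis using empty_in by simp
    next
      case 3
      then obtain y where y: "r y = \<eta>" "c \<le> v y" by blast
      have "c \<le> h \<eta> x \<longleftrightarrow> \<eta> \<le> r x" for x
      proof (cases "r x = \<eta>")
        case True
        then have "v x = v y" using y(1) by (intro v_fiber) simp
        then show ?thesis using True y(2) by (simp add: h_def)
      next
        case False
        then show ?thesis using 3(1,2) by (auto simp: h_def)
      qed
      then have "{x. c \<le> h \<eta> x} = {x. \<eta> \<le> r x}" by blast
      then show ?thesis using r_Pi by simp
    next
      case 4
      have "c \<le> h \<eta> x \<longleftrightarrow> \<eta> < r x" for x
      proof (cases "r x = \<eta>")
        case True
        then have "\<not> c \<le> v x" using 4(3) by blast
        then show ?thesis using True by (simp add: h_def)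
      next
        case False
        then show ?thesis using 4(1,2) by (auto simp: h_def)
      qed
      then have "{x. c \<le> h \<eta> x} = {x. osuc \<eta> \<le> r x}" using osuc_le_iff[OF \<eta>1] by blast
      then show ?thesis using r_Pi by simp
    qed
  qed
  have sum: "altsum h \<theta> x = (if r x < \<theta> then v x else if even_ordinal \<theta> then 0 else K)"
    if "\<theta> < \<omega>\<^sub>1" for \<theta> x
    using that
  proof (induction \<theta> rule: ordinal_induct)
    case zero
    then show ?case by (simp add: altsum_clauses)
  next
    case (suc \<theta>)
    then show ?case
      using r_even[of x] by (auto simp: altsum_clauses less_osuc_iff h_def osign_def)
  next
    case (limit \<theta>)
    let ?E = "{\<zeta>. \<zeta> < \<theta> \<and> even_ordinal \<zeta>}"
    have E: "?E \<noteq> {}" using is_limit_pos[OF limit.hyps] by auto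
    have IH: "altsum h \<zeta> x = (if r x < \<zeta> then v x else 0)" if "\<zeta> \<in> ?E" for \<zeta>
      using that limit by auto
    have eq: "altsum h \<theta> x = (SUP \<zeta>\<in>?E. if r x < \<zeta> then v x else 0)"
      using limit.hyps IH by (auto simp: altsum_clauses intro!: SUP_cong)
    show ?case
    proof (cases "r x < \<theta>")
      case False
      then have "(SUP \<zeta>\<in>?E. if r x < \<zeta> then v x else 0) = (SUP \<zeta>\<in>?E. 0)"
        by (intro SUP_cong) auto
      then show ?thesis using eq False E limit.hyps by simp
    next
      case True
      \<comment> \<open>The first even stage after \<open>r x\<close>, where the supremum is already
        attained.\<close>
      let ?\<zeta> = "osuc (osuc (r x))"
      have \<zeta>: "?\<zeta> \<in> ?E" "r x < ?\<zeta>"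
        using True limit.hyps r1 r_even less_trans[OF less_osuc[OF r1] less_osuc[OF osuc_less_omega1[OF r1]]]
        by (auto simp: is_limitD osuc_less_omega1)
      have "(SUP \<zeta>\<in>?E. if r x < \<zeta> then v x else 0) = v x"
      proof (rule cSup_eq_maximum)
        show "v x \<in> (\<lambda>\<zeta>. if r x < \<zeta> then v x else 0) ` ?E" using \<zeta> by (intro image_eqI[of _ _ ?\<zeta>]) auto
      qed (use v_nonneg in auto)
      then show ?thesis using eq True by simp
    qed
  qed
  have sum_\<mu>: "altsum h \<mu> x = v x" for x using sum[OF \<mu>(2)] r_less by simp
  have "approximable \<Lambda> (\<lambda>x. u x - v x)"
    unfolding approximable_def
  proof (intro allI impI)
    fix \<epsilon> :: real assume "0 < \<epsilon>"
    \<comment> \<open>Subtracting \<open>v\<close> does no harm on sets of constant index, so pieces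
      of a finer decomposition for \<open>u\<close> are intersected with such sets.\<close>
    define \<Q> where "\<Q> = {S. \<forall>x\<in>S. \<forall>y\<in>S. r x = r y}"
    have "rank_on \<Q> \<Q> \<mu> UNIV r"
      using r unfolding rank_on_def \<Q>_def by auto
    then have "omega_splits \<Q> \<Lambda> UNIV"
      unfolding \<mu>_def by (rule rank_on_omega_splits[OF _ \<Lambda>]) (auto simp: \<Q>_def)
    moreover have "omega_splits (small_osc u \<epsilon>) \<Lambda> UNIV"
      using u(2) \<open>0 < \<epsilon>\<close> unfolding approximable_def by simp
    ultimately have "omega_splits (small_osc (\<lambda>x. u x - v x) \<epsilon>) \<Lambda> (UNIV \<inter> UNIV)"
    proof (rule omega_splits_merge)
      show "S \<inter> T \<in> small_osc (\<lambda>x. u x - v x) \<epsilon>" if "S \<in> \<Q>" "T \<in> small_osc u \<epsilon>" for S T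
        unfolding small_osc_def
      proof (intro CollectI ballI)
        fix x y assume xy: "x \<in> S \<inter> T" "y \<in> S \<inter> T"
        then have "v x = v y" using that by (intro v_fiber) (auto simp: \<Q>_def)
        moreover have "\<bar>u x - u y\<bar> \<le> \<epsilon>" using xy that by (auto simp: small_osc_def)
        ultimately show "\<bar>u x - v x - (u y - v y)\<bar> \<le> \<epsilon>" by simp
      qed
    qed (rule small_osc_subset, auto)
    then show "omega_splits (small_osc (\<lambda>x. u x - v x) \<epsilon>) \<Lambda> UNIV" by simp
  qed
  moreover have "\<exists>\<eta><\<mu>. \<forall>\<theta>>\<eta>. h \<theta> x = 0" for x
    using r_less by (intro exI[of _ "r x"]) (auto simp: h_def)
  moreover have "h \<eta> x \<le> K" for \<eta> x using v_K \<open>0 < K\<close> by (auto simp: h_def)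
  moreover have "0 \<le> u x - v x \<and> u x - v x \<le> K / 2" for x
    using v_le[of x] v_ge[of x] by linarith
  ultimately show ?thesis
    using h upper_h by (intro exI[of _ h]) (simp add: sum_\<mu>)
qed

text \<open>\<open>altsum_step\<close> is iterated on the remainders, whose bounds halve. To avoid
  exchanging the infinite series with the suprema in \<open>altsum\<close>, each tail
  \<open>T n\<close> is split into its first sequence and the next tail, and the alternating sum of
  a tail is at most \<open>2 * K / 2 ^ n\<close>. The bound \<open>2 * K\<close> is the total of the
  geometric series.\<close>

lemma altsum_representation:
  assumes u: "\<And>x. 0 \<le> u x \<and> u x \<le> K" "approximable \<Lambda> u" and "0 < K" and \<Lambda>: "0 < \<Lambda>" "\<Lambda> < \<omega>\<^sub>1"
  defines "\<mu> \<equiv> omega_pow \<Lambda>"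
  shows "\<exists>F. dec_seq F \<and> (\<forall>\<eta><\<mu>. upper (F \<eta>)) \<and> (\<forall>\<eta> x. F \<eta> x \<le> 2 * K) \<and>
    (\<forall>x. \<forall>\<epsilon>>0. \<exists>\<eta><\<mu>. \<forall>\<theta>>\<eta>. F \<theta> x < \<epsilon>) \<and> (\<forall>x. u x = altsum F \<mu> x)"
proof -
  have \<mu>: "is_limit \<mu>" "\<mu> < \<omega>\<^sub>1"
    using \<Lambda> by (auto simp: \<mu>_def is_limit_omega_pow omega_pow_less_omega1)
  define good where "good n w \<longleftrightarrow> (\<forall>x. 0 \<le> w x \<and> w x \<le> K / 2 ^ n) \<and> approximable \<Lambda> w" for n :: nat and w
  define step where "step n w h \<longleftrightarrow> dec_seq h \<and> (\<forall>\<eta><\<mu>. upper (h \<eta>)) \<and> (\<forall>\<eta> x. h \<eta> x \<le> K / 2 ^ n) \<and>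
    (\<forall>x. \<exists>\<eta><\<mu>. \<forall>\<theta>>\<eta>. h \<theta> x = 0) \<and> good (Suc n) (\<lambda>x. w x - altsum h \<mu> x)" for n w h
  have "\<exists>h. step n w h" if "good n w" for n w
  proof -
    have w: "0 < K / 2 ^ n" "\<And>x. 0 \<le> w x \<and> w x \<le> K / 2 ^ n" "approximable \<Lambda> w"
      using \<open>0 < K\<close> that by (auto simp: good_def)
    have half: "K / 2 ^ n / 2 = K / 2 ^ Suc n" by simp
    show ?thesis
      using altsum_step[of w "K / 2 ^ n" \<Lambda>, OF w(2,3,1) \<Lambda>]
      unfolding half \<mu>_def[symmetric] step_def good_def by blast
  qed
  then obtain H where H: "\<And>n w. good n w \<Longrightarrow> step n w (H n w)" by metis
  define w where "w = rec_nat u (\<lambda>n v x. v x - altsum (H n v) \<mu> x)"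
  have w_0: "w 0 = u" and w_Suc: "w (Suc n) = (\<lambda>x. w n x - altsum (H n (w n)) \<mu> x)" for n
    by (simp_all add: w_def)
  have good: "good n (w n)" for n
  proof (induction n)
    case 0
    then show ?case using u by (simp add: w_0 good_def)
  next
    case (Suc n)
    then show ?case using H[OF Suc] by (simp add: w_Suc step_def)
  qed
  define h where "h n = H n (w n)" for n
  have h: "step n (w n) (h n)" for n using H[OF good] by (simp add: h_def)
  have h_dec: "dec_seq (h n)" for n using h unfolding step_def by blast
  have h_bound: "0 \<le> h n \<eta> x \<and> h n \<eta> x \<le> K / 2 ^ n" for n \<eta> x
    using h[of n] dec_seq_nonneg[OF h_dec] unfolding step_def by blast
  have geo: "(\<lambda>i. K / 2 ^ (i + n)) sums (2 * K / 2 ^ n)" for n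
    using sums_mult[OF geometric_sums[of "1/2::real"], of "K / 2 ^ n"]
    by (simp add: power_divide power_add field_simps)
  have summable: "summable (\<lambda>i. h (i + n) \<eta> x)" for n \<eta> x
    using h_bound by (intro summable_comparison_test'[OF sums_summable[OF geo[of n]], of 0]) auto
  define T where "T n \<eta> x = (\<Sum>i. h (i + n) \<eta> x)" for n \<eta> x
  have T_dec: "dec_seq (T n)" for n
    unfolding dec_seq_def T_def
    using dec_seqD[OF h_dec] dec_seq_nonneg[OF h_dec] summable
    by (auto intro!: suminf_le suminf_nonneg)
  have T_bound: "T n \<eta> x \<le> 2 * K / 2 ^ n" for n \<eta> x
    unfolding T_def sums_unique[OF geo] using h_bound summable sums_summable[OF geo]
    by (intro suminf_le) auto
  have T_eq: "T n = (\<lambda>\<eta> x. h n \<eta> x + T (Suc n) \<eta> x)" for n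
    unfolding T_def using suminf_split_head[OF summable[of n]] by (intro ext) (simp add: add_ac)
  have T_sum: "altsum (T n) \<mu> x = altsum (h n) \<mu> x + altsum (T (Suc n)) \<mu> x" for n x
    by (subst T_eq) (rule altsum_add[OF h_dec T_dec \<mu>(2)])
  \<comment> \<open>The difference is independent of \<open>n\<close>, while both terms on the left
    lie between 0 and a multiple of \<open>K / 2 ^ n\<close>; so it is 0.\<close>
  have inv: "w n x - altsum (T n) \<mu> x = u x - altsum (T 0) \<mu> x" for n x
  proof (induction n)
    case (Suc n)
    have "w (Suc n) x = w n x - altsum (h n) \<mu> x" by (simp add: w_Suc h_def)
    then show ?case using Suc T_sum[of n x] by linarith
  qed (simp add: w_0)
  have rep: "u x = altsum (T 0) \<mu> x" for x
  proof -
    have "\<bar>u x - altsum (T 0) \<mu> x\<bar> \<le> 2 * K / 2 ^ n" for n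
    proof -
      have "0 \<le> w n x" "w n x \<le> K / 2 ^ n" using good[of n] unfolding good_def by blast+
      moreover have "0 \<le> altsum (T n) \<mu> x" "altsum (T n) \<mu> x \<le> T n 0 x"
        using altsum_bounds[OF T_dec \<mu>(2)] by blast+
      moreover have "K / 2 ^ n \<le> 2 * K / 2 ^ n" using \<open>0 < K\<close> by (simp add: divide_right_mono)
      ultimately show ?thesis using T_bound[of n 0 x] unfolding inv[of n, symmetric] by linarith
    qed
    moreover have "(\<lambda>n. 2 * K / 2 ^ n) \<longlonglongrightarrow> 0"
      using summable_LIMSEQ_zero[OF sums_summable[OF geo[of 0]], THEN tendsto_mult_left, of 2] by simp
    ultimately have "\<bar>u x - altsum (T 0) \<mu> x\<bar> \<le> 0"
      by (intro tendsto_lowerbound[of _ 0 sequentially]) auto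
    then show ?thesis by simp
  qed
  \<comment> \<open>At a fixed point each \<open>h n\<close> is 0 after some stage below \<mu>, and
    the maximum of finitely many such stages is still below \<mu>.\<close>
  have tail: "\<exists>\<eta><\<mu>. \<forall>\<theta>>\<eta>. T 0 \<theta> x = T n \<theta> x" for n x
  proof (induction n)
    case 0
    then show ?case using is_limit_pos[OF \<mu>(1)] by blast
  next
    case (Suc n)
    then obtain \<eta> where \<eta>: "\<eta> < \<mu>" "\<forall>\<theta>>\<eta>. T 0 \<theta> x = T n \<theta> x" by blast
    obtain \<zeta> where \<zeta>: "\<zeta> < \<mu>" "\<forall>\<theta>>\<zeta>. h n \<theta> x = 0" using h[of n] unfolding step_def by blast
    show ?case
      using \<eta> \<zeta> T_eq[of n] by (intro exI[of _ "max \<eta> \<zeta>"]) auto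
  qed
  have vanish: "\<exists>\<eta><\<mu>. \<forall>\<theta>>\<eta>. T 0 \<theta> x < \<epsilon>" if "0 < \<epsilon>" for x \<epsilon>
  proof -
    obtain n where "2 * K / \<epsilon> < 2 ^ n" using real_arch_pow[of 2 "2 * K / \<epsilon>"] by auto
    then have n: "2 * K / 2 ^ n < \<epsilon>" using that by (simp add: field_simps)
    obtain \<eta> where "\<eta> < \<mu>" "\<forall>\<theta>>\<eta>. T 0 \<theta> x = T n \<theta> x" using tail by blast
    then show ?thesis using le_less_trans[OF T_bound n] by metis
  qed
  have "upper (T 0 \<eta>)" if "\<eta> < \<mu>" for \<eta>
    unfolding T_def add_0_right
    by (rule upper_suminf[of _ K]) (use h that h_bound in \<open>auto simp: step_def\<close>)
  then show ?thesis
    using T_dec T_bound[of 0] vanish rep by (intro exI[of _ "T 0"]) auto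
qed

end

section \<open>Borel classes\<close>

lemma pi0_iff: "pi0 \<xi> A \<longleftrightarrow> sigma0 \<xi> (- A)"
proof
  show "pi0 \<xi> A \<Longrightarrow> sigma0 \<xi> (- A)" by (auto elim: pi0.cases)
  show "sigma0 \<xi> (- A) \<Longrightarrow> pi0 \<xi> A" using pi0_Compl[of \<xi> "- A"] by simp
qed

lemma sigma0_gt_1_iff:
  assumes "1 < \<xi>"
  shows "sigma0 \<xi> U \<longleftrightarrow> (\<exists>A::nat \<Rightarrow> _. U = (\<Union>n. A n) \<and> (\<forall>n. \<exists>\<eta>. 1 \<le> \<eta> \<and> \<eta> < \<xi> \<and> pi0 \<eta> (A n)))"
proof
  show "sigma0 \<xi> U \<Longrightarrow> \<exists>A::nat \<Rightarrow> _. U = (\<Union>n. A n) \<and> (\<forall>n. \<exists>\<eta>. 1 \<le> \<eta> \<and> \<eta> < \<xi> \<and> pi0 \<eta> (A n))"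
    using assms by (auto elim: sigma0.cases)
  show "\<exists>A::nat \<Rightarrow> _. U = (\<Union>n. A n) \<and> (\<forall>n. \<exists>\<eta>. 1 \<le> \<eta> \<and> \<eta> < \<xi> \<and> pi0 \<eta> (A n)) \<Longrightarrow> sigma0 \<xi> U"
    using assms sigma0_Union by blast
qed

text \<open>The metric enters here: an open set is exhausted by its points at distance at least
  \<open>1 / (n + 1)\<close> from the complement. This is the step from level 1 to the higher Borel
  classes.\<close>

lemma open_Union_closed:
  fixes U :: "'a::metric_space set"
  assumes "open U"
  obtains A :: "nat \<Rightarrow> 'a set" where "\<And>n. closed (A n)" "U = (\<Union>n. A n)"
\<comment> \<open>\<open>infdist\<close> to the empty set is 0 by convention, so the whole space is
  treated separately.\<close>
proof (cases "U = UNIV")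
  case True
  then show ?thesis using that[of "\<lambda>n. UNIV"] by simp
next
  case False
  then have ne: "- U \<noteq> {}" by blast
  have *: "closed {x. inverse (real (Suc n)) \<le> infdist x (- U)}" for n
    by (intro closed_Collect_le continuous_intros)
  have "x \<in> U \<longleftrightarrow> (\<exists>n. inverse (real (Suc n)) \<le> infdist x (- U))" for x
  proof -
    have "x \<in> U \<longleftrightarrow> infdist x (- U) \<noteq> 0"
      using in_closed_iff_infdist_zero[OF _ ne, of x] assms by auto
    also have "\<dots> \<longleftrightarrow> 0 < infdist x (- U)" using infdist_nonneg[of x "- U"] by (simp add: less_le)
    also have "\<dots> \<longleftrightarrow> (\<exists>n. inverse (real (Suc n)) \<le> infdist x (- U))"
    proof
      show "0 < infdist x (- U) \<Longrightarrow> \<exists>n. inverse (real (Suc n)) \<le> infdist x (- U)"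
        using reals_Archimedean[of "infdist x (- U)"] less_imp_le by blast
      have pos: "0 < inverse (real (Suc n))" for n by simp
      show "\<exists>n. inverse (real (Suc n)) \<le> infdist x (- U) \<Longrightarrow> 0 < infdist x (- U)"
        by (elim exE) (rule less_le_trans[OF pos])
    qed
    finally show ?thesis .
  qed
  then have "U = (\<Union>n. {x. inverse (real (Suc n)) \<le> infdist x (- U)})" by blast
  with * show ?thesis by (rule that)
qed

lemma sigma0_mono:
  fixes U :: "'a::metric_space set"
  assumes "sigma0 \<eta> U" "1 \<le> \<eta>" "\<eta> \<le> \<xi>"
  shows "sigma0 \<xi> U"
proof (cases "\<eta> = \<xi>")
  case False
  then have \<xi>: "\<eta> < \<xi>" "1 < \<xi>" using assms by auto
  show ?thesis
  proof (cases "\<eta> = 1")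
    case True
    then have "open U" using assms(1) by (simp add: sigma0_1_iff)
    then obtain A :: "nat \<Rightarrow> 'a set" where A: "\<And>n. closed (A n)" "U = (\<Union>n. A n)"
      by (rule open_Union_closed) (rule that)
    have "\<exists>\<theta>. 1 \<le> \<theta> \<and> \<theta> < \<xi> \<and> pi0 \<theta> (A n)" for n
      using A(1) \<xi>(2) pi0_1_iff by blast
    then show ?thesis unfolding A(2) by (rule sigma0_Union[OF \<xi>(2)])
  next
    case False
    then have "1 < \<eta>" using assms by auto
    then obtain A :: "nat \<Rightarrow> 'a set" where A: "U = (\<Union>n. A n)" "\<And>n. \<exists>\<theta>. 1 \<le> \<theta> \<and> \<theta> < \<eta> \<and> pi0 \<theta> (A n)"
      using assms(1) unfolding sigma0_gt_1_iff[OF \<open>1 < \<eta>\<close>] by blast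
    have "\<exists>\<theta>. 1 \<le> \<theta> \<and> \<theta> < \<xi> \<and> pi0 \<theta> (A n)" for n
      using A(2)[of n] \<xi>(1) by (meson less_trans)
    then show ?thesis unfolding A(1) by (rule sigma0_Union[OF \<xi>(2)])
  qed
qed (use assms in simp)

lemma sigma0_UN:
  assumes "1 \<le> \<xi>" "\<And>n::nat. sigma0 \<xi> (U n)"
  shows "sigma0 \<xi> (\<Union>n. U n)"
proof (cases "\<xi> = 1")
  case True
  then show ?thesis using assms by (auto simp: sigma0_1_iff)
next
  case False
  then have \<xi>: "1 < \<xi>" using assms by auto
  have "\<exists>A::nat \<Rightarrow> _. U n = (\<Union>m. A m) \<and> (\<forall>m. \<exists>\<eta>. 1 \<le> \<eta> \<and> \<eta> < \<xi> \<and> pi0 \<eta> (A m))" for n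
    using assms(2) unfolding sigma0_gt_1_iff[OF \<xi>] .
  then obtain A :: "nat \<Rightarrow> nat \<Rightarrow> _" where A: "\<And>n. U n = (\<Union>m. A n m)"
    "\<And>n m. \<exists>\<eta>. 1 \<le> \<eta> \<and> \<eta> < \<xi> \<and> pi0 \<eta> (A n m)" by metis
  have "(\<Union>n. U n) = (\<Union>k. case_prod A (prod_decode k))"
  proof (intro set_eqI iffI)
    fix x assume "x \<in> (\<Union>n. U n)"
    then obtain n m where "x \<in> A n m" using A(1) by blast
    then show "x \<in> (\<Union>k. case_prod A (prod_decode k))"
      by (intro UN_I[of "prod_encode (n, m)"]) auto
  next
    fix x assume "x \<in> (\<Union>k. case_prod A (prod_decode k))"
    then obtain k where k: "x \<in> case_prod A (prod_decode k)" by (rule UN_E)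
    obtain n m where "prod_decode k = (n, m)" by (cases "prod_decode k")
    then have "x \<in> A n m" using k by simp
    then show "x \<in> (\<Union>n. U n)" using A(1) by blast
  qed
  moreover have "\<exists>\<eta>. 1 \<le> \<eta> \<and> \<eta> < \<xi> \<and> pi0 \<eta> (case_prod A (prod_decode k))" for k
    using A(2) by (cases "prod_decode k") auto
  ultimately show ?thesis using sigma0_Union[OF \<xi>, of "\<lambda>k. case_prod A (prod_decode k)"] by simp
qed

lemma sigma0_Un:
  assumes "1 \<le> \<xi>" "sigma0 \<xi> U" "sigma0 \<xi> V"
  shows "sigma0 \<xi> (U \<union> V)"
proof -
  have "(\<Union>n::nat. if n = 0 then U else V) = U \<union> V" by (auto split: if_splits)
  then show ?thesis using sigma0_UN[OF assms(1), of "\<lambda>n. if n = 0 then U else V"] assms by simp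
qed

text \<open>Two members of the unions may come from different lower classes; monotonicity raises
  both to the larger one, where their intersection is again multiplicative.\<close>

lemma sigma0_Int:
  fixes U V :: "'a::metric_space set"
  assumes "1 \<le> \<xi>" "sigma0 \<xi> U" "sigma0 \<xi> V"
  shows "sigma0 \<xi> (U \<inter> V)"
proof (cases "\<xi> = 1")
  case True
  then show ?thesis using assms by (auto simp: sigma0_1_iff)
next
  case False
  then have \<xi>: "1 < \<xi>" using assms by auto
  obtain A :: "nat \<Rightarrow> 'a set" where A: "U = (\<Union>n. A n)" "\<And>n. \<exists>\<eta>. 1 \<le> \<eta> \<and> \<eta> < \<xi> \<and> pi0 \<eta> (A n)"
    using assms(2) unfolding sigma0_gt_1_iff[OF \<xi>] by blast
  obtain B :: "nat \<Rightarrow> 'a set" where B: "V = (\<Union>n. B n)" "\<And>n. \<exists>\<eta>. 1 \<le> \<eta> \<and> \<eta> < \<xi> \<and> pi0 \<eta> (B n)"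
    using assms(3) unfolding sigma0_gt_1_iff[OF \<xi>] by blast
  have "sigma0 \<xi> (A n \<inter> B m)" for n m
  proof -
    obtain \<eta> where \<eta>: "1 \<le> \<eta>" "\<eta> < \<xi>" "sigma0 \<eta> (- A n)" using A(2) pi0_iff by blast
    obtain \<theta> where \<theta>: "1 \<le> \<theta>" "\<theta> < \<xi>" "sigma0 \<theta> (- B m)" using B(2) pi0_iff by blast
    let ?m = "max \<eta> \<theta>"
    have m: "1 \<le> ?m" "?m < \<xi>" using \<eta> \<theta> by (auto simp: le_max_iff_disj)
    have "sigma0 ?m (- A n)" "sigma0 ?m (- B m)"
      using \<eta> \<theta> by (auto intro: sigma0_mono)
    then have "pi0 ?m (A n \<inter> B m)" using sigma0_Un[OF m(1)] by (simp add: pi0_iff Compl_Int)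
    then show ?thesis
      unfolding sigma0_gt_1_iff[OF \<xi>] using m by (intro exI[of _ "\<lambda>_. A n \<inter> B m"]) auto
  qed
  then have "sigma0 \<xi> (\<Union>n. \<Union>m. A n \<inter> B m)" by (intro sigma0_UN assms(1))
  moreover have "(\<Union>n. \<Union>m. A n \<inter> B m) = U \<inter> V" using A(1) B(1) by blast
  ultimately show ?thesis by simp
qed

lemma multiplicative_class_pi0:
  assumes "1 \<le> \<xi>"
  shows "multiplicative_class {A :: 'a::metric_space set. pi0 \<xi> A}"
proof
  have "sigma0 1 ({} :: 'a set)" "sigma0 1 (UNIV :: 'a set)" by (auto simp: sigma0_1_iff)
  then have *: "sigma0 \<xi> ({} :: 'a set)" "sigma0 \<xi> (UNIV :: 'a set)"
    using assms by (auto intro: sigma0_mono)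
  then show "UNIV \<in> {A :: 'a set. pi0 \<xi> A}" "{} \<in> {A :: 'a set. pi0 \<xi> A}"
    by (auto simp: pi0_iff)
  show "A \<union> B \<in> {A. pi0 \<xi> A}" if "A \<in> {A. pi0 \<xi> A}" "B \<in> {A. pi0 \<xi> A}" for A B :: "'a set"
    using that sigma0_Int[OF assms] by (simp add: pi0_iff)
  show "(\<Inter>n. F n) \<in> {A. pi0 \<xi> A}" if "\<And>n::nat. F n \<in> {A. pi0 \<xi> A}" for F :: "nat \<Rightarrow> 'a set"
    using that sigma0_UN[OF assms, of "\<lambda>n. - F n"] by (simp add: pi0_iff)
qed

section \<open>The two ranks\<close>

context multiplicative_class
begin

lemma approximable_shift: "approximable \<Lambda> (\<lambda>x. c + u x) \<longleftrightarrow> approximable \<Lambda> u"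
  by (simp add: approximable_def small_osc_def)

text \<open>If \<open>f\<close> rose by more than \<epsilon> within a piece, two neighbouring points
  of a grid of mesh below \<open>\<epsilon> / 2\<close> would fit between the two values, against
  the separation at that pair. Boundedness makes the grid finite, so finitely many refinements
  suffice.\<close>

lemma approximable_if_separated:
  assumes "bounded (range f)" and \<Lambda>: "0 < \<Lambda>"
    and sep: "\<And>p q :: rat. p < q \<Longrightarrow>
      omega_splits ({S. S \<inter> {x. f x \<ge> of_rat q} = {}} \<union> {S. S \<inter> {x. f x \<le> of_rat p} = {}}) \<Lambda> UNIV"
  shows "approximable \<Lambda> f"
  unfolding approximable_def
proof (intro allI impI)
  fix \<epsilon> :: real assume "0 < \<epsilon>"
  then obtain d :: rat where d: "0 < (of_rat d :: real)" "of_rat d < \<epsilon> / 2"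
    using of_rat_dense[of 0 "\<epsilon> / 2"] by auto
  have d0: "0 < d" using d(1) by simp
  obtain M where M: "\<And>x. \<bar>f x\<bar> \<le> M" using assms(1) by (auto simp: bounded_iff)
  obtain a :: rat where a: "of_rat a < - M" using of_rat_dense[of "- M - 1" "- M"] by auto
  define p where "p i = a + of_nat i * d" for i
  have p: "(of_rat (p i) :: real) = of_rat a + real i * of_rat d" for i
    by (simp add: p_def of_rat_add of_rat_mult)
  define fam where "fam n =
    {S. \<forall>i<n. S \<inter> {x. f x \<ge> of_rat (p (Suc i))} = {} \<or> S \<inter> {x. f x \<le> of_rat (p i)} = {}}" for n
  have split: "omega_splits (fam n) \<Lambda> UNIV" for n
  proof (induction n)
    case 0
    then show ?case by (auto simp: fam_def intro!: omega_splits_splits splits.base \<Lambda>)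
  next
    case (Suc n)
    have "p n < p (Suc n)" using d0 by (simp add: p_def algebra_simps)
    have "omega_splits (fam (Suc n)) \<Lambda> (UNIV \<inter> UNIV)"
      by (rule omega_splits_merge[OF Suc sep[OF \<open>p n < p (Suc n)\<close>]])
        (unfold fam_def less_Suc_eq, blast+)
    then show ?case by simp
  qed
  obtain N where N: "(M - of_rat a) / of_rat d < real N" using reals_Archimedean2 by blast
  have N': "M < of_rat (p N)" using N d by (simp add: p field_simps)
  have osc: "f y \<le> f x + \<epsilon>" if S: "S \<in> fam N" "x \<in> S" "y \<in> S" for S x y
  proof (rule ccontr)
    assume "\<not> f y \<le> f x + \<epsilon>"
    then have far: "f x + \<epsilon> < f y" by simp
    define t where "t = (f x - of_rat a) / of_rat d"
    have fx: "f x = of_rat a + t * of_rat d" using d by (simp add: t_def)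
    have "0 \<le> t" using a M[of x] d by (simp add: t_def abs_le_iff)
    \<comment> \<open>The first grid point at or above \<open>f x\<close>; the next one exceeds
      \<open>f x\<close> by less than two meshes and is still below \<open>f y\<close>.\<close>
    define i where "i = nat \<lceil>t\<rceil>"
    have i: "t \<le> real i" "real i < t + 1"
      using \<open>0 \<le> t\<close> by (auto simp: i_def) linarith+
    have 1: "f x \<le> of_rat (p i)" using i d by (simp add: fx p mult_right_mono)
    have "real (Suc i) * of_rat d < (t + 2) * of_rat d"
      using i d by (intro mult_strict_right_mono) auto
    then have 2: "of_rat (p (Suc i)) < f y" using far d unfolding p fx by (simp add: algebra_simps)
    have "f y < of_rat (p N)" using M[of y] N' by (simp add: abs_le_iff)
    then have "real (Suc i) * of_rat d < real N * of_rat d" using 2 unfolding p by simp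
    then have "i < N" using d by simp
    then show False using S 1 2 unfolding fam_def by (fastforce simp: less_imp_le)
  qed
  have "fam N \<subseteq> small_osc f \<epsilon>"
    using osc by (fastforce simp: small_osc_def abs_le_iff algebra_simps)
  then show "omega_splits (small_osc f \<epsilon>) \<Lambda> UNIV"
    by (rule omega_splits_family_mono[OF split])
qed

lemma separated_if_approximable:
  assumes "approximable \<Lambda> f" "a < b"
  shows "omega_splits ({S. S \<inter> {x. f x \<ge> b} = {}} \<union> {S. S \<inter> {x. f x \<le> a} = {}}) \<Lambda> UNIV"
proof (rule omega_splits_family_mono)
  show "omega_splits (small_osc f ((b - a) / 2)) \<Lambda> UNIV"
    using assms unfolding approximable_def by simp
  show "small_osc f ((b - a) / 2) \<subseteq> {S. S \<inter> {x. f x \<ge> b} = {}} \<union> {S. S \<inter> {x. f x \<le> a} = {}}"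
  proof
    fix S assume S: "S \<in> small_osc f ((b - a) / 2)"
    have False if "x \<in> S" "y \<in> S" "b \<le> f x" "f y \<le> a" for x y
    proof -
      have "\<bar>f x - f y\<bar> \<le> (b - a) / 2" using S that by (auto simp: small_osc_def)
      then show False using that assms(2) by (simp add: abs_le_iff)
    qed
    then show "S \<in> {S. S \<inter> {x. f x \<ge> b} = {}} \<union> {S. S \<inter> {x. f x \<le> a} = {}}" by blast
  qed
qed

end

text \<open>The infimum is a member of the set, except that it is \<open>\<omega>\<^sub>1\<close>
  for the empty set; hence the countable bound.\<close>

lemma Inf_ordinal_le_iff:
  fixes S :: "ordinal set"
  assumes "\<mu> < \<omega>\<^sub>1"
  shows "Inf S \<le> \<mu> \<longleftrightarrow> (\<exists>\<nu>\<in>S. \<nu> \<le> \<mu>)"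
  using Inf_less_iff[of S "osuc \<mu>"] by (simp add: less_osuc_iff assms)

text \<open>The least index whose set omits \<open>x\<close> is a successor: \<open>F 0\<close> is
  the whole space, and continuity excludes limits, including the length \<mu> itself. Its
  predecessor is the index of the piece of \<open>x\<close>.\<close>

lemma difference_seq_rank_on:
  fixes F :: "ordinal \<Rightarrow> 'a::metric_space set"
  assumes F: "difference_seq \<xi> \<mu> F" and "1 \<le> \<xi>" and "\<mu> \<le> \<nu>"
    and even: "\<And>\<eta>. \<eta> < \<mu> \<Longrightarrow> even_ordinal \<eta> \<Longrightarrow> F \<eta> - F (osuc \<eta>) \<in> \<P>"
    and odd: "\<And>\<eta>. \<eta> < \<mu> \<Longrightarrow> \<not> even_ordinal \<eta> \<Longrightarrow> F \<eta> - F (osuc \<eta>) \<in> \<Q>"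
    and empty_pieces: "{} \<in> \<P>" "{} \<in> \<Q>"
  shows "\<exists>r. multiplicative_class.rank_on {A. pi0 \<xi> A} \<P> \<Q> \<nu> UNIV r"
proof -
  interpret multiplicative_class "{A :: 'a set. pi0 \<xi> A}"
    by (rule multiplicative_class_pi0) fact
  have \<mu>: "\<mu> < \<omega>\<^sub>1" and F_Pi: "\<And>\<eta>. \<eta> < \<mu> \<Longrightarrow> pi0 \<xi> (F \<eta>)"
    and F_dec0: "\<And>\<theta> \<eta>. \<theta> < \<mu> \<Longrightarrow> \<eta> \<le> \<theta> \<Longrightarrow> F \<theta> \<subseteq> F \<eta>"
    and F_lim: "\<And>\<theta>. \<theta> < \<mu> \<Longrightarrow> is_limit \<theta> \<Longrightarrow> F \<theta> = (\<Inter>\<eta>\<in>{..<\<theta>}. F \<eta>)"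
    and F_0: "F 0 = UNIV" and F_lim_\<mu>: "is_limit \<mu> \<Longrightarrow> (\<Inter>\<eta>\<in>{..<\<mu>}. F \<eta>) = {}"
    and F_empty: "\<And>\<eta>. \<mu> \<le> \<eta> \<Longrightarrow> F \<eta> = {}"
    using F unfolding difference_seq_def by blast+
  have F_dec: "F \<theta> \<subseteq> F \<eta>" if "\<eta> \<le> \<theta>" for \<eta> \<theta>
    using F_dec0[OF _ that] F_empty[of \<theta>] by (cases "\<theta> < \<mu>") auto
  have "\<exists>y<\<mu>. x \<in> F y \<and> x \<notin> F (osuc y)" for x
  proof -
    define \<tau> where "\<tau> = (LEAST \<eta>. x \<notin> F \<eta>)"
    have "x \<notin> F \<mu>" using F_empty by simp
    then have \<tau>: "x \<notin> F \<tau>" "\<tau> \<le> \<mu>" unfolding \<tau>_def by (rule LeastI, rule Least_le)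
    have min: "x \<in> F \<eta>" if "\<eta> < \<tau>" for \<eta>
      using not_less_Least[of \<eta> "\<lambda>\<eta>. x \<notin> F \<eta>"] that unfolding \<tau>_def by blast
    show ?thesis
    proof (cases \<tau> rule: ordinal_cases)
      case zero
      then show ?thesis using \<tau> F_0 by simp
    next
      case (suc y)
      then show ?thesis using \<tau> min[of y] by (intro exI[of _ y]) auto
    next
      case limit
      have "x \<in> (\<Inter>\<eta>\<in>{..<\<tau>}. F \<eta>)" using min by blast
      then have False using limit \<tau> F_lim[of \<tau>] F_lim_\<mu> by (cases "\<tau> = \<mu>") auto
      then show ?thesis ..
    qed
  qed
  then obtain r where r: "\<And>x. r x < \<mu>" "\<And>x. x \<in> F (r x)" "\<And>x. x \<notin> F (osuc (r x))" by metis
  have r1: "r x < \<omega>\<^sub>1" for x using r(1) ordinal_less_omega1_trans by blast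
  have iff: "\<eta> \<le> r x \<longleftrightarrow> x \<in> F \<eta>" for \<eta> x
  proof
    show "x \<in> F \<eta>" if "\<eta> \<le> r x" using F_dec[OF that] r(2) by blast
    show "\<eta> \<le> r x" if "x \<in> F \<eta>"
      using F_dec[of "osuc (r x)" \<eta>] that r(3)[of x] osuc_le_iff[OF r1] by (meson leI subsetD)
  qed
  have fiber: "{x \<in> UNIV. r x = \<eta>} = F \<eta> - F (osuc \<eta>)" if "\<eta> < \<mu>" for \<eta>
  proof -
    have "\<eta> < \<omega>\<^sub>1" using that \<mu> by auto
    then have "r x = \<eta> \<longleftrightarrow> \<eta> \<le> r x \<and> \<not> osuc \<eta> \<le> r x" for x
      unfolding osuc_le_iff[OF \<open>\<eta> < \<omega>\<^sub>1\<close>] by auto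
    then show ?thesis unfolding iff by blast
  qed
  have "rank_on \<P> \<Q> \<nu> UNIV r"
    unfolding rank_on_def
  proof (intro conjI allI ballI)
    show "r x < \<nu>" for x using r(1) \<open>\<mu> \<le> \<nu>\<close> by (rule less_le_trans)
    show "\<exists>P\<in>{A. pi0 \<xi> A}. {x \<in> UNIV. \<eta> \<le> r x} = UNIV \<inter> P" for \<eta>
    proof
      show "F \<eta> \<in> {A. pi0 \<xi> A}"
      proof (cases "\<eta> < \<mu>")
        case False
        then have "F \<eta> = {}" using F_empty by simp
        then show ?thesis using empty_in by simp
      qed (use F_Pi in simp)
      show "{x \<in> UNIV. \<eta> \<le> r x} = UNIV \<inter> F \<eta>" unfolding iff by blast
    qed
    show "{x \<in> UNIV. r x = \<eta>} \<in> (if even_ordinal \<eta> then \<P> else \<Q>)" for \<eta>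
    proof (cases "\<eta> < \<mu>")
      case True
      then show ?thesis unfolding fiber[OF True] using even odd by (cases "even_ordinal \<eta>") simp_all
    next
      case False
      then have "r x \<noteq> \<eta>" for x using r(1)[of x] by auto
      then have eq: "{x \<in> UNIV. r x = \<eta>} = {}" by blast
      show ?thesis unfolding eq using empty_pieces by (cases "even_ordinal \<eta>") simp_all
    qed
  qed
  then show ?thesis by blast
qed

text \<open>From left to right parities are forgotten: an even piece avoids \<open>B\<close>, and an
  odd one avoids \<open>A\<close> because it is disjoint from the even pieces, which cover
  \<open>A\<close>. From right to left \<open>omega_splits_rank_on\<close> restores them, and the
  points of even index form the transfinite difference.\<close>

lemma alpha_sep_le_iff:
  fixes A B :: "'a::metric_space set"
  assumes "1 \<le> \<xi>" and \<Lambda>: "0 < \<Lambda>" "\<Lambda> < \<omega>\<^sub>1"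
  shows "alpha_sep \<xi> A B \<le> omega_pow \<Lambda> \<longleftrightarrow>
    multiplicative_class.omega_splits {A. pi0 \<xi> A} ({S. S \<inter> B = {}} \<union> {S. S \<inter> A = {}}) \<Lambda> UNIV"
    (is "?L \<longleftrightarrow> _")
proof -
  interpret multiplicative_class "{A :: 'a set. pi0 \<xi> A}"
    by (rule multiplicative_class_pi0) fact
  let ?P = "{S. S \<inter> B = {}}" and ?Q = "{S. S \<inter> A = {}}"
  let ?w = "omega_pow \<Lambda>"
  have w: "is_limit ?w" "?w < \<omega>\<^sub>1" using \<Lambda> by (auto simp: is_limit_omega_pow omega_pow_less_omega1)
  have iff: "?L \<longleftrightarrow> (\<exists>\<mu>\<le>?w. \<exists>F. difference_seq \<xi> \<mu> F \<and>
      A \<subseteq> transfinite_difference \<mu> F \<and> transfinite_difference \<mu> F \<subseteq> - B)"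
    unfolding alpha_sep_def Inf_ordinal_le_iff[OF w(2)] by blast
  show ?thesis
  proof
    assume ?L
    then obtain \<mu> F where \<mu>: "\<mu> \<le> ?w" and F: "difference_seq \<xi> \<mu> F"
      and AB: "A \<subseteq> transfinite_difference \<mu> F" "transfinite_difference \<mu> F \<subseteq> - B"
      using iff by blast
    have dec: "F \<theta> \<subseteq> F \<eta>" if "\<theta> < \<mu>" "\<eta> \<le> \<theta>" for \<theta> \<eta> using F that unfolding difference_seq_def by blast
    have "F \<eta> - F (osuc \<eta>) \<in> ?P \<union> ?Q" if "\<eta> < \<mu>" for \<eta>
    proof (cases "even_ordinal \<eta>")
      case True
      then have "F \<eta> - F (osuc \<eta>) \<subseteq> transfinite_difference \<mu> F"
        using that unfolding transfinite_difference_def by blast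
      then show ?thesis using AB by blast
    next
      case False
      have "x \<notin> A" if x: "x \<in> F \<eta> - F (osuc \<eta>)" for x
      proof
        assume "x \<in> A"
        then obtain \<zeta> where \<zeta>: "\<zeta> < \<mu>" "even_ordinal \<zeta>" "x \<in> F \<zeta> - F (osuc \<zeta>)"
          using AB(1) unfolding transfinite_difference_def by blast
        have 1: "\<eta> < \<omega>\<^sub>1" "\<zeta> < \<omega>\<^sub>1" using \<open>\<eta> < \<mu>\<close> \<zeta> ordinal_less_omega1_trans by blast+
        have "\<zeta> \<noteq> \<eta>" using \<zeta> False by auto
        then consider "osuc \<zeta> \<le> \<eta>" | "osuc \<eta> \<le> \<zeta>"
          using 1 by (metis linorder_neqE osuc_le_iff)
        then show False
          using dec[OF \<open>\<eta> < \<mu>\<close>] dec[OF \<zeta>(1)] x \<zeta>(3) by cases blast+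
      qed
      then show ?thesis by blast
    qed
    then obtain r where "rank_on (?P \<union> ?Q) (?P \<union> ?Q) ?w UNIV r"
      using difference_seq_rank_on[OF F \<open>1 \<le> \<xi>\<close> \<mu>, of "?P \<union> ?Q" "?P \<union> ?Q"] by auto
    then show "omega_splits (?P \<union> ?Q) \<Lambda> UNIV"
      by (rule rank_on_omega_splits[OF _ \<Lambda>]) blast
  next
    assume "omega_splits (?P \<union> ?Q) \<Lambda> UNIV"
    then obtain r where r: "rank_on ?P ?Q ?w UNIV r"
      by (rule omega_splits_rank_on[OF _ \<Lambda>]) auto
    have r_less: "r x < ?w" for x using r unfolding rank_on_def by blast
    have r1: "r x < \<omega>\<^sub>1" for x using r_less ordinal_less_omega1_trans by blast
    define F where "F \<eta> = {x. \<eta> \<le> r x}" for \<eta>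
    have diff: "difference_seq \<xi> ?w F"
      unfolding difference_seq_def
    proof (intro conjI allI impI)
      show "pi0 \<xi> (F \<eta>)" for \<eta> using r unfolding rank_on_def F_def by simp
      show "F \<theta> \<subseteq> F \<eta>" if "\<eta> \<le> \<theta>" for \<eta> \<theta> using that by (auto simp: F_def)
      have lim: "\<theta> \<le> r x" if "is_limit \<theta>" "\<And>\<eta>. \<eta> < \<theta> \<Longrightarrow> \<eta> \<le> r x" for \<theta> x
        using that(2)[OF is_limitD[OF that(1)], of "r x"] less_osuc[OF r1[of x]] by (meson leD leI)
      show "F \<theta> = (\<Inter>\<eta>\<in>{..<\<theta>}. F \<eta>)" if "is_limit \<theta>" for \<theta>
        using lim[OF that] by (auto simp: F_def)
      show "(\<Inter>\<eta>\<in>{..<?w}. F \<eta>) = {}"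
      proof -
        have False if "\<And>\<eta>. \<eta> < ?w \<Longrightarrow> \<eta> \<le> r x" for x
          using lim[OF w(1) that] r_less[of x] by simp
        then show ?thesis by (auto simp: F_def)
      qed
      show "F \<eta> = {}" if "?w \<le> \<eta>" for \<eta>
        using less_le_trans[OF r_less that] by (auto simp: F_def not_le)
    qed (use w in \<open>auto simp: F_def\<close>)
    have td: "transfinite_difference ?w F = {x. even_ordinal (r x)}"
    proof -
      have "x \<in> F \<eta> - F (osuc \<eta>) \<longleftrightarrow> r x = \<eta>" if "\<eta> < ?w" for x \<eta>
        using osuc_le_iff[OF ordinal_less_omega1_trans[OF that], of "r x"] by (auto simp: F_def)
      then have "x \<in> transfinite_difference ?w F \<longleftrightarrow> (\<exists>\<eta>. \<eta> < ?w \<and> even_ordinal \<eta> \<and> r x = \<eta>)" for x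
        unfolding transfinite_difference_def by blast
      then show ?thesis using r_less by auto
    qed
    have fiber: "{y \<in> UNIV. r y = r x} \<in> (if even_ordinal (r x) then ?P else ?Q)" for x
      using r unfolding rank_on_def by blast
    have "A \<subseteq> {x. even_ordinal (r x)}"
    proof (rule subsetI, rule ccontr)
      fix x assume x: "x \<in> A" "x \<notin> {x. even_ordinal (r x)}"
      then have "{y \<in> UNIV. r y = r x} \<in> ?Q" using fiber[of x] by simp
      then show False using x(1) by blast
    qed
    moreover have "{x. even_ordinal (r x)} \<subseteq> - B"
    proof (rule subsetI, rule ccontr)
      fix x assume x: "x \<in> {x. even_ordinal (r x)}" "x \<notin> - B"
      then have "{y \<in> UNIV. r y = r x} \<in> ?P" using fiber[of x] by simp
      then show False using x(2) by blast
    qed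
    ultimately show ?L unfolding iff using diff td by (intro exI[of _ ?w] conjI exI[of _ F]) simp_all
  qed
qed

lemma alpha_rank_le_iff:
  fixes f :: "'a::metric_space \<Rightarrow> real"
  assumes "1 \<le> \<xi>" "0 < \<Lambda>" "\<Lambda> < \<omega>\<^sub>1" "bounded (range f)"
  shows "alpha_rank \<xi> f \<le> omega_pow \<Lambda> \<longleftrightarrow> multiplicative_class.approximable {A. pi0 \<xi> A} \<Lambda> f"
proof -
  interpret multiplicative_class "{A :: 'a set. pi0 \<xi> A}"
    by (rule multiplicative_class_pi0) fact
  have "alpha_rank \<xi> f \<le> omega_pow \<Lambda> \<longleftrightarrow> (\<forall>p q :: rat. p < q \<longrightarrow>
      alpha_sep \<xi> {x. f x \<le> of_rat p} {x. f x \<ge> of_rat q} \<le> omega_pow \<Lambda>)"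
    unfolding alpha_rank_def Sup_le_iff by blast
  also have "\<dots> \<longleftrightarrow> approximable \<Lambda> f"
    unfolding alpha_sep_le_iff[OF assms(1-3)]
  proof
    assume "approximable \<Lambda> f"
    then show "\<forall>p q :: rat. p < q \<longrightarrow> omega_splits
        ({S. S \<inter> {x. of_rat q \<le> f x} = {}} \<union> {S. S \<inter> {x. f x \<le> of_rat p} = {}}) \<Lambda> UNIV"
      by (auto intro!: separated_if_approximable simp: of_rat_less)
  qed (intro approximable_if_separated[OF assms(4,2)], blast)
  finally show ?thesis .
qed

lemma altsum_length_le_iff:
  fixes f :: "'a::metric_space \<Rightarrow> real"
  assumes "1 \<le> \<xi>" and \<Lambda>: "0 < \<Lambda>" "\<Lambda> < \<omega>\<^sub>1" and "bounded (range f)"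
  shows "altsum_length \<xi> f \<le> omega_pow \<Lambda> \<longleftrightarrow> multiplicative_class.approximable {A. pi0 \<xi> A} \<Lambda> f"
    (is "?L \<longleftrightarrow> _")
proof -
  interpret multiplicative_class "{A :: 'a set. pi0 \<xi> A}"
    by (rule multiplicative_class_pi0) fact
  let ?w = "omega_pow \<Lambda>"
  have w: "is_limit ?w" "?w < \<omega>\<^sub>1" using \<Lambda> by (auto simp: is_limit_omega_pow omega_pow_less_omega1)
  have upper_iff: "upper g \<longleftrightarrow> semi_borel \<xi> g" for g
  proof -
    have "- {x. c \<le> g x} = {x. g x < c}" for c by auto
    then have "pi0 \<xi> {x. c \<le> g x} \<longleftrightarrow> sigma0 \<xi> {x. g x < c}" for c by (simp add: pi0_iff)
    then show ?thesis unfolding upper_def semi_borel_def by simp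
  qed
  have at_left: "eventually P (at_left \<mu>) \<longleftrightarrow> (\<exists>\<eta><\<mu>. \<forall>\<theta>>\<eta>. \<theta> < \<mu> \<longrightarrow> P \<theta>)" if "is_limit \<mu>" for P \<mu>
    using eventually_at_left[OF is_limit_pos[OF that]] .
  have iff: "?L \<longleftrightarrow> (\<exists>\<mu>\<le>?w. \<exists>F c. DUSB \<xi> \<mu> F \<and> (\<forall>x. f x = c + altsum F \<mu> x))"
    unfolding altsum_length_def Inf_ordinal_le_iff[OF w(2)] by blast
  show ?thesis
  proof
    assume ?L
    then obtain \<mu> F c where \<mu>: "\<mu> \<le> ?w" and F: "DUSB \<xi> \<mu> F" and f: "\<And>x. f x = c + altsum F \<mu> x"
      using iff by blast
    have dec: "\<And>\<eta> \<theta> x. \<theta> < \<mu> \<Longrightarrow> \<eta> \<le> \<theta> \<Longrightarrow> F \<theta> x \<le> F \<eta> x"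
      and nonneg: "\<And>\<eta> x. \<eta> < \<mu> \<Longrightarrow> 0 \<le> F \<eta> x"
      and bdd: "\<And>\<eta>. \<eta> < \<mu> \<Longrightarrow> bounded (range (F \<eta>))"
      and borel: "\<And>\<eta>. \<eta> < \<mu> \<Longrightarrow> semi_borel \<xi> (F \<eta>)"
      and lim: "\<And>x. is_limit \<mu> \<Longrightarrow> ((\<lambda>\<eta>. F \<eta> x) \<longlongrightarrow> 0) (at_left \<mu>)"
      using F unfolding DUSB_def by blast+
    \<comment> \<open>Continuation by 0, as \<open>dec_seq\<close> has no length;
      \<open>altsum_cong\<close> shows that the sum is unchanged.\<close>
    define G where "G \<eta> x = (if \<eta> < \<mu> then F \<eta> x else 0)" for \<eta> x
    have G_eq: "G \<eta> = (if \<eta> < \<mu> then F \<eta> else (\<lambda>x. 0))" for \<eta> by (auto simp: G_def)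
    have "dec_seq G"
      unfolding dec_seq_def G_def using dec nonneg le_less_trans by auto
    moreover have "upper (G \<eta>)" for \<eta>
      unfolding G_eq using borel upper_iff upper_zero by simp
    moreover obtain M where "\<And>x. G 0 x \<le> M"
    proof (cases "0 < \<mu>")
      case True
      then obtain M where "\<And>x. \<bar>F 0 x\<bar> \<le> M" using bdd[of 0] by (auto simp: bounded_iff)
      then show thesis using that True by (auto simp: G_def abs_le_iff)
    next
      case False
      then show thesis using that[of 0] by (simp add: G_def)
    qed
    moreover have "\<exists>\<eta><\<mu>. G \<eta> x < \<epsilon>" if lim_pos: "is_limit \<mu>" "0 < \<epsilon>" for x \<epsilon>
    proof -
      have "eventually (\<lambda>\<eta>. F \<eta> x < \<epsilon>) (at_left \<mu>)"
        using order_tendstoD(2)[OF lim[OF lim_pos(1)] lim_pos(2)] .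
      then obtain \<eta> where \<eta>: "\<eta> < \<mu>" "\<And>\<theta>. \<eta> < \<theta> \<Longrightarrow> \<theta> < \<mu> \<Longrightarrow> F \<theta> x < \<epsilon>"
        unfolding at_left[OF lim_pos(1)] by blast
      \<comment> \<open>The estimate holds strictly after \<eta> only, so the witness is the next
        stage.\<close>
      have "osuc \<eta> < \<mu>" "\<eta> < osuc \<eta>"
        using is_limitD[OF lim_pos(1) \<eta>(1)] less_osuc[OF ordinal_less_omega1_trans[OF \<eta>(1)]] by auto
      then show ?thesis using \<eta>(2) by (intro exI[of _ "osuc \<eta>"]) (simp add: G_def)
    qed
    ultimately have "approximable \<Lambda> (altsum G \<mu>)"
      unfolding approximable_def using omega_splits_altsum[OF _ _ _ \<mu> \<Lambda>] by blast
    moreover have "f = (\<lambda>x. c + altsum G \<mu> x)"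
      using f altsum_cong[of \<mu> F _ G] by (auto simp: G_def)
    ultimately show "approximable \<Lambda> f" using approximable_shift by simp
  next
    assume "approximable \<Lambda> f"
    obtain M where M: "\<And>x. \<bar>f x\<bar> \<le> M" using assms(4) by (auto simp: bounded_iff)
    have "0 \<le> M" using M[of undefined] by linarith
    \<comment> \<open>Adding 1 keeps the bound positive when \<open>M\<close> is 0; the shift by
      \<open>M\<close> makes \<open>f\<close> nonnegative and is undone by the constant of the
      alternating sum.\<close>
    then have "0 < 2 * M + 1" by simp
    moreover have "0 \<le> M + f x \<and> M + f x \<le> 2 * M + 1" for x using M[of x] \<open>0 \<le> M\<close> by linarith
    moreover have "approximable \<Lambda> (\<lambda>x. M + f x)"
      using \<open>approximable \<Lambda> f\<close> approximable_shift by simp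
    ultimately obtain F where F: "dec_seq F" "\<And>\<eta>. \<eta> < ?w \<Longrightarrow> upper (F \<eta>)" "\<And>\<eta> x. F \<eta> x \<le> 2 * (2 * M + 1)"
      "\<And>x \<epsilon>. 0 < \<epsilon> \<Longrightarrow> \<exists>\<eta><?w. \<forall>\<theta>>\<eta>. F \<theta> x < \<epsilon>" "\<And>x. M + f x = altsum F ?w x"
      using altsum_representation[OF _ _ _ \<Lambda>, of "\<lambda>x. M + f x" "2 * M + 1"] by blast
    have "((\<lambda>\<eta>. F \<eta> x) \<longlongrightarrow> 0) (at_left ?w)" for x
    proof (rule order_tendstoI)
      show "eventually (\<lambda>\<eta>. a < F \<eta> x) (at_left ?w)" if "a < 0" for a
        using less_le_trans[OF that dec_seq_nonneg[OF F(1)]] by simp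
      show "eventually (\<lambda>\<eta>. F \<eta> x < a) (at_left ?w)" if "0 < a" for a
        unfolding at_left[OF w(1)] using F(4)[OF that] by blast
    qed
    moreover have "bounded (range (F \<eta>))" for \<eta>
      unfolding bounded_iff using F(3) dec_seq_nonneg[OF F(1)]
      by (intro exI[of _ "2 * (2 * M + 1)"]) auto
    ultimately have "DUSB \<xi> ?w F"
      unfolding DUSB_def upper_iff[symmetric]
      by (intro conjI allI impI w(2) dec_seqD[OF F(1)] dec_seq_nonneg[OF F(1)] F(2))
    moreover have "f x = - M + altsum F ?w x" for x using F(5)[of x] by simp
    ultimately show ?L unfolding iff by blast
  qed
qed

theorem theorem3p9:
  fixes f :: "'a::polish_space \<Rightarrow> real" and \<xi> \<Lambda> :: ordinal
  assumes "uncountable (UNIV :: 'a set)"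
    and "1 \<le> \<xi>" and "\<xi> < \<omega>\<^sub>1"
    and "bounded (range f)" and "baire_class \<xi> f"
    and "1 \<le> \<Lambda>" and "\<Lambda> < \<omega>\<^sub>1"
  shows "f \<in> bounded_baire_rank \<xi> \<Lambda> \<longleftrightarrow> altsum_length \<xi> f \<le> omega_pow \<Lambda>"
proof -
  have "0 < \<Lambda>"
    using less_osuc[OF zero_less_omega1] \<open>1 \<le> \<Lambda>\<close> unfolding one_ordinal_def by simp
  then have "alpha_rank \<xi> f \<le> omega_pow \<Lambda> \<longleftrightarrow> altsum_length \<xi> f \<le> omega_pow \<Lambda>"
    using alpha_rank_le_iff altsum_length_le_iff assms by blast
  then show ?thesis using assms by (simp add: bounded_baire_rank_def)
qed

end
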